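(* Let $\Delta\subseteq\mathbb{R}^n$ be an $n$-dimensional simple lattice polytope with $d$ facets, written as $\Delta=\{x:\langle u_i,x\rangle\le c_i,\ i=1,\ldots,d\}$ with $c_i\in\mathbb{Z}$ and $u_i\in(\mathbb{Z}^n)^*$ the primitive outward normal to the $i$-th facet, and let $\Delta_h=\{x:\langle u_i,x\rangle\le c_i+h_i,\ i=1,\ldots,d\}$ for $h\in\mathbb{R}^d$. Then for every $f\in C^\infty_0(\mathbb{R}^n)$, $$\frac1{N^n}\sum_{k\in\mathbb{Z}^n\cap N\Delta}f\!\left(\frac kN\right)=\left(\sum_F\sum_{\gamma\in\Gamma^\sharp_F}\tau_\gamma\!\left(\frac1N\frac{\partial}{\partial h}\right)\int_{\Delta_h}f(x)\,dx\right)(h=0)\quad\bmod O(N^{-\infty}),$$ where $F$ ranges over the subsets of $\{1,\ldots,d\}$ corresponding to faces of $\Delta$ (including $F=\emptyset$, corresponding to $\Delta$ itself).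
   Context: Simplicity: each codimension-$k$ face of $\Delta$ is the intersection of exactly $k$ facets, so faces correspond to subsets $F\subseteq\{1,\ldots,d\}$ (the face being $\{x\in\Delta:\langle u_i,x\rangle=c_i,\ i\in F\}$). For such $F$ let $U_F=\operatorname{span}_{\mathbb{R}}\{u_i:i\in F\}$, $\mathbb{Z}_F=\operatorname{span}_{\mathbb{Z}}\{u_i:i\in F\}$, and $\Gamma_F=(U_F\cap(\mathbb{Z}^n)^* )/\mathbb{Z}_F$, a finite group; for $E\subseteq F$, $\Gamma_E\subseteq\Gamma_F$. $\Gamma_F^\sharp$ is the set of elements of $\Gamma_F$ not contained in $\Gamma_E$ for any proper subset $E\subsetneq F$. For $\gamma\in\Gamma_F$ write a representative as $\sum_{i\in F}a_iu_i$ ($a_i\in\mathbb{Q}$, well defined mod $\mathbb{Z}$), set $\omega_i=e^{2\pi i a_i}$ for $i\in F$ and $\omega_i=1$ for $i\notin F$, and $\tau_\gamma(s_1,\ldots,s_d)=\prod_{i=1}^d\tau_{\omega_i}(s_i)$, where $\tau_\omega(s)=\frac{s}{1-\omega e^{-s}}$ (so $\tau_1$ is the Todd function $\frac{s}{1-e^{-s}}$). Meaning of the statement: expanding $\sum_F\sum_{\gamma\in\Gamma_F^\sharp}\tau_\gamma(s)=\sum_\alpha t_\alpha s^\alpha$ in Taylor series and setting $G(h)=\int_{\Delta_h}f\,dx$, for every $M$ the left side minus $\sum_{|\alpha|<M}t_\alpha N^{-|\alpha|}(\partial^\alpha_hG)(0)$ is $O(N^{-M})$ as $N\to\infty$. 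*)

theory Defs
  imports "HOL-Analysis.Analysis" "HOL-Library.Landau_Symbols"
begin

section \<open>Smooth functions and iterated partial derivatives\<close>

definition partial_deriv :: "'k \<Rightarrow> (real ^ 'k \<Rightarrow> 'b) \<Rightarrow> real ^ 'k \<Rightarrow> 'b::real_normed_vector"
  where "partial_deriv i g x = vector_derivative (\<lambda>t. g (x + t *\<^sub>R axis i 1)) (at 0)"

text \<open>Asking every iterated partial derivative to be (Frechet) differentiable everywhere also makes
  each of them continuous, so this is the usual class of infinitely differentiable functions.\<close>

definition smooth :: "(real ^ 'k \<Rightarrow> 'b::real_normed_vector) \<Rightarrow> bool"
  where "smooth g \<longleftrightarrow> (\<forall>is x. foldr partial_deriv is g differentiable (at x))"

definition smooth_compact_support :: "(real ^ 'k \<Rightarrow> 'b::real_normed_vector) \<Rightarrow> bool"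
  where "smooth_compact_support g \<longleftrightarrow> smooth g \<and> compact (closure {x. g x \<noteq> 0})"

text \<open>The derivative for a multi-index \<open>\<alpha>\<close>, with \<open>\<alpha> i\<close> derivatives in direction \<open>i\<close>. The linear order on
  the index type only fixes the order of the factors, which is immaterial where \<open>g\<close> is smooth.\<close>

definition multi_deriv ::
  "('d::{finite,linorder} \<Rightarrow> nat) \<Rightarrow> (real ^ 'd::{finite,linorder} \<Rightarrow> 'b) \<Rightarrow>
    real ^ 'd::{finite,linorder} \<Rightarrow> 'b::real_normed_vector"
  where "multi_deriv \<alpha> g = foldr (\<lambda>i. partial_deriv i ^^ \<alpha> i) (sorted_list_of_set UNIV) g"

definition taylor_coeff :: "(real ^ 'd::{finite,linorder} \<Rightarrow> complex) \<Rightarrow>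
  ('d::{finite,linorder} \<Rightarrow> nat) \<Rightarrow> complex"
  where "taylor_coeff g \<alpha> = multi_deriv \<alpha> g 0 / (\<Prod>i\<in>UNIV. fact (\<alpha> i))"

section \<open>Simple lattice polytopes\<close>

text \<open>The dual lattice is identified with the integer lattice through the standard inner product.\<close>

definition int_lattice :: "(real ^ 'n) set"
  where "int_lattice = {x. \<forall>j. x $ j \<in> \<int>}"

definition primitive_vector :: "real ^ 'n \<Rightarrow> bool"
  where "primitive_vector v \<longleftrightarrow>
    v \<in> int_lattice \<and> (\<forall>w\<in>int_lattice. \<forall>m::nat. v = real m *\<^sub>R w \<longrightarrow> m = 1)"

definition lattice_polytope :: "(real ^ 'n) set \<Rightarrow> bool"
  where "lattice_polytope P \<longleftrightarrow> (\<exists>V. finite V \<and> V \<subseteq> int_lattice \<and> P = convex hull V)"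

text \<open>A face of codimension \<open>k\<close> lies in exactly \<open>k\<close> facets and is their intersection (which is
  read as \<open>P\<close> itself when \<open>k = 0\<close>).\<close>

definition simple_polytope :: "(real ^ 'n) set \<Rightarrow> bool"
  where "simple_polytope P \<longleftrightarrow> polytope P \<and>
    (\<forall>G. G face_of P \<and> G \<noteq> {} \<longrightarrow>
       int (card {S. S facet_of P \<and> G \<subseteq> S}) = aff_dim P - aff_dim G \<and>
       G = P \<inter> \<Inter> {S. S facet_of P \<and> G \<subseteq> S})"

definition polyhedron_of :: "('d \<Rightarrow> real ^ 'n) \<Rightarrow> ('d \<Rightarrow> real) \<Rightarrow> (real ^ 'n) set"
  where "polyhedron_of u b = {x. \<forall>i. u i \<bullet> x \<le> b i}"

definition face_at :: "('d \<Rightarrow> real ^ 'n) \<Rightarrow> ('d \<Rightarrow> real) \<Rightarrow> 'd set \<Rightarrow> (real ^ 'n) set"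
  where "face_at u b F = {x \<in> polyhedron_of u b. \<forall>i\<in>F. u i \<bullet> x = b i}"

text \<open>For a simple polytope whose facets are the sets \<open>face_at u b {i}\<close>, the map \<open>F \<mapsto> face_at u b F\<close>
  is a bijection from this collection onto the non-empty faces, \<open>card F\<close> being the codimension.\<close>

definition face_subsets :: "('d \<Rightarrow> real ^ 'n) \<Rightarrow> ('d \<Rightarrow> real) \<Rightarrow> 'd set set"
  where "face_subsets u b = {F. face_at u b F \<noteq> {}}"

section \<open>The groups attached to the faces\<close>

definition int_span :: "('d \<Rightarrow> real ^ 'n) \<Rightarrow> 'd set \<Rightarrow> (real ^ 'n) set"
  where "int_span u F = {\<Sum>i\<in>F. real_of_int (m i) *\<^sub>R u i | m. True}"

definition span_lattice :: "('d \<Rightarrow> real ^ 'n) \<Rightarrow> 'd set \<Rightarrow> (real ^ 'n) set"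
  where "span_lattice u F = span (u ` F) \<inter> int_lattice"

definition coset_rel :: "('d \<Rightarrow> real ^ 'n) \<Rightarrow> 'd set \<Rightarrow> (real ^ 'n) rel"
  where "coset_rel u F =
    {(v, w). v \<in> span_lattice u F \<and> w \<in> span_lattice u F \<and> v - w \<in> int_span u F}"

definition Gamma :: "('d \<Rightarrow> real ^ 'n) \<Rightarrow> 'd set \<Rightarrow> (real ^ 'n) set set"
  where "Gamma u F = span_lattice u F // coset_rel u F"

text \<open>The inclusion of \<open>Gamma u E\<close> into \<open>Gamma u F\<close>, for \<open>E \<subseteq> F\<close>, sends a coset of \<open>int_span u E\<close> to the
  coset of \<open>int_span u F\<close> that contains it.\<close>

definition Gamma_incl :: "('d \<Rightarrow> real ^ 'n) \<Rightarrow> 'd set \<Rightarrow> (real ^ 'n) set \<Rightarrow> (real ^ 'n) set"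
  where "Gamma_incl u F \<delta> = coset_rel u F `` \<delta>"

definition Gamma_sharp :: "('d \<Rightarrow> real ^ 'n) \<Rightarrow> 'd set \<Rightarrow> (real ^ 'n) set set"
  where "Gamma_sharp u F = {\<gamma> \<in> Gamma u F. \<forall>E. E \<subset> F \<longrightarrow> \<gamma> \<notin> Gamma_incl u F ` Gamma u E}"

text \<open>When the \<open>u i\<close>, \<open>i \<in> F\<close>, are linearly independent, the chosen coefficients are unique up to
  integers, so \<open>omega\<close> does not depend on the choice.\<close>

definition rep_coeffs :: "('d \<Rightarrow> real ^ 'n) \<Rightarrow> 'd set \<Rightarrow> (real ^ 'n) set \<Rightarrow> 'd \<Rightarrow> real"
  where "rep_coeffs u F \<gamma> = (SOME a. (\<forall>i\<in>F. a i \<in> \<rat>) \<and> (\<Sum>i\<in>F. a i *\<^sub>R u i) \<in> \<gamma>)"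

definition omega :: "('d \<Rightarrow> real ^ 'n) \<Rightarrow> 'd set \<Rightarrow> (real ^ 'n) set \<Rightarrow> 'd \<Rightarrow> complex"
  where "omega u F \<gamma> i =
    (if i \<in> F then exp (2 * complex_of_real pi * \<i> * complex_of_real (rep_coeffs u F \<gamma> i)) else 1)"

section \<open>Todd functions\<close>

text \<open>The singularity of \<open>s / (1 - exp (- s))\<close> at \<open>0\<close> is removable, with value \<open>1\<close>.\<close>

definition tau :: "complex \<Rightarrow> complex \<Rightarrow> complex"
  where "tau \<omega> s = (if \<omega> = 1 \<and> s = 0 then 1 else s / (1 - \<omega> * exp (- s)))"

text \<open>Real arguments suffice, as only the Taylor coefficients at \<open>0\<close> are used.\<close>

definition tau_gamma ::
  "('d::finite \<Rightarrow> real ^ 'n) \<Rightarrow> 'd::finite set \<Rightarrow> (real ^ 'n) set \<Rightarrow> real ^ 'd::finite \<Rightarrow> complex"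
  where "tau_gamma u F \<gamma> s = (\<Prod>i\<in>UNIV. tau (omega u F \<gamma> i) (complex_of_real (s $ i)))"

definition todd_symbol ::
  "('d::finite \<Rightarrow> real ^ 'n) \<Rightarrow> ('d::finite \<Rightarrow> real) \<Rightarrow> real ^ 'd::finite \<Rightarrow> complex"
  where "todd_symbol u b s = (\<Sum>F\<in>face_subsets u b. \<Sum>\<gamma>\<in>Gamma_sharp u F. tau_gamma u F \<gamma> s)"

end

theory Submission
  imports Defs "HOL-Complex_Analysis.Complex_Analysis"
begin

unbundle no fps_syntax

text \<open>
  Cutoff functions of the quantities \<open>c i - u i \<bullet> x\<close> decompose \<open>f\<close> into pieces, one for each set \<open>S\<close> of
  facets, supported near these facets and away from all others. If \<open>S\<close> cuts out no face, then both
  sides vanish. Otherwise the polytope may be replaced by the cone at a vertex of that face.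
  By orthogonality of characters the sum over the lattice points of the cone is an average over the
  finite group of the vertex of sums over \<open>\<nat>\<^sup>n\<close>, twisted by roots of unity. The twisted Euler-Maclaurin
  formula in one variable follows from \<open>\<tau>\<^sub>\<omega> s * (1 - \<omega> * exp (- s)) = s\<close> by telescoping, and is applied to
  one edge direction after the other. It produces derivatives of the iterated primitive of \<open>f\<close> along the
  edges; its leading order identifies this primitive with the integral over the shifted cone,
  so that no Jacobian needs to be computed. Finally, the group of the vertex is the disjoint union of the
  sets \<open>Gamma_sharp\<close> of the faces through it, while the other faces do not contribute.
\<close>

section \<open>Directional derivatives and functions of class C^k\<close>

text \<open>For a fixed order \<open>M\<close> only finitely many derivatives matter, so everything
  runs in the classes \<open>Ck k\<close>: the cutoffs may be piecewise polynomial, and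
  \<open>f\<close> is cut anew for each \<open>M\<close>. The integral over the shifted polytope is
  not differentiated directly as a function of \<open>h\<close>. Near \<open>h = 0\<close> it is a
  sum of functions of class \<open>Ck M\<close>, one for each piece, and derivatives at 0 only see
  this local form. For a cone, shifting the \<open>i\<close>-th hyperplane by \<open>h $ i\<close>
  moves the apex by \<open>- h $ i\<close> times the edge vector \<open>e i\<close>, so a derivative
  in \<open>h\<close> is minus a derivative along an edge. This sign turns the arguments
  \<open>- 1 / N\<close> of the one-variable formula into the \<open>1 / N\<close> of the theorem.
  Primitives taken forward along the edges lose compact support, but only backwards; on the cone
  everything stays bounded. Hence the error bounds are uniform over all base points in the cone,
  which is also what the induction over the edges needs. Derivatives are always taken in the order
  of the index type, so mixed derivatives never have to be interchanged.\<close>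

definition dir_deriv :: "'a \<Rightarrow> ('a::real_normed_vector \<Rightarrow> 'b) \<Rightarrow> 'a \<Rightarrow> 'b::real_normed_vector"
  where "dir_deriv w f x = vector_derivative (\<lambda>t. f (x + t *\<^sub>R w)) (at 0)"

text \<open>The derivative enters only through its values in fixed directions, so the recursion
  stays within functions of one type and never meets multilinear maps. In finite dimension this is
  the usual class C^k.\<close>

primrec Ck :: "nat \<Rightarrow> ('a::real_normed_vector \<Rightarrow> 'b::real_normed_vector) \<Rightarrow> bool"
  where
    "Ck 0 f \<longleftrightarrow> continuous_on UNIV f"
  | "Ck (Suc k) f \<longleftrightarrow> (\<forall>x. f differentiable (at x)) \<and> (\<forall>w. Ck k (dir_deriv w f))"

lemma has_derivative_imp_dir_deriv:
  assumes "(f has_derivative f') (at x)"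
  shows "((\<lambda>t. f (x + t *\<^sub>R w)) has_vector_derivative f' w) (at 0)"
    and "dir_deriv w f x = f' w"
proof -
  have "((\<lambda>t. x + t *\<^sub>R w) has_vector_derivative w) (at 0)"
    by (auto intro!: derivative_eq_intros)
  then have "((f \<circ> (\<lambda>t. x + t *\<^sub>R w)) has_vector_derivative f' w) (at 0)"
    by (rule vector_derivative_diff_chain_within) (use assms in \<open>auto intro: has_derivative_at_withinI\<close>)
  then show 1: "((\<lambda>t. f (x + t *\<^sub>R w)) has_vector_derivative f' w) (at 0)"
    by (simp add: o_def)
  then show "dir_deriv w f x = f' w"
    unfolding dir_deriv_def by (rule vector_derivative_at)
qed

lemma has_derivative_dir_deriv:
  assumes "f differentiable (at x)"
  shows "(f has_derivative (\<lambda>w. dir_deriv w f x)) (at x)"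
proof -
  obtain f' where f': "(f has_derivative f') (at x)"
    using assms by (auto simp: differentiable_def)
  then have "(\<lambda>w. dir_deriv w f x) = f'"
    using has_derivative_imp_dir_deriv(2) by blast
  with f' show ?thesis by simp
qed

lemma has_vector_derivative_dir_deriv:
  assumes "f differentiable (at (x + t *\<^sub>R w))"
  shows "((\<lambda>t. f (x + t *\<^sub>R w)) has_vector_derivative dir_deriv w f (x + t *\<^sub>R w)) (at t)"
proof -
  have "((\<lambda>t. x + t *\<^sub>R w) has_vector_derivative w) (at t)"
    by (auto intro!: derivative_eq_intros)
  then have "((f \<circ> (\<lambda>t. x + t *\<^sub>R w)) has_vector_derivative dir_deriv w f (x + t *\<^sub>R w)) (at t)"
    by (rule vector_derivative_diff_chain_within)
      (use has_derivative_dir_deriv[OF assms] in \<open>auto intro: has_derivative_at_withinI\<close>)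
  then show ?thesis by (simp add: o_def)
qed

lemma dir_deriv_zero [simp]: "dir_deriv 0 f = (\<lambda>x. 0)"
  by (simp add: dir_deriv_def fun_eq_iff)

lemma dir_deriv_comp_affine:
  assumes "linear L"
  shows "dir_deriv w (\<lambda>x. f (a + L x)) = (\<lambda>x. dir_deriv (L w) f (a + L x))"
  by (simp add: dir_deriv_def fun_eq_iff linear_add[OF assms] linear_scale[OF assms] add.assoc)

lemma dir_deriv_cong_open:
  assumes "open U" "\<And>x. x \<in> U \<Longrightarrow> f x = g x" "x \<in> U"
  shows "dir_deriv w f x = dir_deriv w g x"
proof -
  have "((\<lambda>t. x + t *\<^sub>R w) \<longlongrightarrow> x + 0 *\<^sub>R w) (at 0)"
    by (intro tendsto_intros)
  then have "\<forall>\<^sub>F t in at 0. x + t *\<^sub>R w \<in> U"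
    using assms(1,3) by (simp add: topological_tendstoD)
  then have "\<forall>\<^sub>F t in nhds 0. f (x + t *\<^sub>R w) = g (x + t *\<^sub>R w)"
    using assms by (auto simp: eventually_at_filter elim!: eventually_mono)
  then show ?thesis
    unfolding dir_deriv_def by (intro vector_derivative_cong_eq) auto
qed

lemma Ck_dir_deriv: "Ck (Suc k) f \<Longrightarrow> Ck k (dir_deriv w f)"
  by simp

lemma Ck_Suc_D: "Ck (Suc k) f \<Longrightarrow> Ck k f"
proof (induction k arbitrary: f)
  case 0
  then show ?case
    by (auto simp: continuous_on_eq_continuous_at intro: differentiable_imp_continuous_within)
next
  case (Suc k)
  have "Ck k (dir_deriv w f)" for w
    by (rule Suc.IH) (rule Ck_dir_deriv[OF Suc.prems])
  moreover have "f differentiable (at x)" for x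
    using Suc.prems by simp
  ultimately show ?case
    unfolding Ck.simps(2) by blast
qed

lemma Ck_mono: "Ck m f \<Longrightarrow> k \<le> m \<Longrightarrow> Ck k f"
  by (induction m rule: nat_induct) (auto simp: le_Suc_eq simp del: Ck.simps dest: Ck_Suc_D)

lemma Ck_imp_continuous: "Ck k f \<Longrightarrow> continuous_on UNIV f"
  using Ck_mono[of k f 0] by simp

lemma Ck_SucI:
  assumes "\<And>x. (f has_derivative f' x) (at x)" "\<And>w. Ck k (\<lambda>x. f' x w)"
  shows "Ck (Suc k) f"
proof -
  have "dir_deriv w f = (\<lambda>x. f' x w)" for w
    using has_derivative_imp_dir_deriv(2)[OF assms(1)] by blast
  then show ?thesis
    using assms by (auto simp: differentiable_def)
qed

lemma Ck_SucE:
  assumes "Ck (Suc k) f"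
  obtains f' where "\<And>x. (f has_derivative f' x) (at x)" "\<And>w. Ck k (\<lambda>x. f' x w)"
proof
  show "(f has_derivative (\<lambda>w. dir_deriv w f x)) (at x)" for x
    using assms by (intro has_derivative_dir_deriv) simp
  show "Ck k (\<lambda>x. dir_deriv w f x)" for w
    using Ck_dir_deriv[OF assms] .
qed

lemma dir_deriv_const: "dir_deriv w (\<lambda>x. c) = (\<lambda>x. 0)"
  by (simp add: dir_deriv_def fun_eq_iff)

lemma Ck_const [simp]: "Ck k (\<lambda>x. c)"
  by (induction k arbitrary: c) (auto simp: dir_deriv_const)

lemma Ck_add:
  assumes "Ck k f" "Ck k g"
  shows "Ck k (\<lambda>x. f x + g x)"
  using assms
proof (induction k arbitrary: f g)
  case 0
  then show ?case by (auto intro: continuous_on_add)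
next
  case (Suc k)
  obtain f' g' where "\<And>x. (f has_derivative f' x) (at x)" "\<And>w. Ck k (\<lambda>x. f' x w)"
    "\<And>x. (g has_derivative g' x) (at x)" "\<And>w. Ck k (\<lambda>x. g' x w)"
    using Suc.prems by (elim Ck_SucE) blast
  then show ?case
    by (intro Ck_SucI[where f' = "\<lambda>x w. f' x w + g' x w"] derivative_intros Suc.IH) auto
qed

lemma Ck_sum:
  assumes "\<And>i. i \<in> A \<Longrightarrow> Ck k (f i)"
  shows "Ck k (\<lambda>x. \<Sum>i\<in>A. f i x)"
  using assms by (induction A rule: infinite_finite_induct) (auto intro: Ck_add)

lemma Ck_bounded_bilinear:
  assumes "bounded_bilinear prd" "Ck k f" "Ck k g"
  shows "Ck k (\<lambda>x. prd (f x) (g x))"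
  using assms(2,3)
proof (induction k arbitrary: f g)
  case 0
  then show ?case
    by (auto intro: bounded_bilinear.continuous_on[OF assms(1)])
next
  case (Suc k)
  obtain f' g' where d: "\<And>x. (f has_derivative f' x) (at x)" "\<And>w. Ck k (\<lambda>x. f' x w)"
    "\<And>x. (g has_derivative g' x) (at x)" "\<And>w. Ck k (\<lambda>x. g' x w)"
    using Suc.prems by (elim Ck_SucE) blast
  show ?case
    by (intro Ck_SucI[where f' = "\<lambda>x w. prd (f x) (g' x w) + prd (f' x w) (g x)"]
        bounded_bilinear.FDERIV[OF assms(1)] Ck_add Suc.IH d Ck_Suc_D[OF Suc.prems(1)]
        Ck_Suc_D[OF Suc.prems(2)])
qed

lemma Ck_mult:
  fixes f g :: "'a::real_normed_vector \<Rightarrow> 'b::real_normed_algebra"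
  shows "Ck k f \<Longrightarrow> Ck k g \<Longrightarrow> Ck k (\<lambda>x. f x * g x)"
  by (rule Ck_bounded_bilinear[OF bounded_bilinear_mult])

lemma Ck_scaleR: "Ck k f \<Longrightarrow> Ck k g \<Longrightarrow> Ck k (\<lambda>x. f x *\<^sub>R g x)"
  by (rule Ck_bounded_bilinear[OF bounded_bilinear_scaleR])

lemma Ck_diff:
  assumes "Ck k f" "Ck k g"
  shows "Ck k (\<lambda>x. f x - g x)"
  using Ck_add[OF assms(1) Ck_scaleR[OF Ck_const[of k "-1"] assms(2)]] by simp

lemma Ck_prod:
  fixes f :: "'i \<Rightarrow> 'a::real_normed_vector \<Rightarrow> 'b::{real_normed_algebra,comm_ring_1}"
  assumes "\<And>i. i \<in> A \<Longrightarrow> Ck k (f i)"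
  shows "Ck k (\<lambda>x. \<Prod>i\<in>A. f i x)"
  using assms by (induction A rule: infinite_finite_induct) (auto intro: Ck_mult)

lemma Ck_comp_affine:
  assumes "bounded_linear L" "Ck k f"
  shows "Ck k (\<lambda>x. f (a + L x))"
  using assms(2)
proof (induction k arbitrary: f)
  case 0
  then show ?case
    using assms(1)
    by (auto intro!: continuous_on_compose2[of UNIV f] continuous_intros
        simp: linear_continuous_on)
next
  case (Suc k)
  interpret bounded_linear L by fact
  obtain f' where d: "\<And>x. (f has_derivative f' x) (at x)" "\<And>w. Ck k (\<lambda>x. f' x w)"
    using Suc.prems by (elim Ck_SucE) blast
  have "((\<lambda>x. f (a + L x)) has_derivative (\<lambda>w. f' (a + L x) (L w))) (at x)" for x
  proof -
    have "((\<lambda>x. a + L x) has_derivative L) (at x)"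
      by (auto intro!: derivative_eq_intros has_derivative)
    from has_derivative_compose[OF this d(1)] show ?thesis .
  qed
  then show ?case
    by (rule Ck_SucI) (rule Suc.IH, rule d)
qed

lemma Ck_shift: "Ck k f \<Longrightarrow> Ck k (\<lambda>x. f (a + x))"
  using Ck_comp_affine[OF bounded_linear_ident] .

text \<open>The outer function has a real argument, so its derivative acts by scalar multiplication
  and the chain rule yields a product of two functions of class \<open>Ck k\<close>. The cutoffs are
  composed in this way.\<close>

lemma Ck_comp_real:
  fixes g :: "real \<Rightarrow> 'b::real_normed_vector"
  assumes "Ck k g" "Ck k f"
  shows "Ck k (\<lambda>x. g (f x))"
  using assms
proof (induction k arbitrary: f g)
  case 0
  then show ?case
    by (auto intro: continuous_on_compose2[of UNIV g])
next
  case (Suc k)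
  obtain f' where f': "\<And>x. (f has_derivative f' x) (at x)" "\<And>w. Ck k (\<lambda>x. f' x w)"
    using Suc.prems(2) by (elim Ck_SucE) blast
  obtain g' where g': "\<And>x. (g has_derivative g' x) (at x)" "\<And>w. Ck k (\<lambda>x. g' x w)"
    using Suc.prems(1) by (elim Ck_SucE) blast
  have lin: "g' y s = s *\<^sub>R g' y 1" for y s
    using linear_scale[OF has_derivative_linear[OF g'(1)], of y s 1] by simp
  have "((\<lambda>x. g (f x)) has_derivative (\<lambda>w. f' x w *\<^sub>R g' (f x) 1)) (at x)" for x
    using has_derivative_compose[OF f'(1) g'(1), of x] by (subst (asm) lin)
  then show ?case
    by (rule Ck_SucI) (intro Ck_scaleR f' Suc.IH g' Ck_Suc_D[OF Suc.prems(2)])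
qed

lemma Ck_bounded_linear_comp:
  assumes "bounded_linear L" "Ck k f"
  shows "Ck k (\<lambda>x. L (f x))"
  using assms(2)
proof (induction k arbitrary: f)
  case 0
  then show ?case
    using assms(1) by (auto intro: bounded_linear.continuous_on)
next
  case (Suc k)
  obtain f' where f': "\<And>x. (f has_derivative f' x) (at x)" "\<And>w. Ck k (\<lambda>x. f' x w)"
    using Suc.prems by (elim Ck_SucE) blast
  show ?case
    by (intro Ck_SucI[where f' = "\<lambda>x w. L (f' x w)"] bounded_linear.has_derivative[OF assms(1)]
        f' Suc.IH)
qed

lemma partial_deriv_eq_dir_deriv: "partial_deriv i = dir_deriv (axis i 1)"
  by (simp add: partial_deriv_def dir_deriv_def fun_eq_iff)

text \<open>\<open>smooth\<close> speaks of the coordinate directions only. Since \<open>g\<close>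
  is differentiable, its derivative in any direction is a linear combination of partial derivatives,
  and these are smooth again.\<close>

lemma smooth_imp_Ck:
  fixes g :: "real ^ 'k \<Rightarrow> 'b::real_normed_vector"
  assumes "smooth g"
  shows "Ck k g"
  using assms
proof (induction k arbitrary: g)
  case 0
  then have "g differentiable (at x)" for x
    unfolding smooth_def by (metis foldr.simps(1) id_apply)
  then show ?case
    by (auto simp: continuous_on_eq_continuous_at intro: differentiable_imp_continuous_within)
next
  case (Suc k)
  have diff: "g differentiable (at x)" for x
    using Suc.prems unfolding smooth_def by (metis foldr.simps(1) id_apply)
  have "smooth (partial_deriv i g)" for i
  proof -
    have "foldr partial_deriv is (partial_deriv i g) differentiable (at x)" for "is" x
      using Suc.prems[unfolded smooth_def, rule_format, of "is @ [i]" x] by simp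
    then show ?thesis
      unfolding smooth_def by blast
  qed
  then have "Ck k (\<lambda>x. \<Sum>i\<in>UNIV. (w $ i) *\<^sub>R partial_deriv i g x)" for w :: "real ^ 'k"
    by (intro Ck_sum Ck_scaleR Ck_const Suc.IH)
  moreover have "dir_deriv w g = (\<lambda>x. \<Sum>i\<in>UNIV. (w $ i) *\<^sub>R partial_deriv i g x)" for w :: "real ^ 'k"
  proof
    fix x
    have lin: "linear (\<lambda>w. dir_deriv w g x)"
      using has_derivative_linear[OF has_derivative_dir_deriv[OF diff]] .
    have "dir_deriv w g x = dir_deriv (\<Sum>i\<in>UNIV. (w $ i) *\<^sub>R axis i 1) g x"
      by (simp add: basis_expansion flip: scalar_mult_eq_scaleR)
    also have "\<dots> = (\<Sum>i\<in>UNIV. (w $ i) *\<^sub>R partial_deriv i g x)"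
      by (simp add: linear_sum[OF lin] linear_scale[OF lin] partial_deriv_eq_dir_deriv)
    finally show "dir_deriv w g x = (\<Sum>i\<in>UNIV. (w $ i) *\<^sub>R partial_deriv i g x)" .
  qed
  ultimately show ?case
    using diff by simp
qed

section \<open>Integration along a direction\<close>

text \<open>Where \<open>f\<close> vanishes at distance \<open>T\<close> along \<open>w\<close>,
  minus this function is a primitive of \<open>f\<close> in direction \<open>w\<close>.\<close>

definition line_int :: "real \<Rightarrow> 'a::real_normed_vector \<Rightarrow> ('a \<Rightarrow> 'b) \<Rightarrow> 'a \<Rightarrow> 'b::banach"
  where "line_int T w f x = integral {0..T} (\<lambda>t. f (x + t *\<^sub>R w))"

lemma has_derivative_line_int:
  fixes f :: "'a::euclidean_space \<Rightarrow> 'b::banach"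
  assumes "Ck (Suc 0) f"
  shows "(line_int T w f has_derivative (\<lambda>v. line_int T w (dir_deriv v f) x)) (at x)"
proof -
  have diff: "f differentiable (at y)" for y
    using assms by simp
  have cont: "continuous_on UNIV (dir_deriv v f)" for v
    using assms by simp
  have contf: "continuous_on UNIV f"
    using Ck_imp_continuous[OF assms] .
  have bl: "bounded_linear (\<lambda>v. dir_deriv v f y)" for y
    using has_derivative_bounded_linear[OF has_derivative_dir_deriv[OF diff]] .
  \<comment> \<open>The rule for differentiating under the integral sign wants the derivative as a
    jointly continuous family of bounded linear maps; its continuity can be tested direction by
    direction.\<close>
  define F where "F y t = Blinfun (\<lambda>v. dir_deriv v f (y + t *\<^sub>R w))" for y t
  have F: "blinfun_apply (F y t) = (\<lambda>v. dir_deriv v f (y + t *\<^sub>R w))" for y t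
    unfolding F_def by (rule bounded_linear_Blinfun_apply[OF bl])
  have contF: "continuous_on (UNIV \<times> cbox 0 T) (\<lambda>(y, t). F y t)"
    by (rule continuous_on_blinfun_componentwise)
      (auto simp: F split_beta intro!: continuous_on_compose2[OF cont] continuous_intros)
  have integ: "F x integrable_on cbox 0 T"
  proof (rule integrable_continuous)
    have "continuous_on (cbox 0 T) (\<lambda>t. (x, t))"
      by (intro continuous_intros)
    from continuous_on_compose2[OF contF this] show "continuous_on (cbox 0 T) (F x)"
      by auto
  qed
  have "((\<lambda>y. integral (cbox 0 T) (\<lambda>t. f (y + t *\<^sub>R w))) has_derivative
      blinfun_apply (integral (cbox 0 T) (F x))) (at x within UNIV)"
  proof (rule leibniz_rule)
    show "((\<lambda>y. f (y + t *\<^sub>R w)) has_derivative blinfun_apply (F y t)) (at y within UNIV)"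
      for y t
    proof -
      have "((\<lambda>y. y + t *\<^sub>R w) has_derivative (\<lambda>v. v)) (at y)"
        by (auto intro!: derivative_eq_intros)
      from has_derivative_compose[OF this has_derivative_dir_deriv[OF diff]]
      show ?thesis by (simp add: F)
    qed
    show "(\<lambda>t. f (y + t *\<^sub>R w)) integrable_on cbox 0 T" for y
      by (intro integrable_continuous continuous_on_compose2[OF contf]) (auto intro!: continuous_intros)
  qed (use contF in auto)
  moreover have "blinfun_apply (integral (cbox 0 T) (F x)) = (\<lambda>v. line_int T w (dir_deriv v f) x)"
    using integ by (auto simp: line_int_def F fun_eq_iff blinfun_apply_integral)
  moreover have "line_int T w f = (\<lambda>y. integral (cbox 0 T) (\<lambda>t. f (y + t *\<^sub>R w)))"
    by (simp add: line_int_def fun_eq_iff)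
  ultimately show ?thesis
    by simp
qed

lemma dir_deriv_line_int:
  fixes f :: "'a::euclidean_space \<Rightarrow> 'b::banach"
  assumes "Ck (Suc 0) f"
  shows "dir_deriv v (line_int T w f) = line_int T w (dir_deriv v f)"
  using has_derivative_imp_dir_deriv(2)[OF has_derivative_line_int[OF assms]] by blast

lemma Ck_line_int:
  fixes f :: "'a::euclidean_space \<Rightarrow> 'b::banach"
  assumes "Ck k f"
  shows "Ck k (line_int T w f)"
  using assms
proof (induction k arbitrary: f)
  case 0
  have "continuous_on UNIV (\<lambda>x. integral (cbox 0 T) (\<lambda>t. f (x + t *\<^sub>R w)))"
    using 0 by (intro integral_continuous_on_param)
      (auto simp: split_beta intro!: continuous_on_compose2[of UNIV f] continuous_intros)
  then show ?case
    by (simp add: line_int_def[abs_def])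
next
  case (Suc k)
  have "Ck (Suc 0) f"
    by (rule Ck_mono[OF Suc.prems]) simp
  from has_derivative_line_int[OF this] show ?case
    by (rule Ck_SucI) (rule Suc.IH, rule Ck_dir_deriv[OF Suc.prems])
qed

lemma dir_deriv_line_int_same:
  fixes f :: "'a::euclidean_space \<Rightarrow> 'b::banach"
  assumes "Ck (Suc 0) f" "T \<ge> 0"
  shows "dir_deriv w (line_int T w f) x = f (x + T *\<^sub>R w) - f x"
proof -
  have "((\<lambda>t. dir_deriv w f (x + t *\<^sub>R w)) has_integral f (x + T *\<^sub>R w) - f (x + 0 *\<^sub>R w)) {0..T}"
    using assms by (intro fundamental_theorem_of_calculus)
      (auto intro!: has_vector_derivative_at_within[OF has_vector_derivative_dir_deriv])
  then show ?thesis
    using assms by (simp add: dir_deriv_line_int line_int_def integral_unique)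
qed

text \<open>Flattening the powers into one word of directions reduces statements about multi-indices
  to inductions over a list.\<close>

lemma foldr_dir_deriv_concat:
  fixes e :: "'a \<Rightarrow> 'b::real_normed_vector" and f :: "'b \<Rightarrow> 'c::real_normed_vector"
  shows
  "foldr (\<lambda>i. dir_deriv (e i) ^^ \<alpha> i) js f =
    foldr dir_deriv (concat (map (\<lambda>i. replicate (\<alpha> i) (e i)) js)) f"
proof (induction js arbitrary: f)
  case (Cons j js)
  have "foldr dir_deriv (replicate n v) g = (dir_deriv v ^^ n) g" for n v and g :: "'b \<Rightarrow> 'c"
    by (induction n) auto
  then show ?case
    using Cons by simp
qed simp

lemma length_concat_replicate:
  "length (concat (map (\<lambda>i. replicate (\<alpha> i) (e i)) js)) = sum_list (map \<alpha> js)"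
  by (induction js) auto

lemma Ck_foldr_dir_deriv:
  "Ck (k + length ws) f \<Longrightarrow> Ck k (foldr dir_deriv ws f)"
proof (induction ws arbitrary: k)
  case (Cons w ws)
  have "Ck (Suc k) (foldr dir_deriv ws f)"
    using Cons.prems by (intro Cons.IH) (simp del: Ck.simps)
  then show ?case
    by (simp del: Ck.simps add: Ck_dir_deriv)
qed simp

lemma foldr_dir_deriv_line_int:
  fixes f :: "'a::euclidean_space \<Rightarrow> 'b::banach"
  assumes "Ck (length ws) f"
  shows "foldr dir_deriv ws (line_int T w f) = line_int T w (foldr dir_deriv ws f)"
  using assms
proof (induction ws)
  case (Cons v ws)
  have "Ck (Suc 0) (foldr dir_deriv ws f)"
    using Cons.prems by (intro Ck_foldr_dir_deriv) (simp del: Ck.simps)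
  moreover have "Ck (length ws) f"
    by (rule Ck_mono[OF Cons.prems]) simp
  ultimately show ?case
    using Cons.IH by (simp add: dir_deriv_line_int del: Ck.simps)
qed simp

lemma Ck_foldr_line_int:
  fixes f :: "'a::euclidean_space \<Rightarrow> 'b::banach"
  shows "Ck k f \<Longrightarrow> Ck k (foldr (\<lambda>i. line_int T (e i)) js f)"
  by (induction js) (auto intro: Ck_line_int)

lemma line_int_shift: "line_int T w (\<lambda>x. f (a + x)) = (\<lambda>x. line_int T w f (a + x))"
  by (simp add: line_int_def fun_eq_iff add.assoc)

lemma foldr_line_int_shift:
  "foldr (\<lambda>i. line_int T (e i)) js (\<lambda>x. f (a + x)) = (\<lambda>x. foldr (\<lambda>i. line_int T (e i)) js f (a + x))"
  by (induction js) (auto simp: line_int_shift)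

section \<open>Taylor remainders and the power series of the Todd functions\<close>

lemma Taylor_remainder_bound:
  fixes \<psi> :: "nat \<Rightarrow> real \<Rightarrow> 'b::banach"
  assumes "\<And>l s. l < K \<Longrightarrow> (\<psi> l has_vector_derivative \<psi> (Suc l) s) (at s)"
    and "\<And>x. s \<le> x \<Longrightarrow> norm (\<psi> K x) \<le> C"
    and "\<epsilon> \<ge> 0" "l < K"
  shows "norm (\<psi> l (s + \<epsilon>) - (\<Sum>b<K - l. (\<epsilon> ^ b / fact b) *\<^sub>R \<psi> (l + b) s)) \<le> C * \<epsilon> ^ (K - l)"
proof -
  define p where "p = K - l"
  have C: "C \<ge> 0"
    using assms(2)[of s] norm_ge_zero[of "\<psi> K s"] by linarith
  have p: "p > 0" "l + p = K"
    using assms(4) by (auto simp: p_def)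
  have "((\<lambda>x. ((s + \<epsilon> - x) ^ (p - 1) / fact (p - 1)) *\<^sub>R \<psi> (l + p) x) has_integral
      \<psi> l (s + \<epsilon>) - (\<Sum>i<p. ((s + \<epsilon> - s) ^ i / fact i) *\<^sub>R \<psi> (l + i) s)) {s..s + \<epsilon>}"
    by (rule Taylor_has_integral[where Df = "\<lambda>m. \<psi> (l + m)"])
      (use p assms(1,3) in \<open>auto intro: has_vector_derivative_at_within\<close>)
  then have "norm (\<psi> l (s + \<epsilon>) - (\<Sum>i<p. ((s + \<epsilon> - s) ^ i / fact i) *\<^sub>R \<psi> (l + i) s))
      \<le> (\<epsilon> ^ (p - 1) * C) * measure lborel {s..s + \<epsilon>}"
  
  proof (rule has_integral_bound_real[where S = "{}", rotated 2, unfolded Diff_empty])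
    fix x assume x: "x \<in> {s..s + \<epsilon>}"
    \<comment> \<open>The factorial in the integral remainder is dropped: only the power of
      \<open>\<epsilon>\<close> matters.\<close>
    have "\<bar>(s + \<epsilon> - x) ^ (p - 1) / fact (p - 1)\<bar> \<le> \<epsilon> ^ (p - 1) / 1"
      using x unfolding abs_divide
      by (intro frac_le) (auto simp: power_abs intro!: power_mono fact_ge_1)
    then show "norm (((s + \<epsilon> - x) ^ (p - 1) / fact (p - 1)) *\<^sub>R \<psi> (l + p) x) \<le> \<epsilon> ^ (p - 1) * C"
      using assms(2)[of x] x p unfolding norm_scaleR by (intro mult_mono) auto
  qed (use C assms(3) in auto)
  also have "(\<epsilon> ^ (p - 1) * C) * measure lborel {s..s + \<epsilon>} = C * \<epsilon> ^ p"
    using assms(3) p by (cases p) auto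
  finally show ?thesis
    by (simp add: p_def)
qed

text \<open>A formal quotient, so that the defining identity can be used purely algebraically; the
  link with the function \<open>tau\<close> is \<open>tau_has_fps_expansion\<close>. It also covers
  \<open>\<omega> = 1\<close>, where the denominator has no constant term.\<close>

definition todd_coeff :: "complex \<Rightarrow> nat \<Rightarrow> complex"
  where "todd_coeff \<omega> = fps_nth (fps_X / (1 - fps_const \<omega> * fps_exp (- 1)))"

text \<open>The constant coefficient of the denominator is \<open>1 - \<omega>\<close>; if it
  vanishes, the next coefficient is \<open>\<omega> = 1\<close>. Hence the denominator divides
  \<open>fps_X\<close>.\<close>

lemma todd_denominator_facts:
  fixes \<omega> :: complex
  defines "G \<equiv> 1 - fps_const \<omega> * fps_exp (- 1)"
  shows "G \<noteq> 0" "subdegree G \<le> 1"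
proof -
  have "\<exists>n\<le>1. fps_nth G n \<noteq> 0"
    by (cases "\<omega> = 1") (auto simp: G_def intro: exI[of _ 1] exI[of _ 0])
  then show "G \<noteq> 0" "subdegree G \<le> 1"
    by (auto dest: subdegree_leI)
qed

text \<open>Coefficient \<open>k\<close> of the identity saying that the Todd series times its
  denominator is \<open>fps_X\<close>; the bracket is a coefficient of the denominator.\<close>

lemma todd_coeff_convolution:
  "(\<Sum>l\<le>k. todd_coeff \<omega> l * ((if k - l = 0 then 1 else 0) - \<omega> * (- 1) ^ (k - l) / fact (k - l)))
    = (if k = 1 then 1 else 0)"
proof -
  define G :: "complex fps" where "G = 1 - fps_const \<omega> * fps_exp (- 1)"
  have "fps_X / G * G = fps_X"
    using todd_denominator_facts[of \<omega>]
    by (intro dvd_div_mult_self) (simp add: fps_dvd_iff G_def subdegree_fps_X)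
  then have "fps_nth (fps_X / G * G) k = (if k = 1 then 1 else 0)"
    by simp
  then show ?thesis
    unfolding fps_mult_nth todd_coeff_def G_def[symmetric]
    by (simp add: G_def fps_exp_def atLeast0AtMost mult.assoc cong: if_cong)
qed

text \<open>Read off from the coefficients 0 and 1 of \<open>todd_coeff_convolution\<close>. This
  dichotomy leaves only the trivial character at leading order and later removes the faces that miss
  a given vertex.\<close>

lemma todd_coeff_0: "todd_coeff \<omega> 0 = (if \<omega> = 1 then 1 else 0)"
proof -
  have "todd_coeff \<omega> 0 * (1 - \<omega>) = 0"
    using todd_coeff_convolution[of \<omega> 0] by simp
  moreover have "todd_coeff \<omega> 0 * \<omega> + todd_coeff \<omega> 1 * (1 - \<omega>) = 1"
    using todd_coeff_convolution[of \<omega> 1] by (simp add: atMost_Suc add.commute)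
  ultimately show ?thesis
    by auto
qed

section \<open>The twisted Euler-Maclaurin formula\<close>

text \<open>The truncated series \<open>\<tau>\<^sub>\<omega> (- \<epsilon> d/ds)\<close> applied to a primitive telescopes under \<open>1 - \<omega> e\<^bsup>\<epsilon> d/ds\<^esup>\<close>,
  because \<open>\<tau>\<^sub>\<omega> s * (1 - \<omega> * exp (- s)) = s\<close>.\<close>

lemma todd_difference:
  fixes \<psi> :: "nat \<Rightarrow> real \<Rightarrow> complex"
  assumes deriv: "\<And>l s. l < K \<Longrightarrow> (\<psi> l has_vector_derivative \<psi> (Suc l) s) (at s)"
    and bound: "\<And>x. s \<le> x \<Longrightarrow> norm (\<psi> K x) \<le> C"
    and "\<epsilon> \<ge> 0" "K \<ge> 2" "norm \<omega> = 1"
  defines "A \<equiv> \<lambda>s. \<Sum>l<K. todd_coeff \<omega> l * of_real (- \<epsilon>) ^ l * \<psi> l s"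
  shows "norm (A s - \<omega> * A (s + \<epsilon>) + of_real \<epsilon> * \<psi> 1 s)
    \<le> C * (\<Sum>l<K. norm (todd_coeff \<omega> l)) * \<epsilon> ^ K"
proof -
  define t where "t = todd_coeff \<omega>"
  \<comment> \<open>The coefficients of \<open>1 - \<omega> * exp (- s)\<close>. When
    \<open>s\<close> stands for \<open>z = - \<epsilon>\<close> times the derivative,
    \<open>exp (- s)\<close> is the translation by \<open>\<epsilon>\<close>.\<close>
  define q :: "nat \<Rightarrow> complex" where
    "q b = (if b = 0 then 1 else 0) - \<omega> * (- 1) ^ b / fact b" for b
  define z :: complex where "z = of_real (- \<epsilon>)"
  \<comment> \<open>Expanding \<open>\<psi> l\<close> only to order \<open>K - l\<close> lets the
    one bound on \<open>\<psi> K\<close> govern every remainder, and together with the factor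
    \<open>\<epsilon> ^ l\<close> each has order \<open>K\<close>.\<close>
  define \<delta> where "\<delta> l = \<psi> l (s + \<epsilon>) - (\<Sum>b<K - l. (\<epsilon> ^ b / fact b) *\<^sub>R \<psi> (l + b) s)" for l
  have \<delta>: "norm (\<delta> l) \<le> C * \<epsilon> ^ (K - l)" if "l < K" for l
    unfolding \<delta>_def using Taylor_remainder_bound[OF deriv bound assms(3) that] .
  have split: "\<psi> l s - \<omega> * \<psi> l (s + \<epsilon>) = (\<Sum>b<K - l. q b * z ^ b * \<psi> (l + b) s) - \<omega> * \<delta> l"
    if "l < K" for l
  proof -
    have "(\<Sum>b<K - l. q b * z ^ b * \<psi> (l + b) s)
        = (\<Sum>b<K - l. if b = 0 then \<psi> l s else 0)
          - \<omega> * (\<Sum>b<K - l. (\<epsilon> ^ b / fact b) *\<^sub>R \<psi> (l + b) s)"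
      unfolding sum_distrib_left sum_subtractf[symmetric]
    proof (intro sum.cong refl)
      fix b
      have "(- 1) ^ b * z ^ b = of_real (\<epsilon> ^ b)"
        by (simp add: z_def flip: power_mult_distrib)
      then have "\<omega> * (- 1) ^ b / fact b * z ^ b = \<omega> * of_real (\<epsilon> ^ b / fact b)"
        by simp
      then show "q b * z ^ b * \<psi> (l + b) s = (if b = 0 then \<psi> l s else 0)
          - \<omega> * ((\<epsilon> ^ b / fact b) *\<^sub>R \<psi> (l + b) s)"
        by (auto simp: q_def scaleR_conv_of_real left_diff_distrib)
    qed
    also have "(\<Sum>b<K - l. if b = 0 then \<psi> l s else 0) = \<psi> l s"
      using that by (simp add: sum.delta)
    finally show ?thesis
      by (simp add: \<delta>_def algebra_simps)
  qed
  have "A s - \<omega> * A (s + \<epsilon>) = (\<Sum>l<K. t l * z ^ l * (\<psi> l s - \<omega> * \<psi> l (s + \<epsilon>)))"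
    by (simp add: A_def t_def z_def sum_distrib_left sum_subtractf[symmetric] algebra_simps)
  also have "\<dots> = (\<Sum>l<K. t l * z ^ l * (\<Sum>b<K - l. q b * z ^ b * \<psi> (l + b) s))
      - \<omega> * (\<Sum>l<K. t l * z ^ l * \<delta> l)"
    by (simp add: split right_diff_distrib sum_subtractf sum_distrib_left[of \<omega>] mult.left_commute)
  also have "(\<Sum>l<K. t l * z ^ l * (\<Sum>b<K - l. q b * z ^ b * \<psi> (l + b) s))
      = (\<Sum>l<K. \<Sum>b<K - l. t l * q b * z ^ (l + b) * \<psi> (l + b) s)"
    by (simp add: sum_distrib_left power_add ac_simps)
  also have "\<dots> = (\<Sum>(l, b)\<in>{(l, b). l + b < K}. t l * q b * z ^ (l + b) * \<psi> (l + b) s)"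
    by (subst sum.Sigma) (auto intro!: sum.cong)
  \<comment> \<open>Collecting the terms of total order \<open>k = l + b\<close> produces the
    convolution of the Todd series with its denominator.\<close>
  also have "\<dots> = (\<Sum>k<K. \<Sum>l\<le>k. t l * q (k - l) * z ^ (l + (k - l)) * \<psi> (l + (k - l)) s)"
    by (rule sum.triangle_reindex)
  also have "\<dots> = (\<Sum>k<K. (\<Sum>l\<le>k. t l * q (k - l)) * (z ^ k * \<psi> k s))"
    by (auto simp: sum_distrib_right intro!: sum.cong)
  also have "\<dots> = (\<Sum>k<K. if k = 1 then z * \<psi> 1 s else 0)"
    using todd_coeff_convolution[of \<omega>] by (intro sum.cong) (simp_all add: t_def q_def)
  \<comment> \<open>\<open>K \<ge> 2\<close> ensures that the only surviving order,
    \<open>k = 1\<close>, lies within the truncation.\<close>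
  also have "\<dots> = - of_real \<epsilon> * \<psi> 1 s"
    using assms(4) by (simp add: z_def)
  finally have "A s - \<omega> * A (s + \<epsilon>) + of_real \<epsilon> * \<psi> 1 s = - \<omega> * (\<Sum>l<K. t l * z ^ l * \<delta> l)"
    by simp
  then have "norm (A s - \<omega> * A (s + \<epsilon>) + of_real \<epsilon> * \<psi> 1 s) = norm (\<Sum>l<K. t l * z ^ l * \<delta> l)"
    by (simp add: norm_mult assms(5))
  also have "\<dots> \<le> (\<Sum>l<K. norm (t l) * \<epsilon> ^ l * (C * \<epsilon> ^ (K - l)))"
    using \<delta> assms(3)
    by (intro sum_norm_le) (auto simp: norm_mult norm_power z_def intro!: mult_left_mono)
  also have "\<dots> = (\<Sum>l<K. C * norm (t l) * \<epsilon> ^ K)"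
  proof (intro sum.cong refl)
    fix l assume "l \<in> {..<K}"
    then have "\<epsilon> ^ l * \<epsilon> ^ (K - l) = \<epsilon> ^ K"
      by (simp flip: power_add)
    then show "norm (t l) * \<epsilon> ^ l * (C * \<epsilon> ^ (K - l)) = C * norm (t l) * \<epsilon> ^ K"
      by (metis mult.assoc mult.commute)
  qed
  also have "\<dots> = C * (\<Sum>l<K. norm (todd_coeff \<omega> l)) * \<epsilon> ^ K"
    by (simp add: t_def sum_distrib_left sum_distrib_right)
  finally show ?thesis .
qed

text \<open>Up to sign, \<open>\<psi> 0\<close> is a primitive of the summed function. Weighted by
  \<open>\<omega> ^ m\<close>, the differences of \<open>todd_difference\<close> telescope, and the
  upper end contributes nothing because the \<open>\<psi> l\<close> vanish at \<open>R\<close>. The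
  \<open>R * N\<close> errors of size \<open>1 / N ^ K\<close> cost one power of
  \<open>N\<close>.\<close>

lemma twisted_Euler_Maclaurin:
  fixes \<psi> :: "nat \<Rightarrow> real \<Rightarrow> complex" and R N :: nat
  assumes deriv: "\<And>l s. l < K \<Longrightarrow> (\<psi> l has_vector_derivative \<psi> (Suc l) s) (at s)"
    and bound: "\<And>x. 0 \<le> x \<Longrightarrow> norm (\<psi> K x) \<le> C"
    and vanish: "\<And>l. l < K \<Longrightarrow> \<psi> l (real R) = 0"
    and "K \<ge> 2" "norm \<omega> = 1" "N \<ge> 1"
  shows "norm (1 / of_nat N * (\<Sum>m<R * N. \<omega> ^ m * (- \<psi> 1 (real m / real N)))
      - (\<Sum>l<K. todd_coeff \<omega> l * (- 1 / of_nat N) ^ l * \<psi> l 0))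
    \<le> C * (\<Sum>l<K. norm (todd_coeff \<omega> l)) * real R / real N ^ (K - 1)"
proof -
  define \<epsilon> where "\<epsilon> = 1 / real N"
  define S where "S = C * (\<Sum>l<K. norm (todd_coeff \<omega> l))"
  define A where "A s = (\<Sum>l<K. todd_coeff \<omega> l * of_real (- \<epsilon>) ^ l * \<psi> l s)" for s
  define B where "B m = \<omega> ^ m * A (real m * \<epsilon>)" for m
  define err where "err m = B m - B (Suc m) + \<omega> ^ m * (of_real \<epsilon> * \<psi> 1 (real m * \<epsilon>))" for m
  have \<epsilon>: "\<epsilon> \<ge> 0" "real (R * N) * \<epsilon> = real R"
    using assms(6) by (auto simp: \<epsilon>_def)
  have err: "norm (err m) \<le> S * \<epsilon> ^ K" for m
  proof -
    have "err m = \<omega> ^ m * (A (real m * \<epsilon>) - \<omega> * A (real m * \<epsilon> + \<epsilon>) + of_real \<epsilon> * \<psi> 1 (real m * \<epsilon>))"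
      by (simp add: err_def B_def algebra_simps)
    then have "norm (err m)
        = norm (A (real m * \<epsilon>) - \<omega> * A (real m * \<epsilon> + \<epsilon>) + of_real \<epsilon> * \<psi> 1 (real m * \<epsilon>))"
      by (simp add: norm_mult norm_power assms(5))
    also have "\<dots> \<le> S * \<epsilon> ^ K"
      unfolding A_def S_def
    proof (rule todd_difference)
      fix x assume "real m * \<epsilon> \<le> x"
      moreover have "0 \<le> real m * \<epsilon>"
        using \<epsilon>(1) by simp
      ultimately show "norm (\<psi> K x) \<le> C"
        by (intro bound) linarith
    qed (use assms \<epsilon> in auto)
    finally show ?thesis .
  qed
  have "A (real (R * N) * \<epsilon>) = 0"
    unfolding \<epsilon>(2) A_def by (auto simp: vanish)
  then have "B 0 = (\<Sum>m<R * N. B m - B (Suc m))"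
    by (subst sum_lessThan_telescope') (simp add: B_def)
  then have "- (\<Sum>m<R * N. \<omega> ^ m * (of_real \<epsilon> * \<psi> 1 (real m * \<epsilon>))) - A 0 = - (\<Sum>m<R * N. err m)"
    by (simp add: err_def sum.distrib B_def)
  then have "norm (- (\<Sum>m<R * N. \<omega> ^ m * (of_real \<epsilon> * \<psi> 1 (real m * \<epsilon>))) - A 0)
      \<le> (\<Sum>m<R * N. norm (err m))"
    by (simp add: norm_sum)
  also have "\<dots> \<le> real (R * N) * (S * \<epsilon> ^ K)"
    using sum_mono[of "{..<R * N}" "\<lambda>m. norm (err m)" "\<lambda>_. S * \<epsilon> ^ K"] err by simp
  also have "\<dots> = S * real R / real N ^ (K - 1)"
    using assms(4,6) by (cases K) (auto simp: \<epsilon>_def power_divide)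
  also have "- (\<Sum>m<R * N. \<omega> ^ m * (of_real \<epsilon> * \<psi> 1 (real m * \<epsilon>)))
      = 1 / of_nat N * (\<Sum>m<R * N. \<omega> ^ m * (- \<psi> 1 (real m / real N)))"
    by (simp add: \<epsilon>_def sum_distrib_left sum_negf sum_divide_distrib mult.commute mult.left_commute)
  also have "A 0 = (\<Sum>l<K. todd_coeff \<omega> l * (- 1 / of_nat N) ^ l * \<psi> l 0)"
    by (simp add: A_def \<epsilon>_def)
  finally show ?thesis
    by (simp add: S_def)
qed

section \<open>Summation over a simplicial cone\<close>

text \<open>Serves both for edge coordinates and for multi-indices. Entries outside \<open>S\<close>
  are fixed at 0, so that the set is finite for finite \<open>S\<close> and enlarging
  \<open>S\<close> is a pointwise update.\<close>

definition index_box :: "'i set \<Rightarrow> nat \<Rightarrow> ('i \<Rightarrow> nat) set"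
  where "index_box S L = {m. (\<forall>i\<in>S. m i < L) \<and> (\<forall>i. i \<notin> S \<longrightarrow> m i = 0)}"

lemma index_box_empty [simp]: "index_box {} L = {\<lambda>_. 0}"
  by (auto simp: index_box_def)

lemma index_box_insert:
  assumes "j \<notin> S"
  shows "index_box (insert j S) L = (\<lambda>(k, m). m(j := k)) ` ({..<L} \<times> index_box S L)"
proof (intro subset_antisym subsetI)
  fix m assume m: "m \<in> index_box (insert j S) L"
  then have "(m j, m(j := 0)) \<in> {..<L} \<times> index_box S L"
    using assms by (auto simp: index_box_def)
  then show "m \<in> (\<lambda>(k, m). m(j := k)) ` ({..<L} \<times> index_box S L)"
    by (rule rev_image_eqI) auto
qed (use assms in \<open>auto simp: index_box_def split: if_splits\<close>)

lemma finite_index_box [simp]: "finite S \<Longrightarrow> finite (index_box S L)"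
  by (induction S rule: finite_induct) (auto simp: index_box_insert)

lemma sum_index_box_insert:
  fixes X :: "('i \<Rightarrow> nat) \<Rightarrow> 'b::comm_monoid_add"
  assumes "j \<notin> S"
  shows "(\<Sum>m\<in>index_box (insert j S) L. X m) =
    (\<Sum>k<L. \<Sum>m\<in>index_box S L. X (m(j := k)))"
proof -
  have "inj_on (\<lambda>(k, m). m(j := k)) ({..<L} \<times> index_box S L)"
  proof (rule inj_onI, clarify)
    fix k m k' m'
    assume m: "m \<in> index_box S L" "m' \<in> index_box S L" "m(j := k) = m'(j := k')"
    have "m i = m' i" for i
      using fun_cong[OF m(3), of i] m(1,2) assms by (cases "i = j") (auto simp: index_box_def)
    moreover have "k = k'"
      using fun_cong[OF m(3), of j] by simp
    ultimately show "k = k' \<and> m = m'"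
      by auto
  qed
  from sum.reindex[OF this, of X] show ?thesis
    by (simp add: index_box_insert[OF assms] sum.cartesian_product split_beta o_def)
qed

text \<open>Two dual bases indexed by \<open>F\<close>; at a vertex, \<open>p\<close> will be the
  inward normals and \<open>e\<close> the edge vectors.\<close>

locale dual_frame =
  fixes p e :: "'i \<Rightarrow> 'a::euclidean_space" and F :: "'i set"
  assumes finite_F [simp]: "finite F"
    and dual: "\<And>i j. i \<in> F \<Longrightarrow> j \<in> F \<Longrightarrow> p i \<bullet> e j = (if i = j then 1 else 0)"
    and expansion: "\<And>x. x = (\<Sum>i\<in>F. (p i \<bullet> x) *\<^sub>R e i)"
begin

definition orthant :: "'a set"
  where "orthant = {x. \<forall>i\<in>F. p i \<bullet> x \<ge> 0}"

text \<open>The bound is one-sided on purpose: the forward integral of a compactly supported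
  function need not vanish at points lying backwards along the edge. Bounding only the forward
  coordinates is stable under derivatives and forward integrals; the strict inequality makes the
  region open, as derivatives require.\<close>

definition vanishes :: "real \<Rightarrow> ('a \<Rightarrow> 'b::zero) \<Rightarrow> bool"
  where "vanishes \<rho> f \<longleftrightarrow> (\<forall>x. (\<exists>i\<in>F. p i \<bullet> x > \<rho>) \<longrightarrow> f x = 0)"

lemma orthant_add: "x \<in> orthant \<Longrightarrow> j \<in> F \<Longrightarrow> t \<ge> 0 \<Longrightarrow> x + t *\<^sub>R e j \<in> orthant"
  by (auto simp: orthant_def inner_add_right dual)

lemma vanishes_dir_deriv:
  assumes "vanishes \<rho> f"
  shows "vanishes \<rho> (dir_deriv w f)"
proof -
  have "dir_deriv w f x = 0" if "i \<in> F" "p i \<bullet> x > \<rho>" for i x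
  proof -
    have "open {x. p i \<bullet> x > \<rho>}"
      by (rule open_halfspace_gt)
    then have "dir_deriv w f x = dir_deriv w (\<lambda>x. 0) x"
      by (rule dir_deriv_cong_open) (use assms that in \<open>auto simp: vanishes_def\<close>)
    then show ?thesis
      by (simp add: dir_deriv_const)
  qed
  then show ?thesis
    by (auto simp: vanishes_def)
qed

lemma vanishes_funpow_dir_deriv:
  "vanishes \<rho> f \<Longrightarrow> vanishes \<rho> ((dir_deriv w ^^ l) f)"
  by (induction l) (auto intro: vanishes_dir_deriv)

lemma vanishes_foldr_dir_deriv:
  "vanishes \<rho> f \<Longrightarrow> vanishes \<rho> (foldr dir_deriv ws f)"
  by (induction ws) (auto intro: vanishes_dir_deriv)

text \<open>Moving forward along \<open>e j\<close> never decreases a coordinate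
  \<open>p i \<bullet> x\<close>, so the whole segment stays where \<open>f\<close>
  vanishes.\<close>

lemma vanishes_line_int:
  fixes f :: "'a \<Rightarrow> 'b::banach"
  assumes "vanishes \<rho> f" "j \<in> F"
  shows "vanishes \<rho> (line_int T (e j) f)"
  unfolding vanishes_def
proof (intro allI impI)
  fix x assume "\<exists>i\<in>F. \<rho> < p i \<bullet> x"
  then obtain i where i: "i \<in> F" "\<rho> < p i \<bullet> x"
    by blast
  have "f (x + t *\<^sub>R e j) = 0" if "t \<in> {0..T}" for t
  proof -
    have "p i \<bullet> (x + t *\<^sub>R e j) > \<rho>"
      using i that by (auto simp: inner_add_right dual[OF i(1) assms(2)])
    then show ?thesis
      using assms(1) i(1) by (auto simp: vanishes_def)
  qed
  then have "integral {0..T} (\<lambda>t. f (x + t *\<^sub>R e j)) = integral {0..T} (\<lambda>t. 0)"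
    by (intro integral_cong)
  then show "line_int T (e j) f x = 0"
    by (simp add: line_int_def)
qed

lemma vanishes_foldr_line_int:
  fixes f :: "'a \<Rightarrow> 'b::banach"
  assumes "vanishes \<rho> f" "set js \<subseteq> F"
  shows "vanishes \<rho> (foldr (\<lambda>i. line_int T (e i)) js f)"
  using assms(2) by (induction js) (auto intro: vanishes_line_int assms(1))

text \<open>The points of the cone with all coordinates at most \<open>\<rho>\<close> form a compact
  set, and \<open>f\<close> vanishes on the rest of the cone.\<close>

lemma bounded_on_orthant:
  fixes f :: "'a \<Rightarrow> 'b::real_normed_vector"
  assumes "continuous_on UNIV f" "vanishes \<rho> f"
  obtains C where "C \<ge> 0" "\<And>x. x \<in> orthant \<Longrightarrow> norm (f x) \<le> C"
proof -
  define K where "K = {x. \<forall>i\<in>F. 0 \<le> p i \<bullet> x \<and> p i \<bullet> x \<le> \<rho>}"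
  have "K = (\<Inter>i\<in>F. {x. 0 \<le> p i \<bullet> x} \<inter> {x. p i \<bullet> x \<le> \<rho>})"
    by (auto simp: K_def)
  then have "closed K"
    by (auto intro!: closed_INT closed_Int closed_halfspace_ge closed_halfspace_le)
  moreover have "bounded K"
  proof (rule boundedI)
    fix x assume x: "x \<in> K"
    have "norm x = norm (\<Sum>i\<in>F. (p i \<bullet> x) *\<^sub>R e i)"
      by (subst expansion[of x]) simp
    also have "\<dots> \<le> (\<Sum>i\<in>F. \<bar>\<rho>\<bar> * norm (e i))"
      using x by (intro sum_norm_le) (auto simp: K_def intro!: mult_right_mono)
    finally show "norm x \<le> (\<Sum>i\<in>F. \<bar>\<rho>\<bar> * norm (e i))" .
  qed
  ultimately have "compact (f ` K)"
    using assms(1) by (intro compact_continuous_image) (auto simp: compact_eq_bounded_closed intro: continuous_on_subset)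
  then obtain C where C: "C > 0" "\<forall>y\<in>f ` K. norm y \<le> C"
    using compact_imp_bounded bounded_pos by blast
  show thesis
  proof
    show "norm (f x) \<le> C" if "x \<in> orthant" for x
    proof (cases "x \<in> K")
      case False
      then have "\<exists>i\<in>F. p i \<bullet> x > \<rho>"
        using that by (auto simp: K_def orthant_def not_le)
      then show ?thesis
        using assms(2) C by (auto simp: vanishes_def)
    qed (use C in auto)
  qed (use C in auto)
qed

text \<open>The one-variable formula along each ray in direction \<open>e j\<close>, with the
  forward integral of \<open>\<phi>\<close> as \<open>\<psi> 0\<close>. The constant must not depend
  on the base point \<open>x\<close>, because a later induction sums the error over many base
  points.\<close>

lemma Euler_Maclaurin_line:
  fixes \<phi> :: "'a \<Rightarrow> complex" and R :: nat
  assumes "Ck K \<phi>" "K \<ge> 2" "vanishes \<rho> \<phi>" "\<rho> < real R" "j \<in> F" "norm \<omega> = 1"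
  obtains C where "C \<ge> 0"
    "\<And>N x. N \<ge> 1 \<Longrightarrow> x \<in> orthant \<Longrightarrow>
      norm (1 / of_nat N * (\<Sum>m<R * N. \<omega> ^ m * \<phi> (x + (real m / real N) *\<^sub>R e j))
        - (\<Sum>l<K. todd_coeff \<omega> l * (- 1 / of_nat N) ^ l
            * (dir_deriv (e j) ^^ l) (line_int R (e j) \<phi>) x)) \<le> C / real N ^ (K - 1)"
proof -
  define J where "J l = (dir_deriv (e j) ^^ l) (line_int R (e j) \<phi>)" for l
  have CkJ: "Ck (K - l) (J l)" if "l \<le> K" for l
    using that
  proof (induction l)
    case 0
    then show ?case by (auto simp: J_def intro: Ck_line_int assms)
  next
    case (Suc l)
    then have "Ck (Suc (K - Suc l)) (J l)"
      by (simp add: Suc_diff_Suc del: Ck.simps)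
    then show ?case
      by (simp add: J_def del: Ck.simps add: Ck_dir_deriv)
  qed
  have vJ: "vanishes \<rho> (J l)" for l
    unfolding J_def
    by (intro vanishes_funpow_dir_deriv vanishes_line_int assms)
  obtain C where C: "C \<ge> 0" "\<And>x. x \<in> orthant \<Longrightarrow> norm (J K x) \<le> C"
    using bounded_on_orthant[OF Ck_imp_continuous[OF CkJ] vJ, of K] by auto
  \<comment> \<open>From parameter \<open>R\<close> on, the coordinate \<open>p j\<close> exceeds
    \<open>\<rho>\<close>, whatever the base point in the cone.\<close>
  have beyond: "g (x + t *\<^sub>R e j) = 0"
    if "vanishes \<rho> g" "x \<in> orthant" "t \<ge> real R" for g :: "'a \<Rightarrow> complex" and x t
  proof -
    have "p j \<bullet> (x + t *\<^sub>R e j) > \<rho>"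
      using that assms(4,5) by (auto simp: inner_add_right dual orthant_def intro: add_nonneg_pos
          less_le_trans[of _ "real R"] intro!: order_less_le_trans[OF assms(4)] add_increasing)
    then show ?thesis
      using that(1) assms(5) by (auto simp: vanishes_def)
  qed
  show thesis
  proof
    show "0 \<le> C * (\<Sum>l<K. norm (todd_coeff \<omega> l)) * real R"
      using C by (intro mult_nonneg_nonneg sum_nonneg) auto
    fix N x assume N: "N \<ge> (1::nat)" and x: "x \<in> orthant"
    define \<psi> where "\<psi> l s = J l (x + s *\<^sub>R e j)" for l s
    have "- \<psi> 1 (real m / real N) = \<phi> (x + (real m / real N) *\<^sub>R e j)" for m
    proof -
      let ?y = "x + (real m / real N) *\<^sub>R e j"
      have "?y \<in> orthant"
        using x assms(5) by (intro orthant_add) auto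
      moreover have "Ck (Suc 0) \<phi>"
        by (rule Ck_mono[OF assms(1)]) (use assms(2) in simp)
      ultimately show ?thesis
        using beyond[OF assms(3), of ?y "real R"] by (simp add: \<psi>_def J_def dir_deriv_line_int_same)
    qed
    moreover have "norm (1 / of_nat N * (\<Sum>m<R * N. \<omega> ^ m * (- \<psi> 1 (real m / real N)))
      - (\<Sum>l<K. todd_coeff \<omega> l * (- 1 / of_nat N) ^ l * \<psi> l 0))
      \<le> C * (\<Sum>l<K. norm (todd_coeff \<omega> l)) * real R / real N ^ (K - 1)"
    proof (rule twisted_Euler_Maclaurin)
      show "(\<psi> l has_vector_derivative \<psi> (Suc l) s) (at s)" if "l < K" for l s
      proof -
        have "Ck (Suc (K - Suc l)) (J l)"
          using CkJ[of l] that by (simp add: Suc_diff_Suc del: Ck.simps)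
        then have "J l differentiable (at (x + s *\<^sub>R e j))"
          by simp
        from has_vector_derivative_dir_deriv[OF this] show ?thesis
          by (simp add: \<psi>_def[abs_def] J_def)
      qed
      show "norm (\<psi> K s) \<le> C" if "0 \<le> s" for s
        unfolding \<psi>_def using x that assms(5) by (intro C orthant_add)
      show "\<psi> l (real R) = 0" for l
        unfolding \<psi>_def by (rule beyond[OF vJ x]) simp
    qed (use assms N in auto)
    ultimately show "norm (1 / of_nat N * (\<Sum>m<R * N. \<omega> ^ m * \<phi> (x + (real m / real N) *\<^sub>R e j))
        - (\<Sum>l<K. todd_coeff \<omega> l * (- 1 / of_nat N) ^ l
            * (dir_deriv (e j) ^^ l) (line_int R (e j) \<phi>) x))
        \<le> C * (\<Sum>l<K. norm (todd_coeff \<omega> l)) * real R / real N ^ (K - 1)"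
      by (simp add: \<psi>_def J_def)
  qed
qed

end

section \<open>The Euler-Maclaurin formula over several edge directions\<close>

context dual_frame
begin

definition twisted_sum :: "nat \<Rightarrow> 'i list \<Rightarrow> ('i \<Rightarrow> complex) \<Rightarrow> nat \<Rightarrow> ('a \<Rightarrow> complex) \<Rightarrow> 'a \<Rightarrow> complex"
  where "twisted_sum R js \<omega> N \<phi> x = (1 / of_nat N) ^ length js
    * (\<Sum>m\<in>index_box (set js) (R * N). (\<Prod>i\<in>set js. \<omega> i ^ m i)
        * \<phi> (x + (\<Sum>i\<in>set js. (real (m i) / real N) *\<^sub>R e i)))"

text \<open>If \<open>js\<close> lists all of \<open>F\<close>, then at points of the cone and for
  \<open>R\<close> beyond the support this is the integral of \<open>\<phi>\<close> over the
  translated cone in edge coordinates, that is, without the Jacobian.\<close>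

definition iterated_primitive :: "nat \<Rightarrow> 'i list \<Rightarrow> ('a \<Rightarrow> complex) \<Rightarrow> 'a \<Rightarrow> complex"
  where "iterated_primitive R js \<phi> = foldr (\<lambda>i. line_int (real R) (e i)) js \<phi>"

text \<open>The product of the series \<open>\<tau>\<^sub>\<omega>\<close>, each truncated below
  order \<open>K\<close> and evaluated at \<open>- 1 / N\<close> times the derivative along
  \<open>e i\<close>, applied to the iterated primitive.\<close>

definition todd_sum :: "nat \<Rightarrow> nat \<Rightarrow> 'i list \<Rightarrow> ('i \<Rightarrow> complex) \<Rightarrow> nat \<Rightarrow> ('a \<Rightarrow> complex) \<Rightarrow> 'a \<Rightarrow> complex"
  where "todd_sum R K js \<omega> N \<phi> x = (\<Sum>\<alpha>\<in>index_box (set js) K.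
    (\<Prod>i\<in>set js. todd_coeff (\<omega> i) (\<alpha> i) * (- 1 / of_nat N) ^ \<alpha> i)
      * foldr (\<lambda>i. dir_deriv (e i) ^^ \<alpha> i) js (iterated_primitive R js \<phi>) x)"

text \<open>Induction on the edges: the inner sums are replaced by their approximation at every
  point of the outer sum, and then the one-variable formula is applied to each function
  \<open>G \<alpha>\<close> that occurs. Each edge consumes up to \<open>K\<close> derivatives,
  hence the regularity \<open>K * length js\<close>.\<close>

lemma Euler_Maclaurin_orthant:
  fixes \<phi> :: "'a \<Rightarrow> complex" and R :: nat
  assumes "distinct js" "set js \<subseteq> F" "K \<ge> 2" "Ck (K * length js) \<phi>"
    and "vanishes \<rho> \<phi>" "\<rho> < real R" "\<And>i. i \<in> F \<Longrightarrow> norm (\<omega> i) = 1"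
  shows "\<exists>C\<ge>0. \<forall>N\<ge>1. \<forall>x\<in>orthant.
    norm (twisted_sum R js \<omega> N \<phi> x - todd_sum R K js \<omega> N \<phi> x) \<le> C / real N ^ (K - 1)"
  using assms(1,2,4)
proof (induction js)
  case Nil
  then show ?case
    by (auto simp: twisted_sum_def todd_sum_def iterated_primitive_def intro: exI[of _ 0])
next
  case (Cons j js)
  then have j: "j \<in> F" "j \<notin> set js" "distinct js" "set js \<subseteq> F"
    by auto
  have Ck\<phi>: "Ck (K * length js) \<phi>"
    by (rule Ck_mono[OF Cons.prems(3)]) simp
  let ?S = "twisted_sum R js \<omega>"
  define A where "A = index_box (set js) K"
  define c where "c N \<alpha> = (\<Prod>i\<in>set js. todd_coeff (\<omega> i) (\<alpha> i) * (- 1 / of_nat N) ^ \<alpha> i)" for N :: nat and \<alpha>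
  define J where "J = foldr (\<lambda>i. line_int R (e i)) js \<phi>"
  define G where "G \<alpha> = foldr (\<lambda>i. dir_deriv (e i) ^^ \<alpha> i) js J" for \<alpha>
  obtain C1 where C1: "C1 \<ge> 0"
    "\<And>N y. N \<ge> 1 \<Longrightarrow> y \<in> orthant \<Longrightarrow> norm (?S N \<phi> y - (\<Sum>\<alpha>\<in>A. c N \<alpha> * G \<alpha> y)) \<le> C1 / real N ^ (K - 1)"
    using Cons.IH[OF j(3,4) Ck\<phi>]
    unfolding todd_sum_def A_def c_def G_def J_def iterated_primitive_def by blast
  have order: "K + sum_list (map \<alpha> js) \<le> K * length (j # js)" if "\<alpha> \<in> A" for \<alpha>
  proof -
    have "sum_list (map \<alpha> js) \<le> sum_list (map (\<lambda>_. K) js)"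
      using that by (intro sum_list_mono) (auto simp: A_def index_box_def less_imp_le)
    then show ?thesis
      by (simp add: sum_list_triv mult.commute)
  qed
  have CkG: "Ck K (G \<alpha>)" if "\<alpha> \<in> A" for \<alpha>
    unfolding G_def foldr_dir_deriv_concat J_def
    by (intro Ck_foldr_dir_deriv Ck_foldr_line_int, unfold length_concat_replicate)
      (rule Ck_mono[OF Cons.prems(3) order[OF that]])
  have vG: "vanishes \<rho> (G \<alpha>)" for \<alpha>
    unfolding G_def foldr_dir_deriv_concat J_def
    by (intro vanishes_foldr_dir_deriv vanishes_foldr_line_int assms j)
  \<comment> \<open>Integration along \<open>e j\<close> passes through the derivatives along the
    other edges and extends the iterated primitive by one edge.\<close>
  have line: "line_int R (e j) (G \<alpha>) = foldr (\<lambda>i. dir_deriv (e i) ^^ \<alpha> i) js (line_int R (e j) J)"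
    if "\<alpha> \<in> A" for \<alpha>
    unfolding G_def foldr_dir_deriv_concat
  proof (rule foldr_dir_deriv_line_int[symmetric])
    show "Ck (length (concat (map (\<lambda>i. replicate (\<alpha> i) (e i)) js))) J"
      unfolding length_concat_replicate J_def using order[OF that]
      by (intro Ck_foldr_line_int Ck_mono[OF Cons.prems(3)]) simp
  qed
  define P where "P N x \<alpha> = 1 / of_nat N * (\<Sum>k<R * N. \<omega> j ^ k * G \<alpha> (x + (real k / real N) *\<^sub>R e j))"
    for N x \<alpha>
  define Q where "Q N x \<alpha> = (\<Sum>l<K. todd_coeff (\<omega> j) l * (- 1 / of_nat N) ^ l
      * (dir_deriv (e j) ^^ l) (line_int R (e j) (G \<alpha>)) x)" for N :: nat and x \<alpha>
  have "\<exists>C\<ge>0. \<forall>N\<ge>1. \<forall>x\<in>orthant. norm (P N x \<alpha> - Q N x \<alpha>) \<le> C / real N ^ (K - 1)"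
    if "\<alpha> \<in> A" for \<alpha>
    unfolding P_def Q_def
    by (rule Euler_Maclaurin_line[OF CkG[OF that] assms(3) vG assms(6) j(1) assms(7)[OF j(1)]]) blast
  then obtain C2 where C2: "\<And>\<alpha>. \<alpha> \<in> A \<Longrightarrow> C2 \<alpha> \<ge> 0"
    "\<And>\<alpha> N x. \<alpha> \<in> A \<Longrightarrow> N \<ge> 1 \<Longrightarrow> x \<in> orthant \<Longrightarrow> norm (P N x \<alpha> - Q N x \<alpha>) \<le> C2 \<alpha> / real N ^ (K - 1)"
    by metis
  \<comment> \<open>The powers of \<open>- 1 / N\<close> have norm at most 1, so the coefficients
    are bounded independently of \<open>N\<close>.\<close>
  define c' where "c' \<alpha> = (\<Prod>i\<in>set js. norm (todd_coeff (\<omega> i) (\<alpha> i)))" for \<alpha>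
  have c': "c' \<alpha> \<ge> 0" "norm (c N \<alpha>) \<le> c' \<alpha>" if "N \<ge> 1" for N \<alpha>
  proof -
    show "c' \<alpha> \<ge> 0"
      by (auto simp: c'_def intro: prod_nonneg)
    have "norm ((- 1 / of_nat N :: complex) ^ n) \<le> 1" for n
      using that by (simp add: norm_power norm_divide power_le_one)
    then show "norm (c N \<alpha>) \<le> c' \<alpha>"
      unfolding c_def c'_def prod_norm[symmetric] norm_mult
      by (intro prod_mono) (auto intro: mult_left_le)
  qed
  show ?case
  proof (intro exI[of _ "real R * C1 + (\<Sum>\<alpha>\<in>A. c' \<alpha> * C2 \<alpha>)"] conjI allI impI ballI)
    show "0 \<le> real R * C1 + (\<Sum>\<alpha>\<in>A. c' \<alpha> * C2 \<alpha>)"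
      using C1 C2 c'(1)[of 1] by (intro add_nonneg_nonneg sum_nonneg mult_nonneg_nonneg) auto
    fix N :: nat and x assume N: "N \<ge> 1" and x: "x \<in> orthant"
    have sum_eq: "twisted_sum R (j # js) \<omega> N \<phi> x
        = 1 / of_nat N * (\<Sum>k<R * N. \<omega> j ^ k * ?S N \<phi> (x + (real k / real N) *\<^sub>R e j))"
    proof -
      have *: "(\<Prod>i\<in>insert j (set js). \<omega> i ^ (m(j := k)) i)
              * \<phi> (x + (\<Sum>i\<in>insert j (set js). (real ((m(j := k)) i) / real N) *\<^sub>R e i))
          = \<omega> j ^ k * ((\<Prod>i\<in>set js. \<omega> i ^ m i)
              * \<phi> (x + (real k / real N) *\<^sub>R e j + (\<Sum>i\<in>set js. (real (m i) / real N) *\<^sub>R e i)))" for m k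
      proof -
        have "(\<Prod>i\<in>insert j (set js). \<omega> i ^ (m(j := k)) i) = \<omega> j ^ k * (\<Prod>i\<in>set js. \<omega> i ^ m i)"
          using j(2) by (simp, intro disjI2 prod.cong) auto
        moreover have "(\<Sum>i\<in>insert j (set js). (real ((m(j := k)) i) / real N) *\<^sub>R e i)
            = (real k / real N) *\<^sub>R e j + (\<Sum>i\<in>set js. (real (m i) / real N) *\<^sub>R e i)"
          using j(2) by (simp, intro sum.cong) auto
        ultimately show ?thesis
          by (simp add: add.assoc mult.assoc)
      qed
      show ?thesis
        by (simp only: list.set(2) sum_index_box_insert[OF j(2)] * twisted_sum_def)
          (simp add: sum_distrib_left mult_ac)
    qed
    have main_eq: "todd_sum R K (j # js) \<omega> N \<phi> x = (\<Sum>\<alpha>\<in>A. c N \<alpha> * Q N x \<alpha>)"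
    proof -
      have *: "(\<Prod>i\<in>insert j (set js). todd_coeff (\<omega> i) ((\<alpha>(j := l)) i) * (- 1 / of_nat N) ^ (\<alpha>(j := l)) i)
              * foldr (\<lambda>i. dir_deriv (e i) ^^ (\<alpha>(j := l)) i) (j # js) (foldr (\<lambda>i. line_int R (e i)) (j # js) \<phi>) x
            = c N \<alpha> * (todd_coeff (\<omega> j) l * (- 1 / of_nat N) ^ l
                * (dir_deriv (e j) ^^ l) (line_int R (e j) (G \<alpha>)) x)" if "\<alpha> \<in> A" for \<alpha> l
      proof -
        have "(\<Prod>i\<in>insert j (set js). todd_coeff (\<omega> i) ((\<alpha>(j := l)) i) * (- 1 / of_nat N) ^ (\<alpha>(j := l)) i)
            = todd_coeff (\<omega> j) l * (- 1 / of_nat N) ^ l * c N \<alpha>"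
        proof -
          have "(\<Prod>i\<in>set js. todd_coeff (\<omega> i) ((\<alpha>(j := l)) i) * (- 1 / of_nat N) ^ (\<alpha>(j := l)) i) = c N \<alpha>"
            using j(2) unfolding c_def by (intro prod.cong) (auto simp: fun_upd_apply)
          then show ?thesis
            using j(2) by (subst prod.insert) (simp_all add: fun_upd_apply)
        qed
        moreover have "foldr (\<lambda>i. dir_deriv (e i) ^^ (\<alpha>(j := l)) i) js (line_int R (e j) J)
            = foldr (\<lambda>i. dir_deriv (e i) ^^ \<alpha> i) js (line_int R (e j) J)"
          using j(2) by (intro foldr_cong) auto
        ultimately show ?thesis
          by (simp add: line[OF that] J_def)
      qed
      show ?thesis
        unfolding list.set(2) sum_index_box_insert[OF j(2)] A_def[symmetric] Q_def sum_distrib_left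
          todd_sum_def iterated_primitive_def
        by (subst sum.swap) (intro sum.cong refl *)
    qed
    \<comment> \<open>The outer sum has \<open>R * N\<close> terms and the factor
      \<open>1 / N\<close>, so the error of the induction hypothesis grows only by the factor
      \<open>R\<close>.\<close>
    have "norm (1 / of_nat N * (\<Sum>k<R * N. \<omega> j ^ k * ?S N \<phi> (x + (real k / real N) *\<^sub>R e j))
        - (\<Sum>\<alpha>\<in>A. c N \<alpha> * P N x \<alpha>)) \<le> real R * C1 / real N ^ (K - 1)"
    proof -
      let ?y = "\<lambda>k. x + (real k / real N) *\<^sub>R e j"
      have y: "?y k \<in> orthant" for k
        using x j(1) by (intro orthant_add) auto
      have "(\<Sum>\<alpha>\<in>A. c N \<alpha> * P N x \<alpha>) = 1 / of_nat N * (\<Sum>k<R * N. \<omega> j ^ k * (\<Sum>\<alpha>\<in>A. c N \<alpha> * G \<alpha> (?y k)))"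
        unfolding P_def sum_distrib_left by (subst sum.swap) (simp add: mult_ac)
      then have "norm (1 / of_nat N * (\<Sum>k<R * N. \<omega> j ^ k * ?S N \<phi> (?y k)) - (\<Sum>\<alpha>\<in>A. c N \<alpha> * P N x \<alpha>))
          = 1 / real N * norm (\<Sum>k<R * N. \<omega> j ^ k * (?S N \<phi> (?y k) - (\<Sum>\<alpha>\<in>A. c N \<alpha> * G \<alpha> (?y k))))"
        by (simp add: right_diff_distrib sum_subtractf norm_divide flip: diff_divide_distrib)
      also have "\<dots> \<le> 1 / real N * (\<Sum>k<R * N. C1 / real N ^ (K - 1))"
        using C1(2)[OF N y] assms(7)[OF j(1)]
        by (intro mult_left_mono sum_norm_le) (auto simp: norm_mult norm_power)
      also have "\<dots> = real R * C1 / real N ^ (K - 1)"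
        using N by simp
      finally show ?thesis .
    qed
    moreover have "norm ((\<Sum>\<alpha>\<in>A. c N \<alpha> * P N x \<alpha>) - (\<Sum>\<alpha>\<in>A. c N \<alpha> * Q N x \<alpha>))
        \<le> (\<Sum>\<alpha>\<in>A. c' \<alpha> * C2 \<alpha>) / real N ^ (K - 1)"
    proof -
      have "norm (\<Sum>\<alpha>\<in>A. c N \<alpha> * (P N x \<alpha> - Q N x \<alpha>)) \<le> (\<Sum>\<alpha>\<in>A. c' \<alpha> * (C2 \<alpha> / real N ^ (K - 1)))"
        by (rule sum_norm_le, unfold norm_mult)
          (intro mult_mono C2(2)[OF _ N x] c'[OF N] norm_ge_zero)
      then show ?thesis
        by (simp add: right_diff_distrib sum_subtractf sum_divide_distrib)
    qed
    ultimately show "norm (twisted_sum R (j # js) \<omega> N \<phi> x - todd_sum R K (j # js) \<omega> N \<phi> x)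
        \<le> (real R * C1 + (\<Sum>\<alpha>\<in>A. c' \<alpha> * C2 \<alpha>)) / real N ^ (K - 1)"
      unfolding sum_eq main_eq add_divide_distrib by (rule norm_diff_triangle_le)
  qed
qed

end

section \<open>Riemann sums\<close>

lemma finite_int_lattice_bounded:
  "finite {k \<in> int_lattice. norm (k :: real ^ 'n) \<le> r}"
proof -
  have "{k \<in> int_lattice. norm (k :: real ^ 'n) \<le> r}
      \<subseteq> (\<lambda>g. \<chi> j. real_of_int (g j)) ` (PiE UNIV (\<lambda>_. {- \<lceil>r\<rceil>..\<lceil>r\<rceil>}))"
  proof
    fix k :: "real ^ 'n" assume k: "k \<in> {k \<in> int_lattice. norm k \<le> r}"
    have "real_of_int \<lfloor>k $ j\<rfloor> = k $ j" for j
      using k by (auto simp: int_lattice_def elim: Ints_cases)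
    then have "k = (\<lambda>g. \<chi> j. real_of_int (g j)) (\<lambda>j. \<lfloor>k $ j\<rfloor>)"
      unfolding vec_eq_iff by (metis vec_lambda_beta)
    moreover have "\<lfloor>k $ j\<rfloor> \<in> {- \<lceil>r\<rceil>..\<lceil>r\<rceil>}" for j
    proof -
      have "\<bar>k $ j\<bar> \<le> r"
        using component_le_norm_cart[of k j] k by auto
      then show ?thesis
        by (auto simp: le_floor_iff) linarith+
    qed
    ultimately show "k \<in> (\<lambda>g. \<chi> j. real_of_int (g j)) ` (PiE UNIV (\<lambda>_. {- \<lceil>r\<rceil>..\<lceil>r\<rceil>}))"
      by (intro image_eqI[of _ _ "\<lambda>j. \<lfloor>k $ j\<rfloor>"]) auto
  qed
  then show ?thesis
    by (rule finite_subset) (intro finite_imageI finite_PiE, auto)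
qed

text \<open>The half-open cube lies between an open and a closed box of the same volume.\<close>

lemma integer_cube_measure:
  fixes k :: "real ^ 'n"
  assumes "k \<in> int_lattice" "N > 0"
  defines "Q \<equiv> {x. \<forall>j. real_of_int \<lfloor>real N * x $ j\<rfloor> = k $ j}"
  shows "Q \<in> sets borel" "emeasure lborel Q = ennreal ((1 / real N) ^ CARD('n))"
proof -
  define a b :: "real ^ 'n" where "a = (\<chi> j. k $ j / real N)" and "b = (\<chi> j. (k $ j + 1) / real N)"
  have Q: "Q = {x. \<forall>j. a $ j \<le> x $ j \<and> x $ j < b $ j}"
  proof -
    have "real_of_int \<lfloor>real N * y\<rfloor> = k $ j \<longleftrightarrow> a $ j \<le> y \<and> y < b $ j" for y j
    proof -
      obtain m where m: "k $ j = of_int m"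
        using assms(1) by (auto simp: int_lattice_def elim: Ints_cases)
      then have "real_of_int \<lfloor>real N * y\<rfloor> = k $ j \<longleftrightarrow> \<lfloor>real N * y\<rfloor> = m"
        by simp
      also have "\<dots> \<longleftrightarrow> k $ j \<le> real N * y \<and> real N * y < k $ j + 1"
        by (simp add: floor_eq_iff m)
      also have "\<dots> \<longleftrightarrow> a $ j \<le> y \<and> y < b $ j"
        using assms(2) by (simp add: a_def b_def field_simps)
      finally show ?thesis .
    qed
    then show ?thesis
      by (auto simp: Q_def)
  qed
  show *: "Q \<in> sets borel"
    unfolding Q by measurable
  have "box a b \<subseteq> Q" "Q \<subseteq> cbox a b"
    unfolding Q by (auto simp: mem_box_cart less_imp_le)
  then have "emeasure lborel (box a b) \<le> emeasure lborel Q" "emeasure lborel Q \<le> emeasure lborel (cbox a b)"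
    using * by (auto intro!: emeasure_mono)
  moreover have "(b - a) \<bullet> i = 1 / real N" "a \<bullet> i \<le> b \<bullet> i" if "i \<in> Basis" for i
    using that assms(2) by (auto simp: Basis_vec_def inner_axis a_def b_def field_simps)
  then have "emeasure lborel (box a b) = ennreal ((1 / real N) ^ CARD('n))"
    "emeasure lborel (cbox a b) = ennreal ((1 / real N) ^ CARD('n))"
    by (simp_all add: emeasure_lborel_box emeasure_lborel_cbox)
  ultimately show "emeasure lborel Q = ennreal ((1 / real N) ^ CARD('n))"
    by simp
qed

text \<open>Rounding down to the grid of mesh \<open>1 / N\<close> makes the Riemann sum the
  integral of a step function, and dominated convergence applies. A null set of discontinuities is
  allowed because \<open>\<psi>\<close> will be a continuous function cut off at the boundary of a
  cone. Keeping only nonzero summands makes the lattice sum finite.\<close>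

lemma Riemann_sum_tendsto:
  fixes \<psi> :: "real ^ 'n \<Rightarrow> complex"
  assumes [measurable]: "\<psi> \<in> borel_measurable borel"
    and bound: "\<And>x. norm (\<psi> x) \<le> B" and supp: "\<And>x. norm x > \<rho> \<Longrightarrow> \<psi> x = 0"
    and cont: "Z \<in> null_sets lborel" "\<And>x. x \<notin> Z \<Longrightarrow> isCont \<psi> x"
  shows "(\<lambda>N. (1 / of_nat N) ^ CARD('n) * (\<Sum>k | k \<in> int_lattice \<and> \<psi> (k /\<^sub>R real N) \<noteq> 0. \<psi> (k /\<^sub>R real N)))
    \<longlonglongrightarrow> integral UNIV \<psi>"
proof -
  define d where "d = real CARD('n)"
  define fl :: "nat \<Rightarrow> real ^ 'n \<Rightarrow> real ^ 'n" where
    "fl N x = (\<chi> j. real_of_int \<lfloor>real N * x $ j\<rfloor> / real N)" for N x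
  have fl: "norm (fl N x - x) \<le> d / real N" if "N > 0" for N x
  proof -
    have "\<bar>(fl N x - x) $ j\<bar> \<le> 1 / real N" for j
    proof -
      have "\<bar>real_of_int \<lfloor>real N * x $ j\<rfloor> - real N * x $ j\<bar> \<le> 1"
        by linarith
      then have "\<bar>real_of_int \<lfloor>real N * x $ j\<rfloor> - real N * x $ j\<bar> / real N \<le> 1 / real N"
        by (rule divide_right_mono) simp
      moreover have "(fl N x - x) $ j = (real_of_int \<lfloor>real N * x $ j\<rfloor> - real N * x $ j) / real N"
        using that by (simp add: fl_def diff_divide_distrib)
      ultimately show ?thesis
        by simp
    qed
    then have "(\<Sum>j\<in>UNIV. \<bar>(fl N x - x) $ j\<bar>) \<le> of_nat (card (UNIV :: 'n set)) * (1 / real N)"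
      by (intro sum_bounded_above)
    then show ?thesis
      using norm_le_l1_cart[of "fl N x - x"] by (simp add: d_def)
  qed
  \<comment> \<open>Rounding moves a point by at most \<open>d / N \<le> d\<close>, so all step
    functions live in the ball of radius \<open>\<rho> + d\<close>.\<close>
  define w where "w x = \<bar>B\<bar> * indicator (cball (0 :: real ^ 'n) (\<rho> + d)) x" for x
  have w: "integrable lborel w"
    unfolding w_def by (intro integrable_mult_right integrable_real_indicator)
      (auto simp flip: infinity_ennreal_def intro: emeasure_bounded_finite)
  have [measurable]: "fl N \<in> borel_measurable borel" for N
    by (subst borel_measurable_euclidean_space) (auto simp: Basis_vec_def inner_axis fl_def)
  have "(\<lambda>N. integral\<^sup>L lborel (\<lambda>x. \<psi> (fl (Suc N) x))) \<longlonglongrightarrow> integral\<^sup>L lborel \<psi>"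
    and int: "integrable lborel \<psi>"
  proof -
    have lim: "AE x in lborel. (\<lambda>N. \<psi> (fl (Suc N) x)) \<longlonglongrightarrow> \<psi> x"
    proof (rule AE_I')
      show "{x \<in> space lborel. \<not> (\<lambda>N. \<psi> (fl (Suc N) x)) \<longlonglongrightarrow> \<psi> x} \<subseteq> Z"
      proof (rule subsetI, rule ccontr)
        fix x assume x: "x \<in> {x \<in> space lborel. \<not> (\<lambda>N. \<psi> (fl (Suc N) x)) \<longlonglongrightarrow> \<psi> x}" "x \<notin> Z"
        have "(\<lambda>N. d / real (Suc N)) \<longlonglongrightarrow> 0"
          by (rule LIMSEQ_Suc[OF lim_const_over_n])
        then have "(\<lambda>N. fl (Suc N) x - x) \<longlonglongrightarrow> 0"
          by (rule Lim_null_comparison[rotated]) (intro always_eventually allI fl zero_less_Suc)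
        then have "(\<lambda>N. fl (Suc N) x) \<longlonglongrightarrow> x"
          by (simp add: LIM_zero_iff)
        then have "(\<lambda>N. \<psi> (fl (Suc N) x)) \<longlonglongrightarrow> \<psi> x"
          by (rule isCont_tendsto_compose[OF cont(2)[OF x(2)]])
        with x(1) show False
          by simp
      qed
    qed (rule cont(1))
    have bd: "AE x in lborel. norm (\<psi> (fl (Suc N) x)) \<le> w x" for N
    proof (rule AE_I2)
      fix x
      show "norm (\<psi> (fl (Suc N) x)) \<le> w x"
      proof (cases "norm x \<le> \<rho> + d")
        case True
        then show ?thesis
          using bound[of "fl (Suc N) x"] by (simp add: w_def)
      next
        case False
        have "d / real (Suc N) \<le> d / 1"
          unfolding d_def by (intro divide_left_mono) auto
        then have "norm (fl (Suc N) x) > \<rho>"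
          using False fl[of "Suc N" x] norm_triangle_ineq2[of x "fl (Suc N) x"]
          by (simp add: norm_minus_commute)
        then show ?thesis
          using False by (simp add: supp w_def)
      qed
    qed
    show "(\<lambda>N. integral\<^sup>L lborel (\<lambda>x. \<psi> (fl (Suc N) x))) \<longlonglongrightarrow> integral\<^sup>L lborel \<psi>"
      by (rule integral_dominated_convergence[OF _ _ w lim bd]) auto
    show "integrable lborel \<psi>"
      by (rule integrable_dominated_convergence[OF _ _ w lim bd]) auto
  qed
  moreover have "integral\<^sup>L lborel (\<lambda>x. \<psi> (fl N x))
      = (1 / of_nat N) ^ CARD('n) * (\<Sum>k | k \<in> int_lattice \<and> \<psi> (k /\<^sub>R real N) \<noteq> 0. \<psi> (k /\<^sub>R real N))"
    if "N > 0" for N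
  proof -
    define T where "T = {k :: real ^ 'n. k \<in> int_lattice \<and> \<psi> (k /\<^sub>R real N) \<noteq> 0}"
    define Q where "Q k = {x :: real ^ 'n. \<forall>j. real_of_int \<lfloor>real N * x $ j\<rfloor> = k $ j}" for k
    have "T \<subseteq> {k \<in> int_lattice. norm k \<le> \<rho> * real N}"
    proof
      fix k assume k: "k \<in> T"
      then have "norm (k /\<^sub>R real N) \<le> \<rho>"
        using supp[of "k /\<^sub>R real N"] by (force simp: T_def not_le)
      then show "k \<in> {k \<in> int_lattice. norm k \<le> \<rho> * real N}"
        using that k by (auto simp: T_def field_simps)
    qed
    then have fin: "finite T"
      by (rule finite_subset[OF _ finite_int_lattice_bounded])
    have "\<psi> (fl N x) = (\<Sum>k\<in>T. \<psi> (k /\<^sub>R real N) * indicator (Q k) x)" for x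
    proof -
      define k :: "real ^ 'n" where "k = (\<chi> j. real_of_int \<lfloor>real N * x $ j\<rfloor>)"
      have ind: "x \<in> Q k' \<longleftrightarrow> k' = k" for k'
        by (auto simp: Q_def k_def vec_eq_iff)
      have fl: "fl N x = k /\<^sub>R real N"
        by (simp add: fl_def k_def vec_eq_iff divide_inverse mult.commute)
      have "(\<Sum>k'\<in>T. \<psi> (k' /\<^sub>R real N) * indicator (Q k') x) = (\<Sum>k'\<in>T. if k' = k then \<psi> (k /\<^sub>R real N) else 0)"
        by (intro sum.cong) (auto simp: ind indicator_def)
      also have "\<dots> = (if k \<in> T then \<psi> (k /\<^sub>R real N) else 0)"
        using fin by simp
      also have "\<dots> = \<psi> (fl N x)"
        by (auto simp: T_def fl int_lattice_def k_def)
      finally show ?thesis ..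
    qed
    then have "integral\<^sup>L lborel (\<lambda>x. \<psi> (fl N x))
        = integral\<^sup>L lborel (\<lambda>x. \<Sum>k\<in>T. \<psi> (k /\<^sub>R real N) * indicator (Q k) x)"
      by simp
    also have "\<dots> = (\<Sum>k\<in>T. \<psi> (k /\<^sub>R real N) * (1 / of_nat N) ^ CARD('n))"
    proof (intro has_bochner_integral_integral_eq has_bochner_integral_sum)
      fix k assume k: "k \<in> T"
      then have Q: "Q k \<in> sets borel" "emeasure lborel (Q k) = ennreal ((1 / real N) ^ CARD('n))"
        using integer_cube_measure[of k N] that by (auto simp: T_def Q_def)
      then have "measure lborel (Q k) = (1 / real N) ^ CARD('n)"
        by (simp add: measure_def)
      with Q has_bochner_integral_indicator[of "Q k" lborel "\<psi> (k /\<^sub>R real N)"]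
      show "has_bochner_integral lborel (\<lambda>x. \<psi> (k /\<^sub>R real N) * indicator (Q k) x)
          (\<psi> (k /\<^sub>R real N) * (1 / of_nat N) ^ CARD('n))"
        by (simp add: scaleR_conv_of_real mult.commute of_real_indicator)
    qed
    also have "\<dots> = (1 / of_nat N) ^ CARD('n) * (\<Sum>k\<in>T. \<psi> (k /\<^sub>R real N))"
      by (simp add: sum_distrib_left mult.commute)
    finally show ?thesis
      by (simp add: T_def)
  qed
  ultimately have "(\<lambda>N. (1 / of_nat (Suc N)) ^ CARD('n)
      * (\<Sum>k | k \<in> int_lattice \<and> \<psi> (k /\<^sub>R real (Suc N)) \<noteq> 0. \<psi> (k /\<^sub>R real (Suc N)))) \<longlonglongrightarrow> integral\<^sup>L lborel \<psi>"
    by simp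
  then show ?thesis
    using integral_lborel[OF int] by (subst filterlim_sequentially_Suc[symmetric]) simp
qed

section \<open>The finite groups of the faces\<close>

lemma int_lattice_add: "x \<in> int_lattice \<Longrightarrow> y \<in> int_lattice \<Longrightarrow> x + y \<in> int_lattice"
  by (simp add: int_lattice_def)

lemma int_lattice_diff: "x \<in> int_lattice \<Longrightarrow> y \<in> int_lattice \<Longrightarrow> x - y \<in> int_lattice"
  by (simp add: int_lattice_def)

lemma int_lattice_sum:
  "(\<And>i. i \<in> A \<Longrightarrow> m i \<in> \<int>) \<Longrightarrow> (\<And>i. i \<in> A \<Longrightarrow> x i \<in> int_lattice) \<Longrightarrow> (\<Sum>i\<in>A. m i *\<^sub>R x i) \<in> int_lattice"
  by (auto simp: int_lattice_def intro!: Ints_sum)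

lemma int_lattice_scale: "m \<in> \<int> \<Longrightarrow> x \<in> int_lattice \<Longrightarrow> m *\<^sub>R x \<in> int_lattice"
  by (auto simp: int_lattice_def)

lemma int_lattice_inner: "x \<in> int_lattice \<Longrightarrow> y \<in> int_lattice \<Longrightarrow> x \<bullet> y \<in> \<int>"
  by (auto simp: int_lattice_def inner_vec_def intro!: Ints_sum)

abbreviation e2pi :: "real \<Rightarrow> complex"
  where "e2pi r \<equiv> exp (2 * complex_of_real pi * \<i> * complex_of_real r)"

definition unit_root :: "('d \<Rightarrow> real) \<Rightarrow> 'd \<Rightarrow> complex"
  where "unit_root a i = e2pi (a i)"

lemma exp_2pi_int_diff:
  assumes "a - b \<in> \<int>"
  shows "e2pi a = e2pi b"
proof -
  obtain m where "a = b + of_int m"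
    using assms by (metis Ints_cases add.commute diff_add_cancel)
  then have "2 * complex_of_real pi * \<i> * complex_of_real a
      = 2 * complex_of_real pi * \<i> * complex_of_real b + (2 * of_int m * pi) * \<i>"
    by (simp add: algebra_simps)
  then show ?thesis
    by (auto simp: exp_eq)
qed

lemma exp_2pi_eq_1_iff:
  "e2pi a = 1 \<longleftrightarrow> a \<in> \<int>"
proof
  assume "e2pi a = 1"
  then obtain m :: int where "2 * pi * a = of_int (2 * m) * pi"
    by (auto simp: exp_eq_1)
  then have "a = of_int m"
    by simp
  then show "a \<in> \<int>"
    by simp
next
  assume "a \<in> \<int>"
  then show "e2pi a = 1"
    using exp_2pi_int_diff[of a 0] by simp
qed

lemma norm_unit_root [simp]: "norm (unit_root a i) = 1"
proof -
  have "2 * complex_of_real pi * \<i> * complex_of_real (a i) = \<i> * complex_of_real (2 * pi * a i)"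
    by simp
  then show ?thesis
    unfolding unit_root_def by (simp only: norm_exp_i_times)
qed

text \<open>Coordinates of the lattice points in the half-open parallelepiped spanned by the
  \<open>u i\<close>, \<open>i \<in> F\<close>. For independent \<open>u i\<close> they are a system
  of representatives of \<open>Gamma u F\<close>.\<close>

definition fract_coords :: "('d \<Rightarrow> real ^ 'n) \<Rightarrow> 'd set \<Rightarrow> ('d \<Rightarrow> real) set"
  where "fract_coords u F =
    {a. (\<forall>i\<in>F. 0 \<le> a i \<and> a i < 1) \<and> (\<forall>i. i \<notin> F \<longrightarrow> a i = 0) \<and> (\<Sum>i\<in>F. a i *\<^sub>R u i) \<in> int_lattice}"

lemma fract_coords_not_Int:
  assumes "a \<in> fract_coords u F" "a i \<noteq> 0"
  shows "a i \<notin> \<int>"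
proof
  assume "a i \<in> \<int>"
  then obtain m where "a i = of_int m"
    by (auto elim: Ints_cases)
  moreover have "0 \<le> a i" "a i < 1"
    using assms by (cases "i \<in> F"; auto simp: fract_coords_def)+
  ultimately show False
    using assms(2) by auto
qed

locale indep_family =
  fixes u :: "'d::finite \<Rightarrow> real ^ 'n" and F :: "'d set"
  assumes lattice: "\<And>i. u i \<in> int_lattice"
    and indep: "\<And>a i. (\<Sum>i\<in>F. a i *\<^sub>R u i) = 0 \<Longrightarrow> i \<in> F \<Longrightarrow> a i = 0"
begin

abbreviation comb :: "('d \<Rightarrow> real) \<Rightarrow> real ^ 'n"
  where "comb a \<equiv> \<Sum>i\<in>F. a i *\<^sub>R u i"

lemma coeffs_unique:
  assumes "comb a = comb b" "i \<in> F"
  shows "a i = b i"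
  using indep[of "\<lambda>i. a i - b i", OF _ assms(2)] assms(1)
  by (simp add: scaleR_diff_left sum_subtractf)

lemma indep_subset: "E \<subseteq> F \<Longrightarrow> indep_family u E"
proof
  fix a i assume E: "E \<subseteq> F" "(\<Sum>i\<in>E. a i *\<^sub>R u i) = 0" "i \<in> E"
  have "(\<Sum>i\<in>F. (if i \<in> E then a i else 0) *\<^sub>R u i) = (\<Sum>i\<in>E. a i *\<^sub>R u i)"
    using E(1) by (intro sum.mono_neutral_cong_right) auto
  then show "a i = 0"
    using indep[of "\<lambda>i. if i \<in> E then a i else 0" i] E by auto
qed (rule lattice)

lemma frac_in_fract_coords:
  assumes "comb b \<in> int_lattice"
  shows "(\<lambda>i. if i \<in> F then frac (b i) else 0) \<in> fract_coords u F"
proof -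
  have "(\<Sum>i\<in>F. (if i \<in> F then frac (b i) else 0) *\<^sub>R u i)
      = comb b - (\<Sum>i\<in>F. of_int \<lfloor>b i\<rfloor> *\<^sub>R u i)"
    by (simp add: frac_def scaleR_diff_left sum_subtractf)
  also have "\<dots> \<in> int_lattice"
    by (intro int_lattice_diff int_lattice_sum assms lattice) auto
  finally show ?thesis
    by (auto simp: fract_coords_def frac_lt_1)
qed

lemma fract_coords_bounded:
  assumes "a \<in> fract_coords u F"
  shows "norm (comb a) \<le> (\<Sum>i\<in>F. norm (u i))"
  using assms by (intro sum_norm_le) (auto simp: fract_coords_def intro!: mult_left_le_one_le)

lemma inj_on_comb: "inj_on comb (fract_coords u F)"
proof (rule inj_onI, rule ext)
  fix a b i
  assume ab: "a \<in> fract_coords u F" "b \<in> fract_coords u F"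
    "comb a = comb b"
  show "a i = b i"
    using coeffs_unique[OF ab(3)] ab(1,2) by (cases "i \<in> F") (auto simp: fract_coords_def)
qed

text \<open>Distinct coordinates give distinct lattice points, and these lie in a bounded
  region.\<close>

lemma finite_fract_coords [simp]: "finite (fract_coords u F)"
proof (rule inj_on_finite[OF inj_on_comb])
  show "comb ` fract_coords u F
      \<subseteq> {k \<in> int_lattice. norm k \<le> (\<Sum>i\<in>F. norm (u i))}"
    using fract_coords_bounded by (auto simp: fract_coords_def)
qed (rule finite_int_lattice_bounded)

text \<open>Two of the multiples \<open>m a\<close> have the same fractional parts, because these lie in a finite set.\<close>

lemma coeffs_rational:
  assumes "comb a \<in> int_lattice" "i \<in> F"
  shows "a i \<in> \<rat>"
proof -
  define g where "g m = (\<lambda>i. if i \<in> F then frac (real m * a i) else 0)" for m :: nat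
  have "range g \<subseteq> fract_coords u F"
  proof safe
    fix m
    have "(\<Sum>i\<in>F. (real m * a i) *\<^sub>R u i) = real m *\<^sub>R (comb a)"
      by (simp add: scaleR_sum_right)
    then show "g m \<in> fract_coords u F"
      unfolding g_def using assms(1) by (intro frac_in_fract_coords) (auto intro: int_lattice_scale)
  qed
  then have "\<not> inj g"
    using finite_subset[OF _ finite_fract_coords] by (meson finite_imageD infinite_UNIV_nat)
  then obtain m n where mn: "g m = g n" "m \<noteq> n"
    by (auto simp: inj_def)
  have "frac (real m * a i) = frac (real n * a i)"
    using assms(2) fun_cong[OF mn(1), of i] by (simp add: g_def)
  then have "(real m - real n) * a i = real_of_int (\<lfloor>real m * a i\<rfloor> - \<lfloor>real n * a i\<rfloor>)"
    by (simp add: frac_def algebra_simps)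
  then have "a i = of_int (\<lfloor>real m * a i\<rfloor> - \<lfloor>real n * a i\<rfloor>) / (real m - real n)"
    using mn(2) by (simp add: field_simps)
  also have "\<dots> \<in> \<rat>"
    by (intro Rats_divide Rats_diff) auto
  finally show ?thesis .
qed

lemma span_coeffs:
  assumes "v \<in> span (u ` F)"
  obtains b where "v = comb b"
proof -
  have inj: "inj_on u F"
  proof (rule inj_onI, rule ccontr)
    fix i j assume ij: "i \<in> F" "j \<in> F" "u i = u j" "i \<noteq> j"
    have "(\<Sum>k\<in>F. ((if k = i then 1 else 0) - (if k = j then 1 else 0)) *\<^sub>R u k) = 0"
      using ij by (simp add: scaleR_diff_left sum_subtractf if_distrib[of "\<lambda>c. c *\<^sub>R _"] cong: if_cong)
    from indep[OF this ij(1)] ij(4) show False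
      by simp
  qed
  obtain g where "v = (\<Sum>w\<in>u ` F. g w *\<^sub>R w)"
    using assms by (auto simp: span_finite)
  then have "v = (\<Sum>i\<in>F. g (u i) *\<^sub>R u i)"
    by (simp add: sum.reindex[OF inj])
  then show thesis
    by (rule that)
qed

lemma comb_in_span: "comb b \<in> span (u ` F)"
  by (intro span_sum span_scale span_base) auto

lemma int_span_iff:
  "comb b \<in> int_span u F \<longleftrightarrow> (\<forall>i\<in>F. b i \<in> \<int>)"
proof
  assume "comb b \<in> int_span u F"
  then obtain m where m: "comb b = (\<Sum>i\<in>F. real_of_int (m i) *\<^sub>R u i)"
    by (auto simp: int_span_def)
  show "\<forall>i\<in>F. b i \<in> \<int>"
    using coeffs_unique[OF m] by auto
next
  assume "\<forall>i\<in>F. b i \<in> \<int>"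
  then have "comb b = (\<Sum>i\<in>F. real_of_int \<lfloor>b i\<rfloor> *\<^sub>R u i)"
    by (intro sum.cong) (auto elim: Ints_cases)
  then show "comb b \<in> int_span u F"
    by (auto simp: int_span_def)
qed

lemma coset_rel_iff:
  "(comb a, comb b) \<in> coset_rel u F \<longleftrightarrow>
    comb a \<in> int_lattice \<and> comb b \<in> int_lattice \<and> (\<forall>i\<in>F. a i - b i \<in> \<int>)"
  using int_span_iff[of "\<lambda>i. a i - b i"]
  by (simp add: coset_rel_def span_lattice_def comb_in_span scaleR_diff_left sum_subtractf)

lemma equiv_coset_rel: "equiv (span_lattice u F) (coset_rel u F)"
proof (rule equivI)
  have ex: "\<exists>b. v = comb b" if "v \<in> span_lattice u F" for v
    using that span_coeffs[of v] by (auto simp: span_lattice_def)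
  show "coset_rel u F \<subseteq> span_lattice u F \<times> span_lattice u F"
    by (auto simp: coset_rel_def)
  show "refl_on (span_lattice u F) (coset_rel u F)"
  proof (rule refl_onI)
    fix v assume v: "v \<in> span_lattice u F"
    then obtain b where "v = comb b"
      using ex by blast
    with v show "(v, v) \<in> coset_rel u F"
      by (simp add: coset_rel_iff span_lattice_def)
  qed
  show "sym (coset_rel u F)"
  proof (rule symI)
    fix v w assume vw: "(v, w) \<in> coset_rel u F"
    then have "v \<in> span_lattice u F" "w \<in> span_lattice u F"
      by (auto simp: coset_rel_def)
    then obtain a b where "v = comb a" "w = comb b"
      using ex by metis
    with vw show "(w, v) \<in> coset_rel u F"
      by (auto simp: coset_rel_iff) (metis Ints_minus minus_diff_eq)
  qed
  show "trans (coset_rel u F)"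
  proof (rule transI)
    fix v w x assume vw: "(v, w) \<in> coset_rel u F" "(w, x) \<in> coset_rel u F"
    then have "v \<in> span_lattice u F" "w \<in> span_lattice u F" "x \<in> span_lattice u F"
      by (auto simp: coset_rel_def)
    from ex[OF this(1)] ex[OF this(2)] ex[OF this(3)]
    obtain a b c where "v = comb a" "w = comb b" "x = comb c"
      by (elim exE)
    moreover have "p - r \<in> \<int>" if "p - q \<in> \<int>" "q - r \<in> \<int>" for p q r :: real
      using Ints_add[OF that] by simp
    ultimately show "(v, x) \<in> coset_rel u F"
      using vw by (auto simp: coset_rel_iff)
  qed
qed

definition coset_of :: "('d \<Rightarrow> real) \<Rightarrow> (real ^ 'n) set"
  where "coset_of a = coset_rel u F `` {comb a}"

text \<open>Two coefficient vectors of the same coset differ by integers, which \<open>e2pi\<close>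
  does not see.\<close>

lemma omega_coset_of:
  assumes "a \<in> fract_coords u F"
  shows "omega u F (coset_of a) = unit_root a"
proof
  fix i
  define r where "r = rep_coeffs u F (coset_of a)"
  have a: "comb a \<in> int_lattice"
    using assms by (simp add: fract_coords_def)
  \<comment> \<open>\<open>rep_coeffs\<close> asks for rational coefficients, so a rational witness
    is needed before the choice operator says anything.\<close>
  have "(\<forall>i\<in>F. a i \<in> \<rat>) \<and> comb a \<in> coset_of a"
    using a coeffs_rational[OF a] by (auto simp: coset_of_def coset_rel_iff)
  then have "(\<forall>i\<in>F. r i \<in> \<rat>) \<and> comb r \<in> coset_of a"
    unfolding r_def rep_coeffs_def
    by (rule someI[where P = "\<lambda>r. (\<forall>i\<in>F. r i \<in> \<rat>) \<and> comb r \<in> coset_of a"])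
  then have r: "\<forall>i\<in>F. a i - r i \<in> \<int>"
    by (auto simp: coset_of_def coset_rel_iff)
  show "omega u F (coset_of a) i = unit_root a i"
  proof (cases "i \<in> F")
    case True
    then show ?thesis
      using exp_2pi_int_diff[of "a i" "r i"] r by (auto simp: omega_def unit_root_def r_def)
  next
    case False
    then show ?thesis
      using assms by (simp add: omega_def unit_root_def fract_coords_def)
  qed
qed

lemma Gamma_eq: "Gamma u F = coset_of ` fract_coords u F"
proof (intro subset_antisym subsetI)
  fix \<gamma> assume "\<gamma> \<in> Gamma u F"
  then obtain v where v: "v \<in> span_lattice u F" "\<gamma> = coset_rel u F `` {v}"
    by (auto simp: Gamma_def quotient_def)
  obtain b where b: "v = comb b"
    using v(1) span_coeffs[of v] by (auto simp: span_lattice_def)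
  define a where "a = (\<lambda>i. if i \<in> F then frac (b i) else 0)"
  have a: "a \<in> fract_coords u F"
    unfolding a_def using v(1) b by (intro frac_in_fract_coords) (simp add: span_lattice_def)
  have "(comb b, comb a) \<in> coset_rel u F"
    unfolding coset_rel_iff using v(1) b a
    by (auto simp: span_lattice_def fract_coords_def a_def frac_def)
  then have "\<gamma> = coset_of a"
    unfolding coset_of_def v(2) b by (rule equiv_class_eq[OF equiv_coset_rel])
  with a show "\<gamma> \<in> coset_of ` fract_coords u F"
    by blast
next
  fix \<gamma> assume "\<gamma> \<in> coset_of ` fract_coords u F"
  then show "\<gamma> \<in> Gamma u F"
    by (auto simp: coset_of_def Gamma_def fract_coords_def span_lattice_def
        intro!: quotientI comb_in_span)
qed

lemma inj_on_coset_of: "inj_on coset_of (fract_coords u F)"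
proof (rule inj_onI, rule ext)
  fix a b i
  assume ab: "a \<in> fract_coords u F" "b \<in> fract_coords u F" "coset_of a = coset_of b"
  show "a i = b i"
  proof (cases "i \<in> F")
    case True
    have "(comb a, comb b) \<in> coset_rel u F"
      using ab by (subst equiv_class_eq_iff[OF equiv_coset_rel])
        (auto simp: coset_of_def span_lattice_def fract_coords_def comb_in_span)
    then have "a i - b i \<in> \<int>"
      using True by (simp add: coset_rel_iff)
    then obtain m where m: "a i - b i = of_int m"
      by (auto elim: Ints_cases)
    have "0 \<le> a i" "a i < 1" "0 \<le> b i" "b i < 1"
      using ab True by (auto simp: fract_coords_def)
    then have "real_of_int m < 1" "real_of_int m > - 1"
      using m by linarith+
    then have "m = 0"
      by linarith
    with m show ?thesis
      by simp
  qed (use ab in \<open>auto simp: fract_coords_def\<close>)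
qed

text \<open>A representative over \<open>E\<close>, extended by zero, is also one over
  \<open>F\<close>, and representatives with coefficients in [0,1) are unique.\<close>

lemma coset_of_in_Gamma_incl_iff:
  assumes a: "a \<in> fract_coords u F" and E: "E \<subseteq> F"
  shows "coset_of a \<in> Gamma_incl u F ` Gamma u E \<longleftrightarrow> (\<forall>i\<in>F - E. a i = 0)"
proof -
  interpret E: indep_family u E
    by (rule indep_subset[OF E])
  have extend: "(\<Sum>i\<in>E. b i *\<^sub>R u i) = comb b" if "\<forall>i\<in>F - E. b i = 0" for b
    using E that by (intro sum.mono_neutral_left) auto
  have coset: "Gamma_incl u F (E.coset_of b) = coset_of b" if b: "b \<in> fract_coords u E" for b
  proof -
    have b0: "\<forall>i\<in>F - E. b i = 0"
      using b by (auto simp: fract_coords_def)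
    let ?v = "\<Sum>i\<in>E. b i *\<^sub>R u i"
    have v: "(?v, ?v) \<in> coset_rel u E"
      using b by (simp add: E.coset_rel_iff fract_coords_def)
    have sub: "coset_rel u E \<subseteq> coset_rel u F"
    proof safe
      fix v w assume vw: "(v, w) \<in> coset_rel u E"
      have "span (u ` E) \<subseteq> span (u ` F)"
        using E by (intro span_mono image_mono)
      moreover have "v - w \<in> int_span u F"
      proof -
        obtain m where "v - w = (\<Sum>i\<in>E. real_of_int (m i) *\<^sub>R u i)"
          using vw by (auto simp: coset_rel_def int_span_def)
        also have "\<dots> = (\<Sum>i\<in>E. real_of_int (if i \<in> E then m i else 0) *\<^sub>R u i)"
          by (rule sum.cong) auto
        also have "\<dots> = (\<Sum>i\<in>F. real_of_int (if i \<in> E then m i else 0) *\<^sub>R u i)"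
          by (rule extend) auto
        finally show ?thesis
          by (auto simp only: int_span_def)
      qed
      ultimately show "(v, w) \<in> coset_rel u F"
        using vw by (auto simp: coset_rel_def span_lattice_def)
    qed
    \<comment> \<open>Applying \<open>coset_rel u F\<close> to a whole class over \<open>E\<close>
      gives a single class over \<open>F\<close>, by transitivity.\<close>
    have "coset_rel u F `` (coset_rel u E `` {?v}) = coset_rel u F `` {?v}"
    proof (intro subset_antisym subsetI)
      fix x assume "x \<in> coset_rel u F `` (coset_rel u E `` {?v})"
      then obtain w where "(?v, w) \<in> coset_rel u F" "(w, x) \<in> coset_rel u F"
        using sub by auto
      then show "x \<in> coset_rel u F `` {?v}"
        using equiv_coset_rel by (auto simp: equiv_def dest: transD)
    qed (use v in auto)
    then show ?thesis
      by (simp add: Gamma_incl_def E.coset_of_def coset_of_def extend[OF b0])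
  qed
  show ?thesis
  proof
    assume "coset_of a \<in> Gamma_incl u F ` Gamma u E"
    then obtain b where b: "b \<in> fract_coords u E" "coset_of a = coset_of b"
      unfolding E.Gamma_eq using coset by auto
    have b0: "\<forall>i\<in>F - E. b i = 0"
      using b by (auto simp: fract_coords_def)
    have "b \<in> fract_coords u F"
      using b(1) E extend[OF b0] by (auto simp: fract_coords_def)
    then have "a = b"
      using inj_onD[OF inj_on_coset_of b(2) a] by blast
    with b0 show "\<forall>i\<in>F - E. a i = 0"
      by simp
  next
    assume a0: "\<forall>i\<in>F - E. a i = 0"
    then have "a \<in> fract_coords u E"
      using a E extend[OF a0] by (auto simp: fract_coords_def)
    with coset show "coset_of a \<in> Gamma_incl u F ` Gamma u E"
      unfolding E.Gamma_eq by (metis imageI)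
  qed
qed

text \<open>It suffices to test the maximal proper subsets \<open>F - {i}\<close>, each of which
  forbids one vanishing coordinate.\<close>

lemma Gamma_sharp_eq:
  "Gamma_sharp u F = coset_of ` {a \<in> fract_coords u F. \<forall>i\<in>F. a i \<noteq> 0}"
proof -
  have "(\<forall>E. E \<subset> F \<longrightarrow> coset_of a \<notin> Gamma_incl u F ` Gamma u E) \<longleftrightarrow> (\<forall>i\<in>F. a i \<noteq> 0)"
    if a: "a \<in> fract_coords u F" for a
  proof
    assume sharp: "\<forall>E. E \<subset> F \<longrightarrow> coset_of a \<notin> Gamma_incl u F ` Gamma u E"
    show "\<forall>i\<in>F. a i \<noteq> 0"
    proof
      fix i assume "i \<in> F"
      then have "F - {i} \<subset> F"
        by blast
      then have "coset_of a \<notin> Gamma_incl u F ` Gamma u (F - {i})"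
        using sharp by blast
      then show "a i \<noteq> 0"
        using coset_of_in_Gamma_incl_iff[OF a, of "F - {i}"] by auto
    qed
  next
    assume "\<forall>i\<in>F. a i \<noteq> 0"
    then show "\<forall>E. E \<subset> F \<longrightarrow> coset_of a \<notin> Gamma_incl u F ` Gamma u E"
      using coset_of_in_Gamma_incl_iff[OF a] by blast
  qed
  then show ?thesis
    unfolding Gamma_sharp_def Gamma_eq by auto
qed

lemma sum_Gamma_sharp:
  "(\<Sum>\<gamma>\<in>Gamma_sharp u F. X (omega u F \<gamma>))
    = (\<Sum>a | a \<in> fract_coords u F \<and> (\<forall>i\<in>F. a i \<noteq> 0). X (unit_root a))"
proof -
  have "inj_on coset_of {a \<in> fract_coords u F. \<forall>i\<in>F. a i \<noteq> 0}"
    by (rule inj_on_subset[OF inj_on_coset_of]) auto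
  then show ?thesis
    unfolding Gamma_sharp_eq by (simp add: sum.reindex omega_coset_of)
qed

text \<open>Sort the representatives over \<open>F\<close> by their support
  \<open>{i. a i \<noteq> 0}\<close>: those with support \<open>E\<close> are the ones counted by
  \<open>Gamma_sharp u E\<close>.\<close>

lemma sum_Gamma_sharp_subsets:
  "(\<Sum>E\<in>Pow F. \<Sum>\<gamma>\<in>Gamma_sharp u E. X (omega u E \<gamma>)) = (\<Sum>a\<in>fract_coords u F. X (unit_root a))"
proof -
  have "{a \<in> fract_coords u F. {i. a i \<noteq> 0} = E} = {a. a \<in> fract_coords u E \<and> (\<forall>i\<in>E. a i \<noteq> 0)}"
    if E: "E \<subseteq> F" for E
  proof -
    have extend: "(\<Sum>i\<in>E. b i *\<^sub>R u i) = comb b" if "\<forall>i. i \<notin> E \<longrightarrow> b i = 0" for b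
      using E that by (intro sum.mono_neutral_left) auto
    show ?thesis
    proof (intro subset_antisym subsetI)
      fix a assume a: "a \<in> {a \<in> fract_coords u F. {i. a i \<noteq> 0} = E}"
      then show "a \<in> {a. a \<in> fract_coords u E \<and> (\<forall>i\<in>E. a i \<noteq> 0)}"
        using E extend[of a] by (auto simp: fract_coords_def)
    next
      fix a assume a: "a \<in> {a. a \<in> fract_coords u E \<and> (\<forall>i\<in>E. a i \<noteq> 0)}"
      moreover have "{i. a i \<noteq> 0} = E"
        using a by (auto simp: fract_coords_def)
      moreover have "\<forall>i\<in>F. 0 \<le> a i \<and> a i < 1"
        using a by (auto simp: fract_coords_def)
      ultimately show "a \<in> {a \<in> fract_coords u F. {i. a i \<noteq> 0} = E}"
        using E extend[of a] by (auto simp: fract_coords_def)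
    qed
  qed
  then have "(\<Sum>E\<in>Pow F. \<Sum>\<gamma>\<in>Gamma_sharp u E. X (omega u E \<gamma>))
      = (\<Sum>E\<in>Pow F. \<Sum>a | a \<in> fract_coords u F \<and> {i. a i \<noteq> 0} = E. X (unit_root a))"
    using indep_family.sum_Gamma_sharp[OF indep_subset] by (intro sum.cong) auto
  also have "\<dots> = (\<Sum>a\<in>fract_coords u F. X (unit_root a))"
    by (rule sum.group) (simp_all, auto simp: fract_coords_def)
  finally show ?thesis .
qed

end

section \<open>Taylor coefficients of the Todd symbol\<close>

text \<open>\<open>tau\<close> takes the value 1 at 0 if \<open>\<omega> = 1\<close> and 0
  otherwise, which is the constant coefficient of the quotient in both cases.\<close>

lemma tau_has_fps_expansion:
  "tau \<omega> has_fps_expansion fps_X / (1 - fps_const \<omega> * fps_exp (- 1))"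
proof -
  define G :: "complex fps" where "G = 1 - fps_const \<omega> * fps_exp (- 1)"
  define c where "c = fps_nth fps_X (subdegree G) / fps_nth G (subdegree G)"
  have "(\<lambda>x. if x = 0 then c else x / (1 - \<omega> * exp (- x))) has_fps_expansion (fps_X / G)"
  proof (rule has_fps_expansion_divide)
    show "(\<lambda>x. 1 - \<omega> * exp (- x)) has_fps_expansion G"
      unfolding G_def by (intro fps_expansion_intros)
  qed (use todd_denominator_facts[of \<omega>] in \<open>auto simp: c_def G_def subdegree_fps_X intro!: fps_expansion_intros\<close>)
  moreover have "c = (if \<omega> = 1 then 1 else 0)"
  proof (cases "\<omega> = 1")
    case True
    then have "subdegree G = 1"
      by (intro subdegreeI) (auto simp: G_def)
    then show ?thesis
      using True by (simp add: c_def G_def)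
  next
    case False
    then have "subdegree G = 0"
      by (intro subdegreeI) (auto simp: G_def)
    then show ?thesis
      using False by (simp add: c_def)
  qed
  then have "(\<lambda>x. if x = 0 then c else x / (1 - \<omega> * exp (- x))) = tau \<omega>"
    by (auto simp: tau_def fun_eq_iff)
  ultimately show ?thesis
    by (simp add: G_def)
qed

lemma higher_deriv_tau_0: "(deriv ^^ k) (tau \<omega>) 0 = fact k * todd_coeff \<omega> k"
  using fps_nth_fps_expansion[OF tau_has_fps_expansion, of \<omega> k] by (simp add: todd_coeff_def)

text \<open>At a real \<open>s \<noteq> 0\<close> the norm of \<open>\<omega> * exp (- s)\<close> is
  not 1, so the denominator does not vanish. The whole real line is needed because iterated
  derivatives are formed as functions, not only at 0.\<close>

lemma tau_analytic_on_Reals: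
  assumes "norm \<omega> = 1"
  shows "tau \<omega> analytic_on \<real>"
proof -
  have "tau \<omega> analytic_on {s}" if "s \<in> \<real>" for s
  proof (cases "s = 0")
    case True
    then show ?thesis
      using has_fps_expansion_imp_analytic_0[OF tau_has_fps_expansion] by simp
  next
    case False
    obtain r where r: "s = of_real r"
      using \<open>s \<in> \<real>\<close> by (auto elim: Reals_cases)
    have "1 - \<omega> * exp (- s) \<noteq> 0"
    proof
      assume "1 - \<omega> * exp (- s) = 0"
      then have "norm (\<omega> * exp (- s)) = 1"
        by simp
      with assms False r show False
        by (simp add: norm_mult)
    qed
    then have "(\<lambda>s. s / (1 - \<omega> * exp (- s))) analytic_on {s}"
      by (auto intro!: analytic_intros)
    moreover have "\<forall>\<^sub>F z in nhds s. z / (1 - \<omega> * exp (- z)) = tau \<omega> z"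
      using t1_space_nhds[OF False] by eventually_elim (auto simp: tau_def)
    ultimately show ?thesis
      by (subst (asm) analytic_at_cong) auto
  qed
  then show ?thesis
    using analytic_on_analytic_at by blast
qed

lemma higher_deriv_tau_has_vector_derivative:
  assumes "norm \<omega> = 1"
  shows "((\<lambda>t. (deriv ^^ k) (tau \<omega>) (of_real t)) has_vector_derivative
    (deriv ^^ Suc k) (tau \<omega>) (of_real t)) (at t)"
proof -
  have "(deriv ^^ k) (tau \<omega>) analytic_on \<real>"
    by (intro analytic_higher_deriv tau_analytic_on_Reals assms)
  then have "((deriv ^^ k) (tau \<omega>) has_field_derivative deriv ((deriv ^^ k) (tau \<omega>)) (of_real t)) (at (of_real t))"
    by (meson analytic_on_imp_differentiable_at DERIV_deriv_iff_field_differentiable Reals_of_real)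
  from has_vector_derivative_real_field[OF this] show ?thesis
    by simp
qed

text \<open>A partial derivative in direction \<open>j\<close> raises the order of the
  \<open>j\<close>-th factor by one and keeps the shape of the sum; the function
  \<open>\<beta>\<close> in the proof records the orders reached.\<close>

lemma multi_deriv_sum_prod:
  fixes g :: "'x \<Rightarrow> 'y \<Rightarrow> 'd::{finite,linorder} \<Rightarrow> nat \<Rightarrow> real \<Rightarrow> complex"
  assumes g: "\<And>x y i k t. x \<in> X \<Longrightarrow> y \<in> Y x \<Longrightarrow>
    (g x y i k has_vector_derivative g x y i (Suc k) t) (at t)"
  shows "multi_deriv \<alpha> (\<lambda>s. \<Sum>x\<in>X. \<Sum>y\<in>Y x. \<Prod>i\<in>UNIV. g x y i 0 (s $ i))
    = (\<lambda>s. \<Sum>x\<in>X. \<Sum>y\<in>Y x. \<Prod>i\<in>UNIV. g x y i (\<alpha> i) (s $ i))"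
proof -
  define h :: "('d \<Rightarrow> nat) \<Rightarrow> (real, 'd) vec \<Rightarrow> complex" where
    "h \<beta> = (\<lambda>s. \<Sum>x\<in>X. \<Sum>y\<in>Y x. \<Prod>i\<in>UNIV. g x y i (\<beta> i) (s $ i))" for \<beta>
  have step: "partial_deriv j (h \<beta>) = h (\<beta>(j := Suc (\<beta> j)))" for j \<beta>
  proof
    fix s
    have split: "(\<Prod>i\<in>UNIV. F i) = F j * (\<Prod>i\<in>UNIV - {j}. F i)" for F :: "'d \<Rightarrow> complex"
      by (rule prod.remove) auto
    have "((\<lambda>t. \<Sum>x\<in>X. \<Sum>y\<in>Y x. g x y j (\<beta> j) (s $ j + t) * (\<Prod>i\<in>UNIV - {j}. g x y i (\<beta> i) (s $ i)))
      has_vector_derivative (\<Sum>x\<in>X. \<Sum>y\<in>Y x. g x y j (Suc (\<beta> j)) (s $ j) * (\<Prod>i\<in>UNIV - {j}. g x y i (\<beta> i) (s $ i)))) (at 0)"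
    proof (intro has_vector_derivative_sum has_vector_derivative_mult_left)
      fix x y assume xy: "x \<in> X" "y \<in> Y x"
      have "((\<lambda>t. s $ j + t) has_vector_derivative 1) (at 0)"
        by (auto intro!: derivative_eq_intros)
      from vector_diff_chain_at[OF this, of "g x y j (\<beta> j)" "g x y j (Suc (\<beta> j)) (s $ j)"]
      show "((\<lambda>t. g x y j (\<beta> j) (s $ j + t)) has_vector_derivative g x y j (Suc (\<beta> j)) (s $ j)) (at 0)"
        using g[OF xy] by (simp add: o_def)
    qed
    moreover have "(\<lambda>t. h \<beta> (s + t *\<^sub>R axis j 1))
        = (\<lambda>t. \<Sum>x\<in>X. \<Sum>y\<in>Y x. g x y j (\<beta> j) (s $ j + t) * (\<Prod>i\<in>UNIV - {j}. g x y i (\<beta> i) (s $ i)))"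
      unfolding h_def split by (intro ext sum.cong refl arg_cong2[of _ _ _ _ "(*)"] prod.cong) (auto simp: axis_def)
    moreover have "h (\<beta>(j := Suc (\<beta> j))) s
        = (\<Sum>x\<in>X. \<Sum>y\<in>Y x. g x y j (Suc (\<beta> j)) (s $ j) * (\<Prod>i\<in>UNIV - {j}. g x y i (\<beta> i) (s $ i)))"
      unfolding h_def split by (intro sum.cong refl arg_cong2[of _ _ _ _ "(*)"] prod.cong) auto
    ultimately show "partial_deriv j (h \<beta>) s = h (\<beta>(j := Suc (\<beta> j))) s"
      unfolding partial_deriv_def by (simp add: vector_derivative_at)
  qed
  have pow: "(partial_deriv j ^^ n) (h \<beta>) = h (\<beta>(j := \<beta> j + n))" for j n \<beta>
    by (induction n) (simp_all add: step fun_upd_same del: fun_upd_apply)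
  have "distinct js \<Longrightarrow> foldr (\<lambda>i. partial_deriv i ^^ \<alpha> i) js (h (\<lambda>_. 0)) = h (\<lambda>i. if i \<in> set js then \<alpha> i else 0)" for js
  proof (induction js)
    case (Cons j js)
    have "(\<lambda>i. if i \<in> set js then \<alpha> i else 0)(j := (if j \<in> set js then \<alpha> j else 0) + \<alpha> j)
        = (\<lambda>i. if i \<in> set (j # js) then \<alpha> i else 0)"
      using Cons.prems by (auto simp: fun_eq_iff)
    then show ?case
      using Cons by (simp add: pow)
  qed simp
  from this[of "sorted_list_of_set UNIV"] show ?thesis
    by (simp add: multi_deriv_def h_def[abs_def])
qed

lemma norm_omega [simp]: "norm (omega u F \<gamma> i) = 1"
proof -
  have "2 * complex_of_real pi * \<i> * complex_of_real r = \<i> * complex_of_real (2 * pi * r)" for r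
    by simp
  then show ?thesis
    unfolding omega_def by (simp only: norm_exp_i_times split: if_splits) simp
qed

text \<open>The \<open>k\<close>-th derivative of \<open>tau \<omega>\<close> at 0 is
  \<open>fact k\<close> times its coefficient, and \<open>taylor_coeff\<close> divides by just these
  factorials.\<close>

lemma taylor_coeff_todd_symbol:
  fixes u :: "'d::{finite,linorder} \<Rightarrow> real ^ 'n"
  shows "taylor_coeff (todd_symbol u b) \<alpha> =
    (\<Sum>F\<in>face_subsets u b. \<Sum>\<gamma>\<in>Gamma_sharp u F. \<Prod>i\<in>UNIV. todd_coeff (omega u F \<gamma> i) (\<alpha> i))"
proof -
  have "todd_symbol u b = (\<lambda>s. \<Sum>F\<in>face_subsets u b. \<Sum>\<gamma>\<in>Gamma_sharp u F.
      \<Prod>i\<in>UNIV. (deriv ^^ 0) (tau (omega u F \<gamma> i)) (complex_of_real (s $ i)))"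
    by (simp add: fun_eq_iff todd_symbol_def tau_gamma_def)
  then have "multi_deriv \<alpha> (todd_symbol u b) = (\<lambda>s. \<Sum>F\<in>face_subsets u b. \<Sum>\<gamma>\<in>Gamma_sharp u F.
      \<Prod>i\<in>UNIV. (deriv ^^ \<alpha> i) (tau (omega u F \<gamma> i)) (complex_of_real (s $ i)))"
    by (simp only:) (rule multi_deriv_sum_prod, rule higher_deriv_tau_has_vector_derivative, rule norm_omega)
  then show ?thesis
    by (simp add: taylor_coeff_def higher_deriv_tau_0 prod.distrib sum_divide_distrib)
qed

section \<open>Lattice points and integrals in a vertex cone\<close>

lemma closed_halfspaces: "closed {x. \<forall>i\<in>A. u i \<bullet> x \<le> h i}"
proof -
  have "{x. \<forall>i\<in>A. u i \<bullet> x \<le> h i} = (\<Inter>i\<in>A. {x. u i \<bullet> x \<le> h i})"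
    by auto
  then show ?thesis
    by (auto intro!: closed_INT closed_halfspace_le)
qed

lemma bounded_compact_support:
  fixes \<phi> :: "'a::euclidean_space \<Rightarrow> 'b::real_normed_vector"
  assumes "continuous_on UNIV \<phi>" "\<And>x. norm x > \<rho> \<Longrightarrow> \<phi> x = 0"
  obtains B where "B \<ge> 0" "\<And>x. norm (\<phi> x) \<le> B"
proof -
  have "compact (\<phi> ` cball 0 \<rho>)"
    using assms(1) by (intro compact_continuous_image) (auto intro: continuous_on_subset)
  then obtain B where B: "B > 0" "\<forall>y\<in>\<phi> ` cball 0 \<rho>. norm y \<le> B"
    using compact_imp_bounded bounded_pos by blast
  show thesis
  proof
    show "norm (\<phi> x) \<le> B" for x
      using B assms(2)[of x] by (cases "norm x \<le> \<rho>") auto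
  qed (use B in simp)
qed

lemma integrable_restrict_compact_support:
  fixes \<phi> :: "'a::euclidean_space \<Rightarrow> complex"
  assumes cont: "continuous_on UNIV \<phi>" and supp: "\<And>x. norm x > \<rho> \<Longrightarrow> \<phi> x = 0" and S: "closed S"
  shows "integrable lborel (\<lambda>x. if x \<in> S then \<phi> x else 0)"
proof -
  obtain B where B: "B \<ge> 0" "\<And>x. norm (\<phi> x) \<le> B"
    using bounded_compact_support[OF cont supp] by blast
  have [measurable]: "S \<in> sets borel" "\<phi> \<in> borel_measurable borel"
    using S borel_measurable_continuous_onI[OF cont] by auto
  show ?thesis
  proof (rule Bochner_Integration.integrable_bound)
    show "integrable lborel (\<lambda>x. B * indicator (cball (0 :: 'a) \<rho>) x)"
      by (intro integrable_mult_right integrable_real_indicator)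
        (auto simp flip: infinity_ennreal_def intro: emeasure_bounded_finite)
    show "AE x in lborel. norm (if x \<in> S then \<phi> x else 0) \<le> norm (B * indicator (cball 0 \<rho>) x)"
    proof (rule AE_I2)
      fix x
      show "norm (if x \<in> S then \<phi> x else 0) \<le> norm (B * indicator (cball 0 \<rho>) x)"
        using B(1) B(2)[of x] supp[of x] by (cases "norm x \<le> \<rho>") auto
    qed
  qed simp
qed

lemma integrable_compact_support:
  fixes \<phi> :: "'a::euclidean_space \<Rightarrow> complex"
  assumes "continuous_on UNIV \<phi>" "\<And>x. norm x > \<rho> \<Longrightarrow> \<phi> x = 0" "closed S"
  shows "\<phi> integrable_on S"
  using integrable_on_lborel[OF integrable_restrict_compact_support[OF assms]]
  by (simp add: integrable_restrict_UNIV)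

lemma integral_translation:
  fixes \<phi> :: "'a::euclidean_space \<Rightarrow> complex"
  assumes cont: "continuous_on UNIV \<phi>" and supp: "\<And>x. norm x > \<rho> \<Longrightarrow> \<phi> x = 0" and S: "closed S"
  shows "integral {x. w + x \<in> S} (\<lambda>x. \<phi> (w + x)) = integral S \<phi>"
proof -
  define \<psi> where "\<psi> x = (if x \<in> S then \<phi> x else 0)" for x
  have \<psi>: "integrable lborel \<psi>"
    unfolding \<psi>_def[abs_def] by (rule integrable_restrict_compact_support[OF assms])
  then have [measurable]: "\<psi> \<in> borel_measurable borel"
    using borel_measurable_integrable by force
  have "integrable (distr lborel borel ((+) w)) \<psi>"
    using \<psi> by (simp add: lborel_distr_plus)
  then have \<psi>': "integrable lborel (\<lambda>x. \<psi> (w + x))"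
    by (subst (asm) integrable_distr_eq) auto
  have "integral\<^sup>L lborel \<psi> = integral\<^sup>L (distr lborel borel ((+) w)) \<psi>"
    by (simp add: lborel_distr_plus)
  also have "\<dots> = integral\<^sup>L lborel (\<lambda>x. \<psi> (w + x))"
    using \<psi> by (subst integral_distr) auto
  finally have "integral UNIV (\<lambda>x. \<psi> (w + x)) = integral UNIV \<psi>"
    using integral_lborel[OF \<psi>] integral_lborel[OF \<psi>'] by simp
  then show ?thesis
    using integral_restrict_UNIV[of S \<phi>] integral_restrict_UNIV[of "{x. w + x \<in> S}" "\<lambda>x. \<phi> (w + x)"]
    by (simp add: \<psi>_def[abs_def])
qed

text \<open>The cone at a vertex moved to the origin: \<open>F\<close> are the facets through it,
  and \<open>e i\<close> is the edge direction leaving facet \<open>i\<close>. The entry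
  \<open>- 1\<close> is due to the normals pointing outward.\<close>

locale vertex_cone = indep_family u F for u :: "'d::{finite,linorder} \<Rightarrow> real ^ 'n" and F +
  fixes e :: "'d \<Rightarrow> real ^ 'n"
  assumes dual: "\<And>i j. i \<in> F \<Longrightarrow> j \<in> F \<Longrightarrow> u i \<bullet> e j = (if i = j then - 1 else 0)"
    and spanning: "\<And>w. (\<And>i. i \<in> F \<Longrightarrow> u i \<bullet> w = 0) \<Longrightarrow> w = 0"
    and card_F: "card F = CARD('n)"

sublocale vertex_cone \<subseteq> dual_frame "\<lambda>i. - u i" e F
proof
  fix x
  have "x - (\<Sum>i\<in>F. (- u i \<bullet> x) *\<^sub>R e i) = 0"
  proof (rule spanning)
    fix j assume j: "j \<in> F"
    have "u j \<bullet> (\<Sum>i\<in>F. (- u i \<bullet> x) *\<^sub>R e i) = (\<Sum>i\<in>F. if i = j then u j \<bullet> x else 0)"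
      unfolding inner_sum_right using j by (intro sum.cong) (auto simp: dual)
    then show "u j \<bullet> (x - (\<Sum>i\<in>F. (- u i \<bullet> x) *\<^sub>R e i)) = 0"
      using j by (simp add: inner_diff_right)
  qed
  then show "x = (\<Sum>i\<in>F. (- u i \<bullet> x) *\<^sub>R e i)"
    by simp
qed (auto simp: dual)

context vertex_cone
begin

text \<open>The character attached to \<open>a\<close>, evaluated at the point with edge coordinates
  \<open>m\<close>; by \<open>inner_comb_cone_point\<close> its exponent is, up to sign, an inner
  product with \<open>comb a\<close>.\<close>

definition lattice_weight :: "('d \<Rightarrow> nat) \<Rightarrow> ('d \<Rightarrow> real) \<Rightarrow> complex"
  where "lattice_weight m a = (\<Prod>i\<in>F. unit_root a i ^ m i)"

lemma lattice_weight_eq: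
  "lattice_weight m a = e2pi (\<Sum>i\<in>F. real (m i) * a i)"
proof -
  have "unit_root a i ^ m i = e2pi (real (m i) * a i)" for i
    unfolding unit_root_def by (subst exp_of_nat_mult[symmetric]) (simp add: mult_ac)
  then show ?thesis
    by (simp add: lattice_weight_def exp_sum sum_distrib_left)
qed

lemma inner_cone_point:
  "j \<in> F \<Longrightarrow> u j \<bullet> (\<Sum>i\<in>F. a i *\<^sub>R e i) = - a j"
  by (simp add: inner_sum_right dual if_distrib cong: if_cong)

lemma inner_comb_cone_point:
  "comb a \<bullet> (\<Sum>i\<in>F. real (m i) *\<^sub>R e i) = - (\<Sum>i\<in>F. real (m i) * a i)"
  by (simp add: inner_sum_left inner_cone_point sum_negf mult.commute)

text \<open>The coefficients are minus the inner products with the dual vectors \<open>e i\<close>;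
  what remains is orthogonal to all \<open>e j\<close> and hence to itself.\<close>

lemma comb_exists: "\<exists>b. y = comb b"
proof
  define w where "w = y - (\<Sum>i\<in>F. (- (e i \<bullet> y)) *\<^sub>R u i)"
  have "w \<bullet> e j = 0" if "j \<in> F" for j
  proof -
    have *: "(\<Sum>i\<in>F. (- (e i \<bullet> y)) *\<^sub>R u i) \<bullet> e j = (\<Sum>i\<in>F. if i = j then e j \<bullet> y else 0)"
      unfolding inner_sum_left using that by (intro sum.cong) (auto simp: dual)
    show ?thesis
      unfolding w_def inner_diff_left * using that by (simp add: inner_commute)
  qed
  then have "w \<bullet> w = 0"
    by (subst (2) expansion[of w]) (simp add: inner_sum_right)
  then show "y = (\<Sum>i\<in>F. (- (e i \<bullet> y)) *\<^sub>R u i)"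
    by (simp add: w_def)
qed

text \<open>Orthogonality of the characters of the finite group on the points of the lattice generated by
  the edge vectors.\<close>

lemma sum_lattice_weight:
  "(\<Sum>a\<in>fract_coords u F. lattice_weight m a) =
    (if (\<Sum>i\<in>F. real (m i) *\<^sub>R e i) \<in> int_lattice then of_nat (card (fract_coords u F)) else 0)"
proof (cases "(\<Sum>i\<in>F. real (m i) *\<^sub>R e i) \<in> int_lattice")
  case True
  have "lattice_weight m a = 1" if "a \<in> fract_coords u F" for a
  proof -
    have "comb a \<in> int_lattice"
      using that by (simp add: fract_coords_def)
    then have "- (\<Sum>i\<in>F. real (m i) * a i) \<in> \<int>"
      unfolding inner_comb_cone_point[symmetric] using True by (rule int_lattice_inner)
    then show ?thesis
      unfolding lattice_weight_eq exp_2pi_eq_1_iff by simp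
  qed
  then show ?thesis
    using True by simp
next
  case False
  \<comment> \<open>Some coordinate \<open>z $ j\<close> is not an integer. The class of the
    \<open>j\<close>-th unit vector then has a character value other than 1 at \<open>z\<close>, and
    translation by this class permutes the group, which forces the sum to be 0.\<close>
  define z where "z = (\<Sum>i\<in>F. real (m i) *\<^sub>R e i)"
  obtain j where j: "z $ j \<notin> \<int>"
    using False by (auto simp: z_def int_lattice_def)
  obtain b where b: "axis j 1 = comb b"
    using comb_exists by blast
  have axis: "axis j 1 \<in> int_lattice"
    by (auto simp: int_lattice_def axis_def)
  define c where "c = (\<lambda>i. if i \<in> F then frac (b i) else 0)"
  have c: "c \<in> fract_coords u F"
    unfolding c_def using axis b by (intro frac_in_fract_coords) simp
  have shift: "lattice_weight m a = e2pi (\<Sum>i\<in>F. real (m i) * a' i)"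
    if "\<And>i. i \<in> F \<Longrightarrow> a i - a' i \<in> \<int>" for a a'
    unfolding lattice_weight_eq
  proof (rule exp_2pi_int_diff)
    have "(\<Sum>i\<in>F. real (m i) * a i) - (\<Sum>i\<in>F. real (m i) * a' i) = (\<Sum>i\<in>F. real (m i) * (a i - a' i))"
      by (simp add: sum_subtractf right_diff_distrib)
    also have "\<dots> \<in> \<int>"
      using that by (intro Ints_sum Ints_mult) auto
    finally show "(\<Sum>i\<in>F. real (m i) * a i) - (\<Sum>i\<in>F. real (m i) * a' i) \<in> \<int>" .
  qed
  have "lattice_weight m c = e2pi (\<Sum>i\<in>F. real (m i) * b i)"
    by (rule shift) (simp add: c_def frac_def)
  also have "(\<Sum>i\<in>F. real (m i) * b i) = - (z $ j)"
    using inner_comb_cone_point[of b m] by (simp add: b[symmetric] z_def[symmetric] inner_axis')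
  finally have c1: "lattice_weight m c \<noteq> 1"
    using j by (simp add: exp_2pi_eq_1_iff del: of_real_minus)
  define \<sigma> where "\<sigma> a = (\<lambda>i. if i \<in> F then frac (a i + c i) else 0)" for a
  have "\<sigma> ` fract_coords u F \<subseteq> fract_coords u F"
  proof safe
    fix a assume "a \<in> fract_coords u F"
    with c have "(\<Sum>i\<in>F. (a i + c i) *\<^sub>R u i) \<in> int_lattice"
      by (auto simp: fract_coords_def scaleR_add_left sum.distrib intro: int_lattice_add)
    then show "\<sigma> a \<in> fract_coords u F"
      unfolding \<sigma>_def by (rule frac_in_fract_coords)
  qed
  moreover have inj: "inj_on \<sigma> (fract_coords u F)"
  proof (rule inj_onI, rule ext)
    fix a a' i assume a: "a \<in> fract_coords u F" "a' \<in> fract_coords u F" "\<sigma> a = \<sigma> a'"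
    show "a i = a' i"
    proof (cases "i \<in> F")
      case True
      then have "frac (a i + c i) = frac (a' i + c i)"
        using fun_cong[OF a(3), of i] by (simp add: \<sigma>_def)
      then have "a i - a' i = of_int (\<lfloor>a i + c i\<rfloor> - \<lfloor>a' i + c i\<rfloor>)"
        by (simp add: frac_def)
      moreover have "\<bar>a i - a' i\<bar> < 1"
        using a(1,2) True by (auto simp: fract_coords_def abs_if) (smt (verit))+
      ultimately have "\<lfloor>a i + c i\<rfloor> - \<lfloor>a' i + c i\<rfloor> = 0"
        by linarith
      with \<open>a i - a' i = _\<close> show ?thesis
        by simp
    qed (use a in \<open>auto simp: fract_coords_def\<close>)
  qed
  ultimately have "\<sigma> ` fract_coords u F = fract_coords u F"
    by (intro endo_inj_surj finite_fract_coords)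
  then have "(\<Sum>a\<in>fract_coords u F. lattice_weight m a) = (\<Sum>a\<in>fract_coords u F. lattice_weight m (\<sigma> a))"
    using sum.reindex[OF inj, of "lattice_weight m"] by (simp add: o_def)
  also have "\<dots> = (\<Sum>a\<in>fract_coords u F. lattice_weight m c * lattice_weight m a)"
  proof (intro sum.cong refl)
    fix a
    have "lattice_weight m (\<sigma> a) = e2pi (\<Sum>i\<in>F. real (m i) * (a i + c i))"
      by (rule shift) (simp add: \<sigma>_def frac_def)
    then show "lattice_weight m (\<sigma> a) = lattice_weight m c * lattice_weight m a"
      by (simp add: lattice_weight_eq distrib_left sum.distrib exp_add)
  qed
  also have "\<dots> = lattice_weight m c * (\<Sum>a\<in>fract_coords u F. lattice_weight m a)"
    by (simp add: sum_distrib_left)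
  finally have "(1 - lattice_weight m c) * (\<Sum>a\<in>fract_coords u F. lattice_weight m a) = 0"
    by (simp add: left_diff_distrib)
  with c1 False show ?thesis
    by simp
qed

text \<open>A lattice point \<open>k\<close> of the cone has edge coordinates
  \<open>- (u i \<bullet> k)\<close>, which are natural numbers because the \<open>u i\<close> are
  integral. Not every natural combination of the edge vectors is a lattice point; the average over
  the characters selects those that are. The bound \<open>\<rho> < R\<close> restricts the
  coordinates to a finite box.\<close>

lemma lattice_sum_eq:
  fixes \<phi> :: "real ^ 'n \<Rightarrow> complex" and R N :: nat
  assumes "vanishes \<rho> \<phi>" "\<rho> < real R" "N \<ge> 1"
  shows "(\<Sum>k | k \<in> int_lattice \<and> k \<in> orthant \<and> \<phi> (k /\<^sub>R real N) \<noteq> 0. \<phi> (k /\<^sub>R real N))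
    = (1 / of_nat (card (fract_coords u F))) *
      (\<Sum>a\<in>fract_coords u F. \<Sum>m\<in>index_box F (R * N).
        (\<Prod>i\<in>F. unit_root a i ^ m i) * \<phi> (\<Sum>i\<in>F. (real (m i) / real N) *\<^sub>R e i))"
proof -
  define z where "z m = (\<Sum>i\<in>F. real (m i) *\<^sub>R e i)" for m
  define c where "c = (of_nat (card (fract_coords u F)) :: complex)"
  have "(\<lambda>_. 0) \<in> fract_coords u F"
    by (auto simp: fract_coords_def int_lattice_def)
  then have c: "c \<noteq> 0"
    using finite_fract_coords by (auto simp: c_def)
  have z: "(\<Sum>i\<in>F. (real (m i) / real N) *\<^sub>R e i) = z m /\<^sub>R real N" for m
    by (simp add: z_def scaleR_sum_right divide_inverse mult.commute)
  have inner_z: "u j \<bullet> z m = - real (m j)" if "j \<in> F" for j m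
    using that by (simp add: z_def inner_cone_point)
  have "(\<Sum>a\<in>fract_coords u F. \<Sum>m\<in>index_box F (R * N).
        (\<Prod>i\<in>F. unit_root a i ^ m i) * \<phi> (z m /\<^sub>R real N))
      = (\<Sum>m\<in>index_box F (R * N). (\<Sum>a\<in>fract_coords u F. lattice_weight m a) * \<phi> (z m /\<^sub>R real N))"
    by (subst sum.swap) (simp add: lattice_weight_def sum_distrib_right)
  also have "\<dots> = c * (\<Sum>m\<in>index_box F (R * N). if z m \<in> int_lattice then \<phi> (z m /\<^sub>R real N) else 0)"
    unfolding sum_lattice_weight sum_distrib_left by (intro sum.cong) (auto simp: z_def c_def)
  also have "(\<Sum>m\<in>index_box F (R * N). if z m \<in> int_lattice then \<phi> (z m /\<^sub>R real N) else 0)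
      = (\<Sum>m\<in>{m \<in> index_box F (R * N). z m \<in> int_lattice \<and> \<phi> (z m /\<^sub>R real N) \<noteq> 0}. \<phi> (z m /\<^sub>R real N))"
    by (intro sum.mono_neutral_cong_right) auto
  also have "\<dots> = (\<Sum>k | k \<in> int_lattice \<and> k \<in> orthant \<and> \<phi> (k /\<^sub>R real N) \<noteq> 0. \<phi> (k /\<^sub>R real N))"
  proof (rule sum.reindex_bij_witness[where i = "\<lambda>k i. if i \<in> F then nat \<lfloor>- (u i \<bullet> k)\<rfloor> else 0" and j = z])
    fix m assume m: "m \<in> {m \<in> index_box F (R * N). z m \<in> int_lattice \<and> \<phi> (z m /\<^sub>R real N) \<noteq> 0}"
    show "(\<lambda>i. if i \<in> F then nat \<lfloor>- (u i \<bullet> z m)\<rfloor> else 0) = m"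
      using m by (auto simp: fun_eq_iff inner_z index_box_def)
    show "z m \<in> {k. k \<in> int_lattice \<and> k \<in> orthant \<and> \<phi> (k /\<^sub>R real N) \<noteq> 0}"
      using m by (auto simp: orthant_def inner_z)
  next
    fix k assume k: "k \<in> {k. k \<in> int_lattice \<and> k \<in> orthant \<and> \<phi> (k /\<^sub>R real N) \<noteq> 0}"
    define m where "m = (\<lambda>i. if i \<in> F then nat \<lfloor>- (u i \<bullet> k)\<rfloor> else 0)"
    have m: "real (m i) = - (u i \<bullet> k)" if "i \<in> F" for i
    proof -
      have "- (u i \<bullet> k) \<in> \<int>" "0 \<le> - (u i \<bullet> k)"
        using k that int_lattice_inner[OF lattice, of k i] by (auto simp: orthant_def)
      then show ?thesis
        using that by (auto simp: m_def elim: Ints_cases)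
    qed
    have zm: "z m = k"
      by (subst expansion[of k]) (simp add: z_def m)
    show "z (\<lambda>i. if i \<in> F then nat \<lfloor>- (u i \<bullet> k)\<rfloor> else 0) = k"
      using zm by (simp add: m_def)
    have "m i < R * N" if "i \<in> F" for i
    proof -
      have "\<not> - u i \<bullet> (k /\<^sub>R real N) > \<rho>"
        using assms(1) k that unfolding vanishes_def by blast
      then have "real (m i) / real N < real R"
        using assms(2) that by (simp add: m divide_inverse mult.commute)
      then have "real (m i) < real (R * N)"
        using assms(3) by (simp add: field_simps)
      then show ?thesis
        by linarith
    qed
    then have "m \<in> {m \<in> index_box F (R * N). z m \<in> int_lattice \<and> \<phi> (z m /\<^sub>R real N) \<noteq> 0}"
      using k zm by (auto simp: index_box_def) (simp add: m_def)
    then show "(\<lambda>i. if i \<in> F then nat \<lfloor>- (u i \<bullet> k)\<rfloor> else 0)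
        \<in> {m \<in> index_box F (R * N). z m \<in> int_lattice \<and> \<phi> (z m /\<^sub>R real N) \<noteq> 0}"
      by (simp add: m_def)
  qed simp
  finally show ?thesis
    using c by (simp add: z c_def)
qed

text \<open>Filtering the list used by \<open>multi_deriv\<close> keeps the derivatives along the
  edges in the same order as those in \<open>h\<close>.\<close>

definition indices :: "'d list"
  where "indices = filter (\<lambda>i. i \<in> F) (sorted_list_of_set UNIV)"

lemma indices [simp]: "distinct indices" "set indices = F" "length indices = CARD('n)"
proof -
  show 1: "distinct indices" "set indices = F"
    by (auto simp: indices_def)
  show "length indices = CARD('n)"
    using distinct_card[OF 1(1)] 1(2) card_F by simp
qed

definition lattice_sum :: "nat \<Rightarrow> (real ^ 'n \<Rightarrow> complex) \<Rightarrow> complex"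
  where "lattice_sum N \<phi> = (1 / of_nat N) ^ CARD('n)
    * (\<Sum>k | k \<in> int_lattice \<and> k \<in> orthant \<and> \<phi> (k /\<^sub>R real N) \<noteq> 0. \<phi> (k /\<^sub>R real N))"

lemma lattice_sum_Euler_Maclaurin:
  fixes \<phi> :: "real ^ 'n \<Rightarrow> complex" and R :: nat
  assumes "K \<ge> 2" "Ck (K * CARD('n)) \<phi>" "vanishes \<rho> \<phi>" "\<rho> < real R"
  shows "\<exists>C\<ge>0. \<forall>N\<ge>1. norm (lattice_sum N \<phi> - (1 / of_nat (card (fract_coords u F))) *
      (\<Sum>a\<in>fract_coords u F. todd_sum R K indices (unit_root a) N \<phi> 0)) \<le> C / real N ^ (K - 1)"
proof -
  define A where "A = fract_coords u F"
  let ?X = "\<lambda>a N x. twisted_sum R indices (unit_root a) N \<phi> x"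
  let ?Y = "\<lambda>a N x. todd_sum R K indices (unit_root a) N \<phi> x"
  have "\<exists>C\<ge>0. \<forall>N\<ge>1. \<forall>x\<in>orthant. norm (?X a N x - ?Y a N x) \<le> C / real N ^ (K - 1)" for a
    by (rule Euler_Maclaurin_orthant[of indices K \<phi> \<rho> R]) (use assms in auto)
  moreover have "0 \<in> orthant"
    by (simp add: orthant_def)
  ultimately have "\<exists>C\<ge>0. \<forall>N\<ge>1. norm (?X a N 0 - ?Y a N 0) \<le> C / real N ^ (K - 1)" for a
    by blast
  then obtain C where C: "\<And>a. C a \<ge> 0" "\<And>a N. N \<ge> 1 \<Longrightarrow> norm (?X a N 0 - ?Y a N 0) \<le> C a / real N ^ (K - 1)"
    by metis
  define c where "c = card A"
  have eq: "lattice_sum N \<phi> = (1 / of_nat c) * (\<Sum>a\<in>A. ?X a N 0)" if "N \<ge> 1" for N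
    unfolding lattice_sum_def lattice_sum_eq[OF assms(3,4) that] twisted_sum_def c_def A_def
    by (simp add: sum_distrib_left mult.left_commute add_0_left)
  show ?thesis
  proof (intro exI[of _ "(1 / real c) * (\<Sum>a\<in>A. C a)"] conjI allI impI)
    fix N :: nat assume N: "N \<ge> 1"
    have "norm ((1 / of_nat c) * (\<Sum>a\<in>A. ?X a N 0 - ?Y a N 0)) \<le> (1 / real c) * (\<Sum>a\<in>A. C a / real N ^ (K - 1))"
      unfolding norm_mult using C(2)[OF N] by (intro mult_mono sum_norm_le) (auto simp: norm_divide intro: sum_nonneg)
    then show "norm (lattice_sum N \<phi> - (1 / of_nat (card (fract_coords u F))) *
        (\<Sum>a\<in>fract_coords u F. todd_sum R K indices (unit_root a) N \<phi> 0))
        \<le> (1 / real c) * (\<Sum>a\<in>A. C a) / real N ^ (K - 1)"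
      unfolding eq[OF N] A_def[symmetric] c_def[symmetric]
      by (simp add: sum_subtractf right_diff_distrib sum_divide_distrib diff_divide_distrib mult.commute)
  qed (use C(1) in \<open>auto intro!: divide_nonneg_nonneg sum_nonneg\<close>)
qed

end

section \<open>Integrals over the cone as values of the iterated primitive\<close>

context vertex_cone
begin

abbreviation primitive :: "nat \<Rightarrow> (real ^ 'n \<Rightarrow> complex) \<Rightarrow> real ^ 'n \<Rightarrow> complex"
  where "primitive R \<equiv> iterated_primitive R indices"

lemma zero_in_fract_coords: "(\<lambda>_. 0) \<in> fract_coords u F"
  by (auto simp: fract_coords_def int_lattice_def)

lemma card_fract_coords_pos: "card (fract_coords u F) > 0"
  using zero_in_fract_coords by (auto simp: card_gt_0_iff)

lemma closed_orthant: "closed orthant"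
  using closed_halfspaces[of F u "\<lambda>_. 0"] by (simp add: orthant_def)

text \<open>Both sides are limits of the same Riemann sums, which yields the change of variables to the
  edge coordinates, including the value of the Jacobian.\<close>

lemma integral_orthant:
  fixes \<phi> :: "real ^ 'n \<Rightarrow> complex" and R :: nat
  assumes "Ck (2 * CARD('n)) \<phi>" "vanishes \<rho> \<phi>" "\<rho> < real R"
    and supp: "\<And>x. norm x > \<rho>' \<Longrightarrow> \<phi> x = 0"
  shows "integral orthant \<phi> = primitive R \<phi> 0 / of_nat (card (fract_coords u F))"
proof -
  define \<psi> where "\<psi> x = (if x \<in> orthant then \<phi> x else 0)" for x
  define c where "c = (of_nat (card (fract_coords u F)) :: complex)"
  \<comment> \<open>Truncation at \<open>K = 2\<close> already gives an error of order
    \<open>1 / N\<close>, enough for the limit.\<close>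
  define E where "E N = (1 / c) * (\<Sum>a\<in>fract_coords u F. todd_sum R 2 indices (unit_root a) N \<phi> 0)" for N
  have cont: "continuous_on UNIV \<phi>"
    using Ck_imp_continuous[OF assms(1)] .
  obtain B where B: "B \<ge> 0" "\<And>x. norm (\<phi> x) \<le> B"
    using bounded_compact_support[OF cont supp] by blast
  have [measurable]: "orthant \<in> sets borel" "\<phi> \<in> borel_measurable borel"
    using closed_orthant borel_measurable_continuous_onI[OF cont] by auto
  \<comment> \<open>The boundary hyperplanes of the cone, where cutting off \<open>\<phi>\<close>
    may create discontinuities.\<close>
  define Z where "Z = (\<Union>i\<in>F. {x. u i \<bullet> x = 0})"
  have lim0: "(\<lambda>N. (1 / of_nat N) ^ CARD('n) * (\<Sum>k | k \<in> int_lattice \<and> \<psi> (k /\<^sub>R real N) \<noteq> 0. \<psi> (k /\<^sub>R real N)))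
    \<longlonglongrightarrow> integral UNIV \<psi>"
  proof (rule Riemann_sum_tendsto)
    show "norm (\<psi> x) \<le> B" for x
      using B by (simp add: \<psi>_def)
    show "\<psi> x = 0" if "norm x > \<rho>'" for x
      using supp[OF that] by (simp add: \<psi>_def)
    have "{x. u i \<bullet> x = 0} \<in> null_sets lborel" if "i \<in> F" for i
    proof -
      have "u i \<noteq> 0"
        using dual[OF that that] by auto
      then have "negligible {x. u i \<bullet> x = 0}"
        by (intro negligible_hyperplane) simp
      moreover have "{x. u i \<bullet> x = 0} \<in> sets lborel"
        using closed_hyperplane[of "u i" 0] by simp
      ultimately show ?thesis
        by (simp add: negligible_iff_null_sets null_sets_completion_iff)
    qed
    then show "Z \<in> null_sets lborel"
      unfolding Z_def by (intro null_sets_UN') (auto intro: countable_finite)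
    show "isCont \<psi> x" if "x \<notin> Z" for x
    proof (cases "x \<in> orthant")
      case True
      define U where "U = (\<Inter>i\<in>F. {y. u i \<bullet> y < 0})"
      have U: "open U" "x \<in> U" "U \<subseteq> orthant"
        using True that
        by (auto simp: U_def orthant_def Z_def open_halfspace_lt intro!: open_INT
            intro: less_imp_le order.not_eq_order_implies_strict)
      then have "\<forall>\<^sub>F y in nhds x. \<psi> y = \<phi> y"
        by (auto simp: eventually_nhds \<psi>_def intro!: exI[of _ U])
      then show ?thesis
        using cont by (subst isCont_cong) (auto simp: continuous_on_eq_continuous_at)
    next
      case False
      then have "\<forall>\<^sub>F y in nhds x. \<psi> y = 0"
        using closed_orthant by (auto simp: eventually_nhds \<psi>_def closed_def intro!: exI[of _ "- orthant"])
      then show ?thesis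
        by (subst isCont_cong[where g = "\<lambda>_. 0"]) auto
    qed
  qed (auto simp: \<psi>_def)
  have "(1 / of_nat N) ^ CARD('n) * (\<Sum>k | k \<in> int_lattice \<and> \<psi> (k /\<^sub>R real N) \<noteq> 0. \<psi> (k /\<^sub>R real N)) = lattice_sum N \<phi>"
    if "N \<ge> 1" for N
  proof -
    have "k /\<^sub>R real N \<in> orthant \<longleftrightarrow> k \<in> orthant" for k
      using that by (auto simp: orthant_def mult_le_0_iff)
    then show ?thesis
      unfolding lattice_sum_def \<psi>_def by (intro arg_cong2[of _ _ _ _ "(*)"] sum.cong) auto
  qed
  then have lim1: "(\<lambda>N. lattice_sum N \<phi>) \<longlonglongrightarrow> integral UNIV \<psi>"
    by (intro Lim_transform_eventually[OF lim0] eventually_sequentiallyI[of 1])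
  obtain C where C: "\<And>N. N \<ge> 1 \<Longrightarrow> norm (lattice_sum N \<phi> - E N) \<le> C / real N"
    using lattice_sum_Euler_Maclaurin[of 2 \<phi> \<rho> R] assms(1-3)
    unfolding E_def c_def by auto
  have "(\<lambda>N. lattice_sum N \<phi> - E N) \<longlonglongrightarrow> 0"
    by (rule Lim_null_comparison[OF _ lim_const_over_n[of C]])
      (auto intro!: eventually_sequentiallyI[of 1] C)
  moreover have "E \<longlonglongrightarrow> (1 / c) *
        (\<Sum>a\<in>fract_coords u F. \<Sum>\<alpha>\<in>index_box F 2.
          (\<Prod>i\<in>F. todd_coeff (unit_root a i) (\<alpha> i) * 0 ^ \<alpha> i)
            * foldr (\<lambda>i. dir_deriv (e i) ^^ \<alpha> i) indices (primitive R \<phi>) 0)"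
    unfolding E_def todd_sum_def indices by (intro tendsto_intros lim_const_over_n)
  \<comment> \<open>In the limit only \<open>\<alpha> = 0\<close> remains, where
    \<open>0 ^ 0 = 1\<close>. Its coefficient vanishes unless every \<open>unit_root a i\<close>
    with \<open>i \<in> F\<close> is 1, so only \<open>a = 0\<close> counts.\<close>
  moreover have "(\<Sum>\<alpha>\<in>index_box F 2.
          (\<Prod>i\<in>F. todd_coeff (unit_root a i) (\<alpha> i) * 0 ^ \<alpha> i)
            * foldr (\<lambda>i. dir_deriv (e i) ^^ \<alpha> i) indices (primitive R \<phi>) 0)
      = (if a = (\<lambda>_. 0) then primitive R \<phi> 0 else 0)" if a: "a \<in> fract_coords u F" for a
  proof -
    have "(\<Prod>i\<in>F. todd_coeff (unit_root a i) (\<alpha> i) * 0 ^ \<alpha> i)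
            * foldr (\<lambda>i. dir_deriv (e i) ^^ \<alpha> i) indices (primitive R \<phi>) 0
        = (if \<alpha> = (\<lambda>_. 0) then (if a = (\<lambda>_. 0) then primitive R \<phi> 0 else 0) else 0)"
      if \<alpha>: "\<alpha> \<in> index_box F 2" for \<alpha>
    proof (cases "\<alpha> = (\<lambda>_. 0)")
      case True
      have "(\<Prod>i\<in>F. todd_coeff (unit_root a i) 0) = (if a = (\<lambda>_. 0) then 1 else 0)"
      proof (cases "a = (\<lambda>_. 0)")
        case True
        then show ?thesis
          by (simp add: unit_root_def todd_coeff_0)
      next
        case False
        then obtain i where i: "i \<in> F" "a i \<noteq> 0"
          using a by (auto simp: fract_coords_def fun_eq_iff)
        have "a i \<notin> \<int>"
          using fract_coords_not_Int[OF a i(2)] .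
        then have "todd_coeff (unit_root a i) 0 = 0"
          by (simp add: todd_coeff_0 unit_root_def exp_2pi_eq_1_iff)
        with i False show ?thesis
          by (auto intro!: prod_zero)
      qed
      moreover have "foldr (\<lambda>i. dir_deriv (e i) ^^ 0) js f = f" for js and f :: "real ^ 'n \<Rightarrow> complex"
        by (induction js) auto
      ultimately show ?thesis
        using True by simp
    next
      case False
      then obtain i where "\<alpha> i \<noteq> 0"
        by auto
      moreover from this have "i \<in> F"
        using \<alpha> by (auto simp: index_box_def)
      ultimately have "(\<Prod>i\<in>F. todd_coeff (unit_root a i) (\<alpha> i) * 0 ^ \<alpha> i) = 0"
        by (intro prod_zero) auto
      with False show ?thesis
        by simp
    qed
    moreover have "(\<lambda>_. 0) \<in> index_box F 2"
      by (auto simp: index_box_def)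
    ultimately show ?thesis
      by (simp cong: sum.cong)
  qed
  then have "(1 / c) * (\<Sum>a\<in>fract_coords u F. \<Sum>\<alpha>\<in>index_box F 2.
          (\<Prod>i\<in>F. todd_coeff (unit_root a i) (\<alpha> i) * 0 ^ \<alpha> i)
            * foldr (\<lambda>i. dir_deriv (e i) ^^ \<alpha> i) indices (primitive R \<phi>) 0) = primitive R \<phi> 0 / c"
    using zero_in_fract_coords by (simp cong: sum.cong)
  ultimately have "(\<lambda>N. (lattice_sum N \<phi> - E N) + E N) \<longlonglongrightarrow> 0 + primitive R \<phi> 0 / c"
    by (intro tendsto_add) auto
  then have "integral UNIV \<psi> = primitive R \<phi> 0 / c"
    using LIMSEQ_unique[OF lim1] by simp
  then show ?thesis
    by (simp add: c_def \<psi>_def[abs_def] integral_restrict_UNIV)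
qed

text \<open>The apex of the shifted cone is the vector \<open>w\<close> with
  \<open>u i \<bullet> w = h i\<close>; translation by it moves the cone back to the origin. The
  coordinates on the support grow by at most \<open>\<delta>\<close>, so one \<open>R\<close> serves
  for all small \<open>h\<close>.\<close>

lemma integral_shifted_orthant:
  fixes \<phi> :: "real ^ 'n \<Rightarrow> complex" and R :: nat
  assumes "Ck (2 * CARD('n)) \<phi>" "vanishes \<rho> \<phi>" "\<rho> + \<delta> < real R"
    and supp: "\<And>x. norm x > \<rho>' \<Longrightarrow> \<phi> x = 0" and h: "\<And>i. \<bar>h i\<bar> \<le> \<delta>"
  shows "integral {x. \<forall>i\<in>F. u i \<bullet> x \<le> h i} \<phi>
    = primitive R \<phi> (- (\<Sum>i\<in>F. h i *\<^sub>R e i)) / of_nat (card (fract_coords u F))"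
proof -
  define w where "w = - (\<Sum>i\<in>F. h i *\<^sub>R e i)"
  have uw: "u i \<bullet> w = h i" if "i \<in> F" for i
    using that by (simp add: w_def inner_cone_point)
  have "integral {x. w + x \<in> {x. \<forall>i\<in>F. u i \<bullet> x \<le> h i}} (\<lambda>x. \<phi> (w + x))
      = integral {x. \<forall>i\<in>F. u i \<bullet> x \<le> h i} \<phi>"
    by (rule integral_translation[OF Ck_imp_continuous[OF assms(1)] supp closed_halfspaces])
  moreover have "{x. w + x \<in> {x. \<forall>i\<in>F. u i \<bullet> x \<le> h i}} = orthant"
    by (auto simp: orthant_def inner_add_right uw)
  moreover have "integral orthant (\<lambda>x. \<phi> (w + x))
      = primitive R (\<lambda>x. \<phi> (w + x)) 0 / of_nat (card (fract_coords u F))"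
  proof (rule integral_orthant)
    show "vanishes (\<rho> + \<delta>) (\<lambda>x. \<phi> (w + x))"
      unfolding vanishes_def
    proof (intro allI impI)
      fix x assume "\<exists>i\<in>F. - u i \<bullet> x > \<rho> + \<delta>"
      then obtain i where i: "i \<in> F" "- u i \<bullet> x > \<rho> + \<delta>"
        by blast
      then have "- u i \<bullet> (w + x) > \<rho>"
        using h[of i] by (simp add: inner_add_right uw)
      then show "\<phi> (w + x) = 0"
        using assms(2) i(1) unfolding vanishes_def by blast
    qed
    show "\<phi> (w + x) = 0" if "norm x > \<rho>' + norm w" for x
      using norm_triangle_ineq4[of "w + x" w] that by (intro supp) auto
  qed (use assms in \<open>auto intro: Ck_shift\<close>)
  moreover have "primitive R (\<lambda>x. \<phi> (w + x)) 0 = primitive R \<phi> w"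
    by (simp add: iterated_primitive_def foldr_line_int_shift)
  ultimately show ?thesis
    by (simp add: w_def)
qed

end

section \<open>From derivatives in the shift parameters to derivatives along the edges\<close>

lemma foldr_dir_deriv_uminus_divide:
  fixes f :: "'a::real_normed_vector \<Rightarrow> complex"
  assumes "Ck (length ws) f"
  shows "foldr dir_deriv (map uminus ws) (\<lambda>x. f x / c)
    = (\<lambda>x. (- 1) ^ length ws * foldr dir_deriv ws f x / c)"
  using assms
proof (induction ws)
  case (Cons w ws)
  define g where "g = foldr dir_deriv ws f"
  have "Ck (Suc 0) g"
    unfolding g_def using Cons.prems by (intro Ck_foldr_dir_deriv) (simp del: Ck.simps)
  then have g: "(g has_derivative (\<lambda>w. dir_deriv w g x)) (at x)" for x
    by (intro has_derivative_dir_deriv) simp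
  have 1: "dir_deriv (- w) (\<lambda>x. (- 1) ^ length ws * g x / c) x = (- 1) ^ length ws * dir_deriv (- w) g x / c" for x
    by (intro has_derivative_imp_dir_deriv(2) has_derivative_mult_right g
        bounded_linear.has_derivative[OF bounded_linear_divide])
  have 2: "dir_deriv (- w) g x = - dir_deriv w g x" for x
    using linear_neg[OF has_derivative_linear[OF g]] .
  have "Ck (length ws) f"
    by (rule Ck_mono[OF Cons.prems]) simp
  then have IH: "foldr dir_deriv (map uminus ws) (\<lambda>x. f x / c) = (\<lambda>x. (- 1) ^ length ws * g x / c)"
    unfolding g_def by (rule Cons.IH)
  show ?case
    by (rule ext) (simp add: IH 1 2 flip: g_def)
qed simp

lemma foldr_dir_deriv_comp_linear:
  assumes "linear L"
  shows "foldr (\<lambda>i. dir_deriv (w i) ^^ \<alpha> i) js (\<lambda>h. f (L h))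
    = (\<lambda>h. foldr (\<lambda>i. dir_deriv (L (w i)) ^^ \<alpha> i) js f (L h))"
proof -
  have comp: "dir_deriv v (\<lambda>h. g (L h)) = (\<lambda>h. dir_deriv (L v) g (L h))" for v g
    using dir_deriv_comp_affine[OF assms, of v g 0] by simp
  have pow: "(dir_deriv v ^^ n) (\<lambda>h. g (L h)) = (\<lambda>h. (dir_deriv (L v) ^^ n) g (L h))" for v n g
    by (induction n) (simp_all add: comp)
  show ?thesis
    by (induction js) (auto simp: pow)
qed

lemma foldr_dir_deriv_zero:
  assumes "j \<in> set js" "w j = 0" "\<alpha> j \<noteq> 0"
  shows "foldr (\<lambda>i. dir_deriv (w i) ^^ \<alpha> i) js f = (\<lambda>x. 0)"
  using assms(1)
proof (induction js)
  case (Cons i js)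
  have const: "(dir_deriv v ^^ n) (\<lambda>x. 0) = (\<lambda>x. 0)" for v n
    by (induction n) (auto simp: dir_deriv_const)
  show ?case
  proof (cases "i = j")
    case True
    obtain n where "\<alpha> j = Suc n"
      using assms(3) by (cases "\<alpha> j") auto
    then show ?thesis
      using True assms(2) by simp
  next
    case False
    then show ?thesis
      using Cons const by simp
  qed
qed simp

lemma multi_deriv_eq_foldr:
  "multi_deriv \<alpha> g = foldr (\<lambda>i. dir_deriv (axis i 1) ^^ \<alpha> i) (sorted_list_of_set UNIV) g"
  by (simp add: multi_deriv_def partial_deriv_eq_dir_deriv)

lemma finite_multi_indices: "finite {\<alpha> :: 'd::finite \<Rightarrow> nat. sum \<alpha> UNIV < M}"
proof (rule finite_subset)
  show "{\<alpha> :: 'd \<Rightarrow> nat. sum \<alpha> UNIV < M} \<subseteq> index_box UNIV M"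
  proof
    fix \<alpha> :: "'d \<Rightarrow> nat" assume "\<alpha> \<in> {\<alpha>. sum \<alpha> UNIV < M}"
    moreover have "\<alpha> i \<le> sum \<alpha> UNIV" for i
      by (rule member_le_sum) auto
    ultimately show "\<alpha> \<in> index_box UNIV M"
      by (auto simp: index_box_def intro: le_less_trans)
  qed
qed (simp_all add: finite_index_box)

context vertex_cone
begin

text \<open>Displacement of the apex when the hyperplanes move by \<open>h\<close>: the solution of
  \<open>u i \<bullet> w = h $ i\<close> for \<open>i \<in> F\<close>.\<close>

definition vertex_shift :: "(real, 'd) vec \<Rightarrow> real ^ 'n"
  where "vertex_shift h = - (\<Sum>i\<in>F. h $ i *\<^sub>R e i)"

lemma linear_vertex_shift: "linear vertex_shift"
  by (rule linearI) (simp_all add: vertex_shift_def scaleR_add_left sum.distrib scaleR_sum_right)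

lemma vertex_shift_axis: "vertex_shift (axis i 1) = (if i \<in> F then - e i else 0)"
proof -
  have "(\<Sum>j\<in>F. axis i 1 $ j *\<^sub>R e j) = (\<Sum>j\<in>F. if j = i then e i else 0)"
    by (intro sum.cong) (auto simp: axis_def)
  then show ?thesis
    by (simp add: vertex_shift_def)
qed

lemma multi_deriv_vertex_shift_eq:
  "multi_deriv \<alpha> (\<lambda>h. J (vertex_shift h)) = (\<lambda>h. foldr
    (\<lambda>i. dir_deriv (vertex_shift (axis i 1)) ^^ \<alpha> i) (sorted_list_of_set UNIV) J (vertex_shift h))"
  unfolding multi_deriv_eq_foldr by (rule foldr_dir_deriv_comp_linear[OF linear_vertex_shift])

text \<open>The apex does not feel the hyperplanes outside \<open>F\<close>, so a derivative in such
  a parameter is a derivative in direction 0.\<close>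

lemma multi_deriv_vertex_shift_0:
  assumes "i \<notin> F" "\<alpha> i \<noteq> 0"
  shows "multi_deriv \<alpha> (\<lambda>h. J (vertex_shift h)) = (\<lambda>h. 0)"
  unfolding multi_deriv_vertex_shift_eq using assms
  by (subst foldr_dir_deriv_zero[of i]) (auto simp: vertex_shift_axis)

text \<open>Each derivative in \<open>h $ i\<close> acts as minus a derivative along
  \<open>e i\<close>. The resulting sign cancels the one in the powers of \<open>- 1 / N\<close> in
  \<open>todd_sum\<close>.\<close>

lemma multi_deriv_vertex_shift:
  fixes J :: "real ^ 'n \<Rightarrow> complex"
  assumes \<alpha>: "\<And>i. i \<notin> F \<Longrightarrow> \<alpha> i = 0" and J: "Ck (sum \<alpha> UNIV) J"
  shows "multi_deriv \<alpha> (\<lambda>h. J (vertex_shift h) / c) = (\<lambda>h. (- 1) ^ (sum \<alpha> UNIV)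
    * foldr (\<lambda>i. dir_deriv (e i) ^^ \<alpha> i) indices J (vertex_shift h) / c)"
proof -
  define ws where "ws = concat (map (\<lambda>i. replicate (\<alpha> i) (e i)) indices)"
  let ?J = "\<lambda>x. J x / c"
  have "length ws = sum_list (map \<alpha> indices)"
    by (simp add: ws_def length_concat_replicate)
  also have "\<dots> = (\<Sum>i\<in>F. \<alpha> i)"
    by (subst sum_list_distinct_conv_sum_set) auto
  also have "\<dots> = sum \<alpha> UNIV"
    using \<alpha> by (intro sum.mono_neutral_left) auto
  finally have len: "length ws = sum \<alpha> UNIV" .
  have "foldr (\<lambda>i. dir_deriv (vertex_shift (axis i 1)) ^^ \<alpha> i) (sorted_list_of_set UNIV) ?J
      = foldr (\<lambda>i. if i \<in> F then dir_deriv (- e i) ^^ \<alpha> i else id) (sorted_list_of_set UNIV) ?J"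
    by (intro foldr_cong) (auto simp: vertex_shift_axis \<alpha> fun_eq_iff)
  also have "\<dots> = foldr (\<lambda>i. dir_deriv (- e i) ^^ \<alpha> i) indices ?J"
    by (simp add: indices_def foldr_filter)
  also have "\<dots> = foldr dir_deriv (map uminus ws) ?J"
    by (simp add: foldr_dir_deriv_concat ws_def map_concat o_def)
  also have "\<dots> = (\<lambda>x. (- 1) ^ length ws * foldr dir_deriv ws J x / c)"
    by (rule foldr_dir_deriv_uminus_divide) (simp add: len J)
  finally show ?thesis
    unfolding multi_deriv_vertex_shift_eq[of \<alpha> ?J]
    by (simp add: foldr_dir_deriv_concat len flip: ws_def)
qed

text \<open>\<open>todd_sum\<close> runs over a box of multi-indices, the expansion over those of
  total order below \<open>M\<close>. Box terms of order at least \<open>M\<close> go into the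
  error; terms missing from the box involve an index outside \<open>F\<close>, so their derivative
  vanishes. That vanishing is also exported, so that the coefficients of such multi-indices can be
  exchanged later.\<close>

lemma cone_expansion:
  fixes \<phi> :: "real ^ 'n \<Rightarrow> complex"
  assumes Ck\<phi>: "Ck ((M + 2) * CARD('n)) \<phi>" and supp: "\<And>x. norm x > \<rho>' \<Longrightarrow> \<phi> x = 0"
  obtains \<delta> G where "\<delta> > 0" "Ck M G"
    "\<And>h. (\<And>i. \<bar>h $ i\<bar> \<le> \<delta>) \<Longrightarrow> integral {x. \<forall>i\<in>F. u i \<bullet> x \<le> h $ i} \<phi> = G h"
    "\<And>\<alpha> i. i \<notin> F \<Longrightarrow> \<alpha> i \<noteq> 0 \<Longrightarrow> multi_deriv \<alpha> G 0 = 0"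
    "(\<lambda>N. lattice_sum N \<phi> - (\<Sum>\<alpha> | sum \<alpha> UNIV < M.
            (\<Sum>a\<in>fract_coords u F. \<Prod>i\<in>UNIV. todd_coeff (unit_root a i) (\<alpha> i))
              * (1 / of_nat N ^ (sum \<alpha> UNIV)) * multi_deriv \<alpha> G 0))
      \<in> O(\<lambda>N. 1 / of_nat N ^ M)"
proof -
  \<comment> \<open>\<open>\<rho>'\<close> bounds the norm on the support, and \<open>\<rho>\<close>
    then bounds the coordinates \<open>- u i \<bullet> x\<close> by Cauchy-Schwarz.\<close>
  define \<rho> where "\<rho> = (\<Sum>i\<in>F. norm (u i)) * \<bar>\<rho>'\<bar>"
  \<comment> \<open>The extra room admits all shifts with \<open>\<bar>h $ i\<bar> \<le> 1\<close>,
    so that \<open>\<delta> = 1\<close> will do.\<close>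
  define R where "R = nat \<lceil>\<rho> + 1\<rceil> + 1"
  have R: "\<rho> + 1 < real R"
    unfolding R_def by linarith
  have van: "vanishes \<rho> \<phi>"
    unfolding vanishes_def
  proof (intro allI impI supp)
    fix x assume "\<exists>i\<in>F. - u i \<bullet> x > \<rho>"
    then obtain i where i: "i \<in> F" "- u i \<bullet> x > \<rho>"
      by blast
    show "norm x > \<rho>'"
    proof (rule ccontr)
      assume "\<not> norm x > \<rho>'"
      then have "norm x \<le> \<bar>\<rho>'\<bar>"
        by linarith
      have "- u i \<bullet> x \<le> norm (u i) * norm x"
        using norm_cauchy_schwarz[of "- u i" x] by simp
      also have "\<dots> \<le> \<rho>"
        unfolding \<rho>_def using i(1) \<open>norm x \<le> _\<close>
        by (intro mult_mono member_le_sum sum_nonneg) auto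
      finally show False
        using i(2) by simp
    qed
  qed
  define c where "c = (of_nat (card (fract_coords u F)) :: complex)"
  have c: "c \<noteq> 0"
    using card_fract_coords_pos by (auto simp: c_def)
  define G where "G = (\<lambda>h. primitive R \<phi> (vertex_shift h) / c)"
  have CkP: "Ck ((M + 2) * CARD('n)) (primitive R \<phi>)"
    unfolding iterated_primitive_def by (intro Ck_foldr_line_int Ck\<phi>)
  have "M * 1 \<le> (M + 2) * CARD('n)"
    by (intro mult_le_mono) (auto simp: Suc_le_eq)
  then have "Ck M (primitive R \<phi>)"
    by (intro Ck_mono[OF CkP]) simp
  then have "Ck M (\<lambda>h. primitive R \<phi> (vertex_shift h))"
    using Ck_comp_affine[of vertex_shift M "primitive R \<phi>" 0] linear_vertex_shift
    by (simp add: linear_conv_bounded_linear)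
  then have CkG: "Ck M G"
    unfolding G_def by (rule Ck_bounded_linear_comp[OF bounded_linear_divide])
  define D where "D \<alpha> = foldr (\<lambda>i. dir_deriv (e i) ^^ \<alpha> i) indices (primitive R \<phi>) 0" for \<alpha>
  have deriv0: "multi_deriv \<alpha> G 0 = 0" if "i \<notin> F" "\<alpha> i \<noteq> 0" for \<alpha> i
    unfolding G_def using multi_deriv_vertex_shift_0[of i \<alpha> "\<lambda>x. primitive R \<phi> x / c"] that by simp
  \<comment> \<open>The summation formula needs \<open>K \<ge> 2\<close> and leaves an error of
    order \<open>K - 1 = M + 1\<close>, which is more than enough.\<close>
  define K where "K = M + 2"
  have ord: "sum \<alpha> UNIV \<le> K * CARD('n)" if "\<alpha> \<in> index_box F K" for \<alpha>
  proof -
    have "sum \<alpha> UNIV = (\<Sum>i\<in>F. \<alpha> i)"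
      using that by (intro sum.mono_neutral_right) (auto simp: index_box_def)
    also have "\<dots> \<le> (\<Sum>i\<in>F. K)"
      using that by (intro sum_mono) (auto simp: index_box_def less_imp_le)
    finally show ?thesis
      by (simp add: card_F mult.commute)
  qed
  have deriv: "multi_deriv \<alpha> G 0 = (- 1) ^ (sum \<alpha> UNIV) * D \<alpha> / c" if \<alpha>: "\<alpha> \<in> index_box F K" for \<alpha>
  proof -
    have \<alpha>0: "\<And>i. i \<notin> F \<Longrightarrow> \<alpha> i = 0"
      using \<alpha> by (auto simp: index_box_def)
    have "Ck (sum \<alpha> UNIV) (primitive R \<phi>)"
      using ord[OF \<alpha>] by (auto intro: Ck_mono[OF CkP] simp: K_def)
    from multi_deriv_vertex_shift[of \<alpha> "primitive R \<phi>" c, OF \<alpha>0 this] show ?thesis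
      by (simp add: G_def D_def vertex_shift_def)
  qed
  define t where "t \<alpha> = (\<Sum>a\<in>fract_coords u F. \<Prod>i\<in>UNIV. todd_coeff (unit_root a i) (\<alpha> i))" for \<alpha>
  define T where "T \<alpha> = t \<alpha> * multi_deriv \<alpha> G 0" for \<alpha>
  define E where "E N = (\<Sum>\<alpha>\<in>index_box F K. T \<alpha> * (1 / of_nat N ^ (sum \<alpha> UNIV)))" for N :: nat
  have E_eq: "(1 / c) * (\<Sum>a\<in>fract_coords u F. todd_sum R K indices (unit_root a) N \<phi> 0) = E N" for N
  proof -
    have "(\<Prod>i\<in>F. todd_coeff (unit_root a i) (\<alpha> i) * (- 1 / of_nat N) ^ \<alpha> i) * D \<alpha> / c
        = (\<Prod>i\<in>UNIV. todd_coeff (unit_root a i) (\<alpha> i)) * multi_deriv \<alpha> G 0 * (1 / of_nat N ^ (sum \<alpha> UNIV))"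
      if "a \<in> fract_coords u F" "\<alpha> \<in> index_box F K" for a \<alpha>
    proof -
      have "(\<Prod>i\<in>UNIV. todd_coeff (unit_root a i) (\<alpha> i)) = (\<Prod>i\<in>F. todd_coeff (unit_root a i) (\<alpha> i))"
        using that by (intro prod.mono_neutral_right)
          (auto simp: index_box_def fract_coords_def unit_root_def todd_coeff_0)
      moreover have "sum \<alpha> UNIV = (\<Sum>i\<in>F. \<alpha> i)"
        using that by (intro sum.mono_neutral_right) (auto simp: index_box_def)
      moreover have "(\<Prod>i\<in>F. (- 1 / of_nat N :: complex) ^ \<alpha> i)
          = (- 1) ^ (\<Sum>i\<in>F. \<alpha> i) / of_nat N ^ (\<Sum>i\<in>F. \<alpha> i)"
        by (subst power_sum[symmetric]) (rule power_divide)
      ultimately show ?thesis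
        unfolding deriv[OF that(2)] prod.distrib by (simp add: mult_ac)
    qed
    then have "(\<Sum>a\<in>fract_coords u F. \<Sum>\<alpha>\<in>index_box F K.
          (\<Prod>i\<in>F. todd_coeff (unit_root a i) (\<alpha> i) * (- 1 / of_nat N) ^ \<alpha> i) * D \<alpha> / c)
       = (\<Sum>a\<in>fract_coords u F. \<Sum>\<alpha>\<in>index_box F K.
          (\<Prod>i\<in>UNIV. todd_coeff (unit_root a i) (\<alpha> i)) * multi_deriv \<alpha> G 0 * (1 / of_nat N ^ (sum \<alpha> UNIV)))"
      by (intro sum.cong) auto
    also have "\<dots> = E N"
      unfolding E_def T_def t_def sum_distrib_right by (rule sum.swap)
    finally show ?thesis
      by (simp add: todd_sum_def D_def sum_divide_distrib)
  qed
  obtain C where C: "C \<ge> 0" "\<And>N. N \<ge> 1 \<Longrightarrow> norm (lattice_sum N \<phi> - E N) \<le> C / real N ^ (K - 1)"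
    using lattice_sum_Euler_Maclaurin[of K \<phi> \<rho> R] Ck\<phi> van R
    unfolding E_eq[symmetric] c_def by (auto simp: K_def)
  define A where "A = {\<alpha> \<in> index_box F K. sum \<alpha> UNIV < M}"
  define B where "B = {\<alpha> \<in> index_box F K. \<not> sum \<alpha> UNIV < M}"
  define H where "H N = (\<Sum>\<alpha> | sum \<alpha> UNIV < M. T \<alpha> * (1 / of_nat N ^ (sum \<alpha> UNIV)))" for N :: nat
  have H: "H N = (\<Sum>\<alpha>\<in>A. T \<alpha> * (1 / of_nat N ^ (sum \<alpha> UNIV)))" for N
    unfolding H_def
  proof (rule sum.mono_neutral_right)
    show "\<forall>\<alpha>\<in>{\<alpha>. sum \<alpha> UNIV < M} - A. T \<alpha> * (1 / of_nat N ^ (sum \<alpha> UNIV)) = 0"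
    proof
      fix \<alpha> :: "'d \<Rightarrow> nat" assume \<alpha>: "\<alpha> \<in> {\<alpha>. sum \<alpha> UNIV < M} - A"
      have "\<alpha> i < K" for i
        using \<alpha> member_le_sum[of i UNIV \<alpha>] by (auto simp: K_def)
      then obtain i where "i \<notin> F" "\<alpha> i \<noteq> 0"
        using \<alpha> by (auto simp: A_def index_box_def)
      then show "T \<alpha> * (1 / of_nat N ^ (sum \<alpha> UNIV)) = 0"
        by (simp add: T_def deriv0)
    qed
  qed (auto simp: A_def finite_multi_indices)
  have EH: "norm (E N - H N) \<le> (\<Sum>\<alpha>\<in>B. norm (T \<alpha>)) / real N ^ M" if N: "N \<ge> 1" for N
  proof -
    have AB: "index_box F K = A \<union> B" "A \<inter> B = {}" "finite A" "finite B"
      by (auto simp: A_def B_def)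
    have "E N - H N = (\<Sum>\<alpha>\<in>B. T \<alpha> * (1 / of_nat N ^ (sum \<alpha> UNIV)))"
      unfolding E_def H AB(1) by (subst sum.union_disjoint[OF AB(3,4,2)]) simp
    also have "norm \<dots> \<le> (\<Sum>\<alpha>\<in>B. norm (T \<alpha>) * (1 / real N ^ M))"
    proof (rule sum_norm_le)
      fix \<alpha> assume "\<alpha> \<in> B"
      then have "1 / real N ^ (sum \<alpha> UNIV) \<le> 1 / real N ^ M"
        using N by (intro divide_left_mono power_increasing) (auto simp: B_def)
      then show "norm (T \<alpha> * (1 / of_nat N ^ (sum \<alpha> UNIV))) \<le> norm (T \<alpha>) * (1 / real N ^ M)"
        unfolding norm_mult by (intro mult_left_mono) (auto simp: norm_divide norm_power)
    qed
    also have "\<dots> = (\<Sum>\<alpha>\<in>B. norm (T \<alpha>)) / real N ^ M"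
      by (simp add: sum_divide_distrib)
    finally show ?thesis .
  qed
  have "(\<lambda>N. lattice_sum N \<phi> - H N) \<in> O(\<lambda>N. 1 / of_nat N ^ M)"
  proof (rule bigoI[where c = "C + (\<Sum>\<alpha>\<in>B. norm (T \<alpha>))"], rule eventually_sequentiallyI[of 1])
    fix N :: nat assume N: "N \<ge> 1"
    have "C / real N ^ (K - 1) \<le> C / real N ^ M"
      using N C(1) by (intro divide_left_mono power_increasing) (auto simp: K_def)
    then have "norm (lattice_sum N \<phi> - E N) \<le> C / real N ^ M"
      using C(2)[OF N] by linarith
    then have "norm (lattice_sum N \<phi> - H N) \<le> C / real N ^ M + (\<Sum>\<alpha>\<in>B. norm (T \<alpha>)) / real N ^ M"
      using EH[OF N] by (rule norm_diff_triangle_le)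
    then show "norm (lattice_sum N \<phi> - H N) \<le> (C + (\<Sum>\<alpha>\<in>B. norm (T \<alpha>))) * norm (1 / of_nat N ^ M :: complex)"
      by (simp add: norm_divide norm_power add_divide_distrib)
  qed
  then have main: "(\<lambda>N. lattice_sum N \<phi> - (\<Sum>\<alpha> | sum \<alpha> UNIV < M. t \<alpha> * (1 / of_nat N ^ (sum \<alpha> UNIV)) * multi_deriv \<alpha> G 0))
      \<in> O(\<lambda>N. 1 / of_nat N ^ M)"
    unfolding H_def T_def by (simp add: mult_ac)
  have int: "integral {x. \<forall>i\<in>F. u i \<bullet> x \<le> h $ i} \<phi> = G h" if "\<And>i. \<bar>h $ i\<bar> \<le> 1" for h :: "(real, 'd) vec"
    unfolding G_def c_def vertex_shift_def
  proof (rule integral_shifted_orthant)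
    show "Ck (2 * CARD('n)) \<phi>"
      by (rule Ck_mono[OF Ck\<phi>]) simp
  qed (use van R supp that in auto)
  show thesis
    by (rule that[OF zero_less_one CkG int deriv0 main[unfolded t_def]])
qed

end

section \<open>A partition of unity adapted to the facets\<close>

text \<open>A truncated power, of class \<open>Ck k\<close>; this suffices since the number of
  derivatives needed is known in advance.\<close>

definition ramp :: "nat \<Rightarrow> real \<Rightarrow> real"
  where "ramp k x = max 0 x ^ Suc k"

lemma ramp_has_derivative: "(ramp (Suc k) has_real_derivative real (k + 2) * ramp k x) (at x)"
proof (cases x "0 :: real" rule: linorder_cases)
  case less
  have "((\<lambda>x. 0 :: real) has_real_derivative 0) (at x)"
    by simp
  moreover have "\<forall>\<^sub>F y in nhds x. 0 = ramp (Suc k) y"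
    using eventually_nhds_in_open[of "{..<0}" x] less by (auto simp: ramp_def elim!: eventually_mono)
  ultimately show ?thesis
    using less by (subst (asm) DERIV_cong_ev) (auto simp: ramp_def)
next
  case equal
  \<comment> \<open>At 0 the difference quotient is bounded by \<open>ramp k\<close>, which tends to
    0.\<close>
  have "((\<lambda>h. (ramp (Suc k) (0 + h) - ramp (Suc k) 0) / h) \<longlongrightarrow> 0) (at 0)"
  proof (rule Lim_null_comparison)
    show "\<forall>\<^sub>F h in at 0. norm ((ramp (Suc k) (0 + h) - ramp (Suc k) 0) / h) \<le> ramp k h"
    proof (rule always_eventually, rule allI)
      fix h :: real
      show "norm ((ramp (Suc k) (0 + h) - ramp (Suc k) 0) / h) \<le> ramp k h"
        by (cases "h > 0") (auto simp: ramp_def max_def power2_eq_square)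
    qed
    have "((\<lambda>h. max 0 h ^ Suc k) \<longlongrightarrow> max 0 0 ^ Suc k) (at (0 :: real))"
      by (intro tendsto_intros)
    then show "(ramp k \<longlongrightarrow> 0) (at 0)"
      by (simp add: ramp_def[abs_def])
  qed
  then show ?thesis
    using equal by (simp add: DERIV_def ramp_def)
next
  case greater
  have "((\<lambda>x. x ^ Suc (Suc k)) has_real_derivative real (k + 2) * x ^ Suc k) (at x)"
    by (rule DERIV_cong[OF DERIV_pow]) simp
  moreover have "\<forall>\<^sub>F y in nhds x. y ^ Suc (Suc k) = ramp (Suc k) y"
    using eventually_nhds_in_open[of "{0<..}" x] greater by (auto simp: ramp_def max_def elim!: eventually_mono)
  ultimately show ?thesis
    using greater by (subst (asm) DERIV_cong_ev) (auto simp: ramp_def max_def)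
qed

lemma Ck_ramp: "Ck k (ramp k)"
proof (induction k)
  case 0
  show ?case
    by (auto simp: ramp_def intro!: continuous_intros)
next
  case (Suc k)
  show ?case
  proof (rule Ck_SucI)
    show "(ramp (Suc k) has_derivative (\<lambda>w. (real (k + 2) * ramp k x) * w)) (at x)" for x
      using ramp_has_derivative[of k x] by (simp add: has_field_derivative_def)
    show "Ck k (\<lambda>x. (real (k + 2) * ramp k x) * w)" for w
      by (intro Ck_mult Ck_const Suc)
  qed
qed

text \<open>The inner \<open>ramp\<close> is 0 up to \<open>x = 0\<close> and at least 1 from
  \<open>x = 1\<close> on, so the value falls from 1 to 0 on the unit interval.\<close>

definition cutoff :: "nat \<Rightarrow> real \<Rightarrow> real"
  where "cutoff k x = ramp k (1 - ramp k x)"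

lemma Ck_cutoff: "Ck k (cutoff k)"
  unfolding cutoff_def[abs_def] by (rule Ck_comp_real[OF Ck_ramp]) (intro Ck_diff Ck_const Ck_ramp)

lemma cutoff_eq_1: "x \<le> 0 \<Longrightarrow> cutoff k x = 1"
  by (simp add: cutoff_def ramp_def)

lemma cutoff_eq_0:
  assumes "x \<ge> 1"
  shows "cutoff k x = 0"
proof -
  have "ramp k x \<ge> 1"
    using one_le_power[OF assms, of "Suc k"] assms unfolding ramp_def max_def by auto
  then show ?thesis
    by (simp add: cutoff_def ramp_def)
qed

text \<open>One summand in the expansion of the product of \<open>\<chi> i + (1 - \<chi> i)\<close>
  over all facets, where for \<open>r > 0\<close> the cutoff \<open>\<chi> i\<close> is 1 while the
  slack \<open>b i - u i \<bullet> x\<close> is at most \<open>r\<close>, and 0 once it reaches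
  \<open>2 * r\<close>. A violated constraint has negative slack and counts as near.\<close>

definition facet_bump :: "nat \<Rightarrow> real \<Rightarrow> ('d::finite \<Rightarrow> real ^ 'n) \<Rightarrow> ('d \<Rightarrow> real) \<Rightarrow> 'd set \<Rightarrow> real ^ 'n \<Rightarrow> complex"
  where "facet_bump k r u b S x =
    (\<Prod>i\<in>S. complex_of_real (cutoff k ((b i - u i \<bullet> x) / r - 1)))
      * (\<Prod>i\<in>UNIV - S. complex_of_real (1 - cutoff k ((b i - u i \<bullet> x) / r - 1)))"

lemma sum_facet_bump: "(\<Sum>S\<in>UNIV. facet_bump k r u b S x) = 1"
proof -
  have "1 = (\<Prod>i\<in>UNIV. complex_of_real (cutoff k ((b i - u i \<bullet> x) / r - 1))
      + complex_of_real (1 - cutoff k ((b i - u i \<bullet> x) / r - 1)))"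
    by simp
  also have "\<dots> = (\<Sum>S\<in>Pow UNIV. facet_bump k r u b S x)"
    unfolding facet_bump_def by (rule prod_add) simp
  finally show ?thesis
    by simp
qed

lemma facet_bump_support:
  assumes "facet_bump k r u b S x \<noteq> 0" "r > 0"
  shows "i \<in> S \<Longrightarrow> u i \<bullet> x > b i - 2 * r" "i \<notin> S \<Longrightarrow> u i \<bullet> x < b i - r"
proof -
  show "u i \<bullet> x > b i - 2 * r" if "i \<in> S"
  proof (rule ccontr)
    assume "\<not> u i \<bullet> x > b i - 2 * r"
    then have "(b i - u i \<bullet> x) / r - 1 \<ge> 1"
      using assms(2) by (simp add: field_simps)
    then have "facet_bump k r u b S x = 0"
      using that by (auto simp: facet_bump_def cutoff_eq_0 intro!: disjI1 bexI[of _ i])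
    with assms(1) show False
      by simp
  qed
  show "u i \<bullet> x < b i - r" if "i \<notin> S"
  proof (rule ccontr)
    assume "\<not> u i \<bullet> x < b i - r"
    then have "(b i - u i \<bullet> x) / r - 1 \<le> 0"
      using assms(2) by (simp add: field_simps)
    then have "facet_bump k r u b S x = 0"
      using that by (auto simp: facet_bump_def cutoff_eq_1 intro!: disjI2 bexI[of _ i])
    with assms(1) show False
      by simp
  qed
qed

lemma Ck_facet_bump: "Ck k (facet_bump k r u b S)"
proof -
  have 1: "Ck k (\<lambda>x. cutoff k ((b i - u i \<bullet> x) / r - 1))" for i
  proof -
    have "bounded_linear (\<lambda>x. - (u i \<bullet> x) / r)"
      by (intro bounded_linear_divide[THEN bounded_linear_compose] bounded_linear_minus bounded_linear_inner_right)
    from Ck_comp_affine[OF this Ck_cutoff, where a = "b i / r - 1"] show ?thesis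
      by (simp add: diff_divide_distrib algebra_simps)
  qed
  show ?thesis
    unfolding facet_bump_def[abs_def]
    by (intro Ck_mult Ck_prod Ck_bounded_linear_comp[OF bounded_linear_of_real] Ck_diff Ck_const 1)
qed

section \<open>Locality and additivity of iterated derivatives\<close>

lemma foldr_dir_deriv_cong_open:
  assumes "open U" "\<And>x. x \<in> U \<Longrightarrow> f x = g x" "x \<in> U"
  shows "foldr dir_deriv ws f x = foldr dir_deriv ws g x"
  using assms(3)
proof (induction ws arbitrary: x)
  case (Cons w ws)
  then show ?case
    using dir_deriv_cong_open[OF assms(1), of "foldr dir_deriv ws f" "foldr dir_deriv ws g"] by simp
qed (use assms in auto)

lemma foldr_dir_deriv_sum:
  assumes "\<And>s. s \<in> A \<Longrightarrow> Ck (length ws) (g s)"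
  shows "foldr dir_deriv ws (\<lambda>x. \<Sum>s\<in>A. g s x) = (\<lambda>x. \<Sum>s\<in>A. foldr dir_deriv ws (g s) x)"
  using assms
proof (induction ws)
  case (Cons w ws)
  have "Ck (length ws) (g s)" if "s \<in> A" for s
    by (rule Ck_mono[OF Cons.prems[OF that]]) simp
  then have IH: "foldr dir_deriv ws (\<lambda>x. \<Sum>s\<in>A. g s x) = (\<lambda>x. \<Sum>s\<in>A. foldr dir_deriv ws (g s) x)"
    by (rule Cons.IH)
  have "Ck (Suc 0) (foldr dir_deriv ws (g s))" if "s \<in> A" for s
    using Cons.prems[OF that] by (intro Ck_foldr_dir_deriv) (simp del: Ck.simps)
  then have "(foldr dir_deriv ws (g s) has_derivative (\<lambda>v. dir_deriv v (foldr dir_deriv ws (g s)) x)) (at x)"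
    if "s \<in> A" for s x
    using that by (intro has_derivative_dir_deriv) simp
  then have "dir_deriv w (\<lambda>x. \<Sum>s\<in>A. foldr dir_deriv ws (g s) x) x
      = (\<Sum>s\<in>A. dir_deriv w (foldr dir_deriv ws (g s)) x)" for x
    by (intro has_derivative_imp_dir_deriv(2) has_derivative_sum)
  then show ?case
    by (simp add: IH fun_eq_iff)
qed simp

text \<open>The list of directions does not depend on \<open>g\<close>, so facts about words of
  directions carry over to \<open>multi_deriv\<close>.\<close>

lemma multi_deriv_directions:
  fixes \<alpha> :: "'d::{finite,linorder} \<Rightarrow> nat"
  obtains ws where "length ws = sum \<alpha> UNIV"
    "\<And>g :: (real, 'd) vec \<Rightarrow> 'b::real_normed_vector. multi_deriv \<alpha> g = foldr dir_deriv ws g"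
proof
  define ws :: "(real, 'd) vec list" where
    "ws = concat (map (\<lambda>i. replicate (\<alpha> i) (axis i 1)) (sorted_list_of_set UNIV))"
  show "length ws = sum \<alpha> UNIV"
    by (simp add: ws_def length_concat_replicate sum_list_distinct_conv_sum_set)
  show "multi_deriv \<alpha> g = foldr dir_deriv ws g" for g :: "(real, 'd) vec \<Rightarrow> 'b"
    by (simp add: multi_deriv_eq_foldr foldr_dir_deriv_concat ws_def)
qed

lemma multi_deriv_cong_open:
  fixes f g :: "(real, 'd::{finite,linorder}) vec \<Rightarrow> 'b::real_normed_vector"
  assumes "open U" "\<And>x. x \<in> U \<Longrightarrow> f x = g x" "x \<in> U"
  shows "multi_deriv \<alpha> f x = multi_deriv \<alpha> g x"
proof (rule multi_deriv_directions[of \<alpha>])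
  fix ws assume "\<And>g :: (real, 'd) vec \<Rightarrow> 'b. multi_deriv \<alpha> g = foldr dir_deriv ws g"
  then show ?thesis
    using foldr_dir_deriv_cong_open[OF assms] by simp
qed

lemma multi_deriv_sum:
  fixes g :: "'s \<Rightarrow> (real, 'd::{finite,linorder}) vec \<Rightarrow> 'b::real_normed_vector"
  assumes "\<And>s. s \<in> A \<Longrightarrow> Ck (sum \<alpha> UNIV) (g s)"
  shows "multi_deriv \<alpha> (\<lambda>x. \<Sum>s\<in>A. g s x) = (\<lambda>x. \<Sum>s\<in>A. multi_deriv \<alpha> (g s) x)"
proof (rule multi_deriv_directions[of \<alpha>])
  fix ws assume "length ws = sum \<alpha> UNIV" "\<And>g :: (real, 'd) vec \<Rightarrow> 'b. multi_deriv \<alpha> g = foldr dir_deriv ws g"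
  then show ?thesis
    using foldr_dir_deriv_sum[of A ws g] assms by simp
qed

section \<open>Vertices of a simple lattice polytope\<close>

text \<open>The normals other than \<open>u j\<close> are too few to span the space, so some
  \<open>z \<noteq> 0\<close> is orthogonal to them. By the second hypothesis
  \<open>u j \<bullet> z \<noteq> 0\<close>, and \<open>z\<close> can be normalised.\<close>

lemma dual_basis_exists:
  fixes u :: "'d::finite \<Rightarrow> real ^ 'n"
  assumes card: "card F = CARD('n)" and span: "\<And>w. (\<And>i. i \<in> F \<Longrightarrow> u i \<bullet> w = 0) \<Longrightarrow> w = 0"
  obtains e where "\<And>i j. i \<in> F \<Longrightarrow> j \<in> F \<Longrightarrow> u i \<bullet> e j = (if i = j then - 1 else 0)"
proof -
  have "\<exists>e. \<forall>i\<in>F. u i \<bullet> e = (if i = j then - 1 else 0)" if j: "j \<in> F" for j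
  proof -
    have "dim (u ` (F - {j})) \<le> card (u ` (F - {j}))"
      by (rule dim_le_card') simp
    also have "\<dots> \<le> card (F - {j})"
      by (rule card_image_le) simp
    also have "\<dots> < DIM(real ^ 'n)"
      using card j by simp
    finally obtain z where z: "z \<noteq> 0" "\<And>y. y \<in> span (u ` (F - {j})) \<Longrightarrow> orthogonal z y"
      using orthogonal_to_subspace_exists by blast
    have z0: "u i \<bullet> z = 0" if "i \<in> F" "i \<noteq> j" for i
      using z(2)[of "u i"] that by (auto simp: orthogonal_def inner_commute intro: span_base)
    have "u j \<bullet> z \<noteq> 0"
      using span[of z] z0 z(1) by metis
    then have "u i \<bullet> ((- 1 / (u j \<bullet> z)) *\<^sub>R z) = (if i = j then - 1 else 0)" if "i \<in> F" for i
      using z0[OF that] by auto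
    then show ?thesis
      by blast
  qed
  then obtain e where "\<And>j. j \<in> F \<Longrightarrow> \<forall>i\<in>F. u i \<bullet> e j = (if i = j then - 1 else 0)"
    by metis
  then show thesis
    using that by blast
qed

locale simple_lattice_polytope =
  fixes \<Delta> :: "(real ^ 'n) set" and u :: "'d::{finite,linorder} \<Rightarrow> real ^ 'n" and c :: "'d \<Rightarrow> int"
  assumes lattice_polytope: "lattice_polytope \<Delta>"
    and simple: "simple_polytope \<Delta>"
    and full_dim: "aff_dim \<Delta> = int CARD('n)"
    and \<Delta>_eq: "\<Delta> = polyhedron_of u (\<lambda>i. real_of_int (c i))"
    and facets: "bij_betw (\<lambda>i. {x \<in> \<Delta>. u i \<bullet> x = real_of_int (c i)}) UNIV {S. S facet_of \<Delta>}"
    and primitive: "\<And>i. primitive_vector (u i)"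
begin

abbreviation b :: "'d \<Rightarrow> real"
  where "b i \<equiv> real_of_int (c i)"

lemma in_\<Delta>_iff: "x \<in> \<Delta> \<longleftrightarrow> (\<forall>i. u i \<bullet> x \<le> b i)"
  by (simp add: \<Delta>_eq polyhedron_of_def)

lemma compact_\<Delta>: "compact \<Delta>" and convex_\<Delta>: "convex \<Delta>"
  using simple by (auto simp: simple_polytope_def polytope_imp_compact polytope_imp_convex)

lemma u_lattice: "u i \<in> int_lattice"
  using primitive[of i] by (simp add: primitive_vector_def)

text \<open>The intersection of the polytope with supporting hyperplanes is a face. A nonempty
  compact convex face has an extreme point, and this is extreme in the whole polytope.\<close>

lemma extreme_point_exists:
  assumes "face_at u b S \<noteq> {}"
  obtains v where "v extreme_point_of \<Delta>" "v \<in> face_at u b S"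
proof -
  define K where "K = face_at u b S"
  \<comment> \<open>\<open>\<Delta>\<close> is inserted so that the intersection is also right for
    \<open>S = {}\<close>.\<close>
  define \<T> where "\<T> = insert \<Delta> ((\<lambda>i. \<Delta> \<inter> {x. u i \<bullet> x = b i}) ` S)"
  have "(\<Delta> \<inter> {x. u i \<bullet> x = b i}) face_of \<Delta>" for i
    by (rule face_of_Int_supporting_hyperplane_le[OF convex_\<Delta>]) (simp add: in_\<Delta>_iff)
  then have "T face_of \<Delta>" if "T \<in> \<T>" for T
    using that face_of_refl[OF convex_\<Delta>] by (auto simp: \<T>_def)
  then have "\<Inter> \<T> face_of \<Delta>"
    by (intro face_of_Inter) (auto simp: \<T>_def)
  moreover have "\<Inter> \<T> = K"
    by (auto simp: \<T>_def K_def face_at_def \<Delta>_eq)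
  ultimately have face: "K face_of \<Delta>"
    by simp
  then have "compact K" "convex K" "K \<noteq> {}"
    using assms compact_\<Delta> convex_\<Delta> by (auto simp: K_def face_of_imp_compact face_of_imp_convex)
  then obtain v where v: "v extreme_point_of K"
    using extreme_point_exists_convex by blast
  then have "v extreme_point_of \<Delta>"
    using face_of_trans[OF _ face, of "{v}"] by (simp add: face_of_singleton)
  moreover have "v \<in> face_at u b S"
    using v by (simp add: extreme_point_of_def K_def)
  ultimately show thesis
    by (rule that)
qed

text \<open>Extreme points of a convex hull belong to the generating set, so \<open>v\<close> is a
  lattice point. With \<open>F\<close> the set of all constraints active at \<open>v\<close>,
  simplicity at the face \<open>{v}\<close> gives both \<open>card F = CARD('n)\<close> and that
  these facets meet only in \<open>v\<close>; the latter makes the normals span.\<close>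

lemma vertex_exists:
  assumes "face_at u b S \<noteq> {}"
  obtains v F e where "S \<subseteq> F" "v \<in> int_lattice" "\<And>i. i \<in> F \<Longrightarrow> u i \<bullet> v = b i" "v \<in> \<Delta>" "vertex_cone u F e"
proof -
  obtain v where v: "v extreme_point_of \<Delta>" "v \<in> face_at u b S"
    using extreme_point_exists[OF assms] .
  have v\<Delta>: "v \<in> \<Delta>"
    using v(1) by (simp add: extreme_point_of_def)
  have "v \<in> int_lattice"
  proof -
    obtain V where "V \<subseteq> int_lattice" "\<Delta> = convex hull V"
      using lattice_polytope by (auto simp: lattice_polytope_def)
    then show ?thesis
      using v(1) extreme_point_of_convex_hull by blast
  qed
  define F where "F = {i. u i \<bullet> v = b i}"
  have "S \<subseteq> F"
    using v(2) by (auto simp: face_at_def F_def)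
  have "{v} face_of \<Delta>"
    using v(1) by (simp add: face_of_singleton)
  then have faces: "int (card {S. S facet_of \<Delta> \<and> {v} \<subseteq> S}) = aff_dim \<Delta> - aff_dim {v}"
      "{v} = \<Delta> \<inter> \<Inter> {S. S facet_of \<Delta> \<and> {v} \<subseteq> S}"
    using simple unfolding simple_polytope_def by blast+
  have facets_v: "{S. S facet_of \<Delta> \<and> {v} \<subseteq> S} = (\<lambda>i. {x \<in> \<Delta>. u i \<bullet> x = b i}) ` F"
    using facets v\<Delta> by (auto simp: bij_betw_def F_def)
  have "inj_on (\<lambda>i. {x \<in> \<Delta>. u i \<bullet> x = b i}) F"
    using facets by (auto simp: bij_betw_def intro: inj_on_subset)
  then have card: "card F = CARD('n)"
    using faces(1) unfolding facets_v by (simp add: card_image full_dim)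
  have span: "w = 0" if w: "\<And>i. i \<in> F \<Longrightarrow> u i \<bullet> w = 0" for w
  proof (rule ccontr)
    assume "w \<noteq> 0"
    \<comment> \<open>Near \<open>v\<close> the inactive constraints stay strict, so a small step
      orthogonal to all active normals would remain in the polytope and in all facets through
      \<open>v\<close>.\<close>
    define U where "U = (\<Inter>i\<in>- F. {x. u i \<bullet> x < b i})"
    have "open U"
      unfolding U_def by (intro open_INT) (auto simp: open_halfspace_lt)
    moreover have "v \<in> U"
      using v\<Delta> by (auto simp: U_def F_def in_\<Delta>_iff intro: order.not_eq_order_implies_strict)
    ultimately obtain \<epsilon> where \<epsilon>: "\<epsilon> > 0" "ball v \<epsilon> \<subseteq> U"
      by (auto simp: open_contains_ball)
    define t where "t = \<epsilon> / (2 * norm w)"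
    have t: "t > 0" "norm (t *\<^sub>R w) < \<epsilon>"
      using \<epsilon> \<open>w \<noteq> 0\<close> by (auto simp: t_def)
    have "v + t *\<^sub>R w \<in> \<Delta>"
    proof -
      have "dist v (v + t *\<^sub>R w) < \<epsilon>"
        using t by (simp add: dist_norm)
      then have "v + t *\<^sub>R w \<in> U"
        using \<epsilon>(2) by auto
      then have "u i \<bullet> (v + t *\<^sub>R w) \<le> b i" for i
        using w[of i] by (cases "i \<in> F") (auto simp: U_def F_def inner_add_right less_imp_le)
      then show ?thesis
        by (simp add: in_\<Delta>_iff)
    qed
    then have "v + t *\<^sub>R w \<in> \<Delta> \<inter> \<Inter> {S. S facet_of \<Delta> \<and> {v} \<subseteq> S}"
      unfolding facets_v using w by (auto simp: F_def inner_add_right)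
    then have "v + t *\<^sub>R w \<in> {v}"
      unfolding faces(2)[symmetric] .
    with t(1) \<open>w \<noteq> 0\<close> show False
      by simp
  qed
  obtain e where e: "\<And>i j. i \<in> F \<Longrightarrow> j \<in> F \<Longrightarrow> u i \<bullet> e j = (if i = j then - 1 else 0)"
    using dual_basis_exists[OF card span] by blast
  have cone: "vertex_cone u F e"
  proof
    fix a :: "'d \<Rightarrow> real" and j assume a: "(\<Sum>i\<in>F. a i *\<^sub>R u i) = 0" "j \<in> F"
    have "0 = (\<Sum>i\<in>F. a i *\<^sub>R u i) \<bullet> e j"
      by (simp add: a(1))
    also have "\<dots> = (\<Sum>i\<in>F. if i = j then - a j else 0)"
      unfolding inner_sum_left using a(2) by (intro sum.cong) (auto simp: e)
    also have "\<dots> = - a j"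
      using a(2) by simp
    finally show "a j = 0"
      by simp
  qed (use u_lattice e span card in auto)
  show thesis
    by (rule that[OF \<open>S \<subseteq> F\<close> \<open>v \<in> int_lattice\<close> _ v\<Delta> cone]) (simp add: F_def)
qed

lemma face_indep:
  assumes "E \<in> face_subsets u b"
  shows "indep_family u E"
proof -
  have "face_at u b E \<noteq> {}"
    using assms by (simp add: face_subsets_def)
  then show ?thesis
  proof (rule vertex_exists)
    fix F e assume "E \<subseteq> F" "vertex_cone u F e"
    then show ?thesis
      using indep_family.indep_subset[OF vertex_cone.axioms(1)] by metis
  qed
qed

text \<open>Terms of faces not containing the vertex vanish, as their Todd functions have no constant term.\<close>

lemma taylor_coeff_todd_symbol_at_vertex:
  assumes v: "v \<in> \<Delta>" "\<And>i. i \<in> F \<Longrightarrow> u i \<bullet> v = b i" and F: "vertex_cone u F e"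
    and \<alpha>: "\<And>i. i \<notin> F \<Longrightarrow> \<alpha> i = 0"
  shows "taylor_coeff (todd_symbol u b) \<alpha>
    = (\<Sum>a\<in>fract_coords u F. \<Prod>i\<in>UNIV. todd_coeff (unit_root a i) (\<alpha> i))"
proof -
  \<comment> \<open>Every subset of \<open>F\<close> indexes a nonempty face, since that face
    contains \<open>v\<close>.\<close>
  have "Pow F \<subseteq> face_subsets u b"
    using v by (auto simp: face_subsets_def face_at_def \<Delta>_eq)
  moreover have "(\<Sum>\<gamma>\<in>Gamma_sharp u E. \<Prod>i\<in>UNIV. todd_coeff (omega u E \<gamma> i) (\<alpha> i)) = 0"
    if E: "E \<in> face_subsets u b - Pow F" for E
  proof -
    interpret E: indep_family u E
      using E by (intro face_indep) simp
    obtain i where i: "i \<in> E" "i \<notin> F"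
      using E by auto
    have zero: "(\<Prod>i\<in>UNIV. todd_coeff (unit_root a i) (\<alpha> i)) = 0"
      if a: "a \<in> fract_coords u E" "\<forall>i\<in>E. a i \<noteq> 0" for a
    proof -
      have "a i \<notin> \<int>"
        using fract_coords_not_Int[OF a(1)] a(2) i(1) by blast
      then have "todd_coeff (unit_root a i) (\<alpha> i) = 0"
        using \<alpha>[OF i(2)] by (simp add: todd_coeff_0 unit_root_def exp_2pi_eq_1_iff)
      then show ?thesis
        by (auto intro!: prod_zero)
    qed
    show ?thesis
      by (subst E.sum_Gamma_sharp[where X = "\<lambda>\<omega>. \<Prod>i\<in>UNIV. todd_coeff (\<omega> i) (\<alpha> i)"], rule sum.neutral)
        (use zero in blast)
  qed
  ultimately have "taylor_coeff (todd_symbol u b) \<alpha>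
      = (\<Sum>E\<in>Pow F. \<Sum>\<gamma>\<in>Gamma_sharp u E. \<Prod>i\<in>UNIV. todd_coeff (omega u E \<gamma> i) (\<alpha> i))"
    unfolding taylor_coeff_todd_symbol by (intro sum.mono_neutral_right) auto
  also have "\<dots> = (\<Sum>a\<in>fract_coords u F. \<Prod>i\<in>UNIV. todd_coeff (unit_root a i) (\<alpha> i))"
    using F by (intro indep_family.sum_Gamma_sharp_subsets[where X = "\<lambda>\<omega>. \<Prod>i\<in>UNIV. todd_coeff (\<omega> i) (\<alpha> i)"]
        vertex_cone.axioms(1))
  finally show ?thesis .
qed

text \<open>The total violation \<open>g\<close> of the constraints defining the face is continuous
  and everywhere positive, hence bounded below on a ball. Where every constraint is violated by at
  most \<open>r\<close>, it is at most \<open>r\<close> times the number of its terms.\<close>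

lemma nonface_separation:
  assumes "face_at u b S = {}"
  obtains r where "r > 0" "\<And>x. norm x \<le> \<rho> \<Longrightarrow> \<not> ((\<forall>i. u i \<bullet> x \<le> b i + r) \<and> (\<forall>i\<in>S. b i - r \<le> u i \<bullet> x))"
proof -
  define g where "g x = (\<Sum>i\<in>UNIV. max 0 (u i \<bullet> x - b i)) + (\<Sum>i\<in>S. max 0 (b i - u i \<bullet> x))" for x
  have pos: "g x > 0" for x
  proof (rule ccontr)
    assume "\<not> g x > 0"
    moreover have "(\<Sum>i\<in>UNIV. max 0 (u i \<bullet> x - b i)) \<ge> 0" "(\<Sum>i\<in>S. max 0 (b i - u i \<bullet> x)) \<ge> 0"
      by (auto intro!: sum_nonneg)
    ultimately have "(\<Sum>i\<in>UNIV. max 0 (u i \<bullet> x - b i)) = 0" "(\<Sum>i\<in>S. max 0 (b i - u i \<bullet> x)) = 0"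
      unfolding g_def by linarith+
    then have "\<forall>i. max 0 (u i \<bullet> x - b i) = 0" "\<forall>i\<in>S. max 0 (b i - u i \<bullet> x) = 0"
      by (subst (asm) sum_nonneg_eq_0_iff; simp)+
    then have "\<forall>i. u i \<bullet> x \<le> b i" "\<forall>i\<in>S. u i \<bullet> x \<ge> b i"
      by (metis diff_le_0_iff_le max.cobounded2)+
    then have "x \<in> face_at u b S"
      by (auto simp: face_at_def polyhedron_of_def intro: antisym)
    with assms show False
      by simp
  qed
  define B where "B = cball (0 :: real ^ 'n) \<bar>\<rho>\<bar>"
  have "continuous_on B g"
    unfolding g_def by (intro continuous_intros)
  moreover have "compact B" "B \<noteq> {}"
    by (auto simp: B_def)
  ultimately have "\<exists>y\<in>B. \<forall>x\<in>B. g y \<le> g x"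
    by (intro continuous_attains_inf)
  then obtain y where y: "\<And>x. x \<in> B \<Longrightarrow> g y \<le> g x"
    by blast
  \<comment> \<open>One more than the number of summands of \<open>g\<close>, to make the final
    inequality strict.\<close>
  define n where "n = real (card (UNIV :: 'd set)) + real (card S) + 1"
  have n: "n > 0"
    by (simp add: n_def)
  define q where "q = g y / n"
  have q: "q > 0" "n * q = g y"
    using pos n by (auto simp: q_def)
  show thesis
  proof (rule that[OF q(1)])
    fix x :: "real ^ 'n" assume "norm x \<le> \<rho>"
    then have "x \<in> B"
      by (simp add: B_def)
    show "\<not> ((\<forall>i. u i \<bullet> x \<le> b i + q) \<and> (\<forall>i\<in>S. b i - q \<le> u i \<bullet> x))"
    proof
      assume x: "(\<forall>i. u i \<bullet> x \<le> b i + q) \<and> (\<forall>i\<in>S. b i - q \<le> u i \<bullet> x)"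
      have "(\<Sum>i\<in>UNIV. max 0 (u i \<bullet> x - b i)) \<le> (\<Sum>i\<in>(UNIV :: 'd set). q)"
        using x q by (intro sum_mono) (auto simp: algebra_simps)
      moreover have "(\<Sum>i\<in>S. max 0 (b i - u i \<bullet> x)) \<le> (\<Sum>i\<in>S. q)"
        using x q by (intro sum_mono) (auto simp: algebra_simps)
      ultimately have "g x \<le> (n - 1) * q"
        by (simp add: g_def n_def distrib_right)
      also have "\<dots> < n * q"
        using q by (intro mult_strict_right_mono) auto
      also have "\<dots> = g y"
        by (rule q)
      finally show False
        using y[OF \<open>x \<in> B\<close>] by simp
    qed
  qed
qed

text \<open>There are finitely many sets \<open>S\<close>, so the smallest bound serves for all. The
  tolerance \<open>2 * r\<close> is that of \<open>facet_bump_support\<close>, and \<open>r\<close>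
  will be the largest shift of the polytope; this is why half the minimum is taken.\<close>

lemma uniform_nonface_separation:
  obtains r where "r > 0"
    "\<And>S x. face_at u b S = {} \<Longrightarrow> norm x \<le> \<rho> \<Longrightarrow> \<not> ((\<forall>i. u i \<bullet> x \<le> b i + r) \<and> (\<forall>i\<in>S. b i - 2 * r \<le> u i \<bullet> x))"
proof -
  have "\<forall>S. \<exists>r>0. face_at u b S = {} \<longrightarrow>
      (\<forall>x. norm x \<le> \<rho> \<longrightarrow> \<not> ((\<forall>i. u i \<bullet> x \<le> b i + r) \<and> (\<forall>i\<in>S. b i - r \<le> u i \<bullet> x)))"
  proof
    fix S
    show "\<exists>r>0. face_at u b S = {} \<longrightarrow>
      (\<forall>x. norm x \<le> \<rho> \<longrightarrow> \<not> ((\<forall>i. u i \<bullet> x \<le> b i + r) \<and> (\<forall>i\<in>S. b i - r \<le> u i \<bullet> x)))"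
    proof (cases "face_at u b S = {}")
      case True
      then show ?thesis
        by (rule nonface_separation[of S \<rho>]) blast
    qed (auto intro: exI[of _ 1])
  qed
  then obtain r where r: "\<And>S. r S > 0" "\<And>S x. face_at u b S = {} \<Longrightarrow> norm x \<le> \<rho>
      \<Longrightarrow> \<not> ((\<forall>i. u i \<bullet> x \<le> b i + r S) \<and> (\<forall>i\<in>S. b i - r S \<le> u i \<bullet> x))"
    by metis
  define m where "m = Min (range r)"
  have m: "m > 0" "m \<le> r S" for S
    using r(1) by (auto simp: m_def)
  show thesis
  proof
    show "m / 2 > 0"
      using m by simp
    fix S and x :: "real ^ 'n" assume S: "face_at u b S = {}" "norm x \<le> \<rho>"
    show "\<not> ((\<forall>i. u i \<bullet> x \<le> b i + m / 2) \<and> (\<forall>i\<in>S. b i - 2 * (m / 2) \<le> u i \<bullet> x))"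
    proof
      assume x: "(\<forall>i. u i \<bullet> x \<le> b i + m / 2) \<and> (\<forall>i\<in>S. b i - 2 * (m / 2) \<le> u i \<bullet> x)"
      have "u i \<bullet> x \<le> b i + r S" for i
        using conjunct1[OF x, rule_format, of i] m(1) m(2)[of S] by linarith
      moreover have "b i - r S \<le> u i \<bullet> x" if "i \<in> S" for i
        using conjunct2[OF x, rule_format, OF that] m(2)[of S] by linarith
      ultimately show False
        using r(2)[OF S] by blast
    qed
  qed
qed

end

section \<open>Expansions of the pieces and their sum\<close>

context simple_lattice_polytope
begin

abbreviation shifted :: "(real, 'd) vec \<Rightarrow> (real ^ 'n) set"
  where "shifted h \<equiv> polyhedron_of u (\<lambda>i. b i + h $ i)"

abbreviation scaled_points :: "nat \<Rightarrow> (real ^ 'n) set"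
  where "scaled_points N \<equiv> int_lattice \<inter> (\<lambda>x. real N *\<^sub>R x) ` \<Delta>"

lemma finite_scaled_points: "finite (scaled_points N)"
proof -
  have "bounded ((\<lambda>x. real N *\<^sub>R x) ` \<Delta>)"
    by (intro compact_imp_bounded compact_scaling compact_\<Delta>)
  then obtain B where "\<forall>k\<in>(\<lambda>x. real N *\<^sub>R x) ` \<Delta>. norm k \<le> B"
    by (auto simp: bounded_iff)
  then show ?thesis
    by (intro finite_subset[OF _ finite_int_lattice_bounded[of B]]) auto
qed

lemma in_scaled_points_iff:
  "N \<ge> 1 \<Longrightarrow> k \<in> scaled_points N \<longleftrightarrow> k \<in> int_lattice \<and> k /\<^sub>R real N \<in> \<Delta>"
  by (auto intro!: image_eqI[of k _ "k /\<^sub>R real N"])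

text \<open>\<open>G\<close> is a separate parameter, because the integral of a piece of
  \<open>f\<close> over the shifted polytope is identified only for small \<open>h\<close>, where it
  agrees with some \<open>G\<close> of class \<open>Ck M\<close>.\<close>

definition remainder :: "nat \<Rightarrow> (real ^ 'n \<Rightarrow> complex) \<Rightarrow> ((real, 'd) vec \<Rightarrow> complex) \<Rightarrow> nat \<Rightarrow> complex"
  where "remainder M f G N =
    1 / of_nat N ^ CARD('n) * (\<Sum>k\<in>scaled_points N. f (k /\<^sub>R real N))
    - (\<Sum>\<alpha> | sum \<alpha> UNIV < M.
        taylor_coeff (todd_symbol u b) \<alpha> * (1 / of_nat N ^ (sum \<alpha> UNIV)) * multi_deriv \<alpha> G 0)"

text \<open>Shifts by at most \<open>r\<close> cannot make the polytope reach the support of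
  \<open>g\<close>, so neither the integral nor the lattice sum sees it.\<close>

lemma expansion_away_from_polytope:
  assumes r: "r > 0" and supp: "\<And>x. g x \<noteq> 0 \<Longrightarrow> \<not> (\<forall>i. u i \<bullet> x \<le> b i + r)"
  shows "\<And>h. (\<And>i. \<bar>h $ i\<bar> \<le> r) \<Longrightarrow> integral (shifted h) g = 0"
    and "remainder M g (\<lambda>h. 0) = (\<lambda>N. 0)"
proof -
  show "integral (shifted h) g = 0" if h: "\<And>i. \<bar>h $ i\<bar> \<le> r" for h :: "(real, 'd) vec"
  proof -
    have "g x = 0" if x: "x \<in> shifted h" for x
    proof -
      have "u i \<bullet> x \<le> b i + r" for i
        using x h[of i] by (auto simp: polyhedron_of_def dest!: spec[of _ i])
      then show ?thesis
        using supp by blast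
    qed
    then have "integral (shifted h) g = integral (shifted h) (\<lambda>_. 0)"
      by (rule integral_cong)
    then show ?thesis
      by simp
  qed
  have g\<Delta>: "g x = 0" if "x \<in> \<Delta>" for x
  proof -
    have "u i \<bullet> x \<le> b i + r" for i
      using that r in_\<Delta>_iff[of x] by (auto dest!: spec[of _ i])
    then show ?thesis
      using supp by blast
  qed
  have g0: "(\<Sum>k\<in>scaled_points N. g (k /\<^sub>R real N)) = 0" if "N \<ge> 1" for N
    by (intro sum.neutral ballI g\<Delta>) (simp only: in_scaled_points_iff[OF that])
  have c: "1 / of_nat N ^ CARD('n) * (\<Sum>k\<in>scaled_points N. g (k /\<^sub>R real N)) = 0" for N
    using g0[of N] by (cases "N \<ge> 1") auto
  have m: "multi_deriv \<alpha> (\<lambda>h :: (real, 'd) vec. 0 :: complex) 0 = 0" for \<alpha>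
    using multi_deriv_sum[of "{} :: nat set" \<alpha> "\<lambda>_ _. 0 :: complex"] by (simp add: fun_eq_iff)
  show "remainder M g (\<lambda>h. 0) = (\<lambda>N. 0)"
    unfolding remainder_def c m by simp
qed

text \<open>On the support of \<open>g\<close> the constraints outside \<open>F\<close> hold with
  margin \<open>r\<close>, so there the polytope, even after shifts by at most \<open>r\<close>,
  coincides with the correspondingly shifted cone at \<open>v\<close>. Since \<open>N\<close> times
  \<open>v\<close> is a lattice point, moving \<open>v\<close> to the origin turns the lattice sum
  into that of \<open>cone_expansion\<close>.\<close>

lemma expansion_near_vertex:
  fixes g :: "real ^ 'n \<Rightarrow> complex"
  assumes F: "vertex_cone u F e" and v: "v \<in> int_lattice" "v \<in> \<Delta>" "\<And>i. i \<in> F \<Longrightarrow> u i \<bullet> v = b i"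
    and g: "Ck ((M + 2) * CARD('n)) g" "\<And>x. norm x > \<rho> \<Longrightarrow> g x = 0"
    and r: "r > 0" and supp: "\<And>x i. g x \<noteq> 0 \<Longrightarrow> i \<notin> F \<Longrightarrow> u i \<bullet> x < b i - r"
  shows "\<exists>\<delta>>0. \<exists>G. Ck M G \<and>
    (\<forall>h. (\<forall>i. \<bar>h $ i\<bar> \<le> \<delta>) \<longrightarrow> integral (shifted h) g = G h) \<and>
    remainder M g G \<in> O(\<lambda>N. 1 / of_nat N ^ M)"
proof -
  interpret vertex_cone u F e by fact
  define \<phi> where "\<phi> x = g (v + x)" for x
  have supp_\<phi>: "\<phi> x = 0" if "norm x > \<rho> + norm v" for x
    unfolding \<phi>_def using norm_triangle_ineq4[of "v + x" v] that by (intro g) auto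
  have Ck\<phi>: "Ck ((M + 2) * CARD('n)) \<phi>"
    unfolding \<phi>_def[abs_def] by (rule Ck_shift[OF g(1)])
  obtain \<delta> G where \<delta>: "\<delta> > 0" and G: "Ck M G"
    and int: "\<And>h. (\<And>i. \<bar>h $ i\<bar> \<le> \<delta>) \<Longrightarrow> integral {x. \<forall>i\<in>F. u i \<bullet> x \<le> h $ i} \<phi> = G h"
    and deriv0: "\<And>\<alpha> i. i \<notin> F \<Longrightarrow> \<alpha> i \<noteq> 0 \<Longrightarrow> multi_deriv \<alpha> G 0 = 0"
    and asymp: "(\<lambda>N. lattice_sum N \<phi> - (\<Sum>\<alpha> | sum \<alpha> UNIV < M.
            (\<Sum>a\<in>fract_coords u F. \<Prod>i\<in>UNIV. todd_coeff (unit_root a i) (\<alpha> i))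
              * (1 / of_nat N ^ (sum \<alpha> UNIV)) * multi_deriv \<alpha> G 0))
      \<in> O(\<lambda>N. 1 / of_nat N ^ M)"
    by (rule cone_expansion[OF Ck\<phi> supp_\<phi>]) blast+
  have cont: "continuous_on UNIV g"
    using Ck_imp_continuous[OF g(1)] .
  have integral: "integral (shifted h) g = G h"
    if h: "\<And>i. \<bar>h $ i\<bar> \<le> min \<delta> r" for h :: "(real, 'd) vec"
  proof -
    define P where "P = shifted h"
    have "closed P"
      using closed_halfspaces[of UNIV u] by (simp add: P_def polyhedron_of_def)
    then have PG: "integral P g = integral {x. v + x \<in> P} \<phi>"
      unfolding \<phi>_def by (intro integral_translation[OF cont g(2), symmetric])
    have P_iff: "v + x \<in> P \<longleftrightarrow> (\<forall>i\<in>F. u i \<bullet> x \<le> h $ i)" if "\<phi> x \<noteq> 0" for x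
    proof -
      have "u i \<bullet> (v + x) \<le> b i + h $ i" if "i \<notin> F" for i
      proof -
        have "u i \<bullet> (v + x) < b i - r"
          using that \<open>\<phi> x \<noteq> 0\<close> by (intro supp) (simp_all add: \<phi>_def)
        moreover have "- r \<le> h $ i"
          using h[of i] by (simp add: abs_le_iff)
        ultimately show ?thesis
          by linarith
      qed
      moreover have "u i \<bullet> (v + x) \<le> b i + h $ i \<longleftrightarrow> u i \<bullet> x \<le> h $ i" if "i \<in> F" for i
        using v(3)[OF that] by (simp add: inner_add_right)
      ultimately show ?thesis
        unfolding P_def polyhedron_of_def by blast
    qed
    have "(\<lambda>x. if x \<in> {x. v + x \<in> P} then \<phi> x else 0)
        = (\<lambda>x. if x \<in> {x. \<forall>i\<in>F. u i \<bullet> x \<le> h $ i} then \<phi> x else 0)"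
    proof
      fix x
      show "(if x \<in> {x. v + x \<in> P} then \<phi> x else 0)
          = (if x \<in> {x. \<forall>i\<in>F. u i \<bullet> x \<le> h $ i} then \<phi> x else 0)"
        using P_iff[of x] by (cases "\<phi> x = 0") auto
    qed
    from arg_cong[OF this, of "integral UNIV"]
    have "integral {x. v + x \<in> P} \<phi> = integral {x. \<forall>i\<in>F. u i \<bullet> x \<le> h $ i} \<phi>"
      by (simp only: integral_restrict_UNIV)
    also have "\<dots> = G h"
      using h by (intro int) simp
    finally show ?thesis
      using PG by (simp add: P_def)
  qed
  have sum_eq: "(\<Sum>k | k \<in> int_lattice \<and> k \<in> orthant \<and> \<phi> (k /\<^sub>R real N) \<noteq> 0. \<phi> (k /\<^sub>R real N))
      = (\<Sum>k\<in>scaled_points N. g (k /\<^sub>R real N))" if N: "N \<ge> 1" for N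
  proof -
    have Nv: "real N *\<^sub>R v \<in> int_lattice"
      using v(1) by (intro int_lattice_scale) auto
    have shift: "v + k /\<^sub>R real N = (real N *\<^sub>R v + k) /\<^sub>R real N" for k
      using N by (simp add: scaleR_add_right)
    have orth: "k \<in> orthant \<longleftrightarrow> v + k /\<^sub>R real N \<in> \<Delta>" if "\<phi> (k /\<^sub>R real N) \<noteq> 0" for k
    proof -
      have "u i \<bullet> (v + k /\<^sub>R real N) \<le> b i" if "i \<notin> F" for i
        using supp[of "v + k /\<^sub>R real N" i] that \<open>\<phi> (k /\<^sub>R real N) \<noteq> 0\<close> r by (simp add: \<phi>_def)
      moreover have "u i \<bullet> (v + k /\<^sub>R real N) \<le> b i \<longleftrightarrow> - u i \<bullet> k \<ge> 0" if "i \<in> F" for i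
        using v(3)[OF that] N by (simp add: inner_add_right mult_le_0_iff)
      ultimately show ?thesis
        unfolding in_\<Delta>_iff orthant_def by blast
    qed
    have "(\<Sum>k | k \<in> int_lattice \<and> k \<in> orthant \<and> \<phi> (k /\<^sub>R real N) \<noteq> 0. \<phi> (k /\<^sub>R real N))
        = (\<Sum>k\<in>{k \<in> scaled_points N. g (k /\<^sub>R real N) \<noteq> 0}. g (k /\<^sub>R real N))"
    proof (rule sum.reindex_bij_witness[where i = "\<lambda>k. k - real N *\<^sub>R v" and j = "\<lambda>k. real N *\<^sub>R v + k"])
      fix k assume k: "k \<in> {k. k \<in> int_lattice \<and> k \<in> orthant \<and> \<phi> (k /\<^sub>R real N) \<noteq> 0}"
      show "real N *\<^sub>R v + k \<in> {k \<in> scaled_points N. g (k /\<^sub>R real N) \<noteq> 0}"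
        using k orth[of k] Nv by (simp add: in_scaled_points_iff[OF N] \<phi>_def shift int_lattice_add del: Int_iff)
      show "g ((real N *\<^sub>R v + k) /\<^sub>R real N) = \<phi> (k /\<^sub>R real N)"
        by (simp add: \<phi>_def shift)
    next
      fix k assume k: "k \<in> {k \<in> scaled_points N. g (k /\<^sub>R real N) \<noteq> 0}"
      then have k': "k \<in> int_lattice" "k /\<^sub>R real N \<in> \<Delta>" "g (k /\<^sub>R real N) \<noteq> 0"
        by (simp_all add: in_scaled_points_iff[OF N] del: Int_iff)
      have eq: "v + (k - real N *\<^sub>R v) /\<^sub>R real N = k /\<^sub>R real N"
        by (simp add: shift)
      then have "\<phi> ((k - real N *\<^sub>R v) /\<^sub>R real N) \<noteq> 0"
        using k' by (simp add: \<phi>_def)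
      moreover from this have "k - real N *\<^sub>R v \<in> orthant"
        using orth eq k' by simp
      ultimately show "k - real N *\<^sub>R v \<in> {k. k \<in> int_lattice \<and> k \<in> orthant \<and> \<phi> (k /\<^sub>R real N) \<noteq> 0}"
        using k' Nv by (simp add: int_lattice_diff)
    qed auto
    also have "\<dots> = (\<Sum>k\<in>scaled_points N. g (k /\<^sub>R real N))"
      using finite_scaled_points by (intro sum.mono_neutral_left) auto
    finally show ?thesis .
  qed
  \<comment> \<open>If \<open>\<alpha>\<close> is nonzero somewhere outside \<open>F\<close>, the
    derivative of \<open>G\<close> makes both sides 0; otherwise the Todd symbol has the coefficient
    computed from the vertex group.\<close>
  have coeff: "(\<Sum>a\<in>fract_coords u F. \<Prod>i\<in>UNIV. todd_coeff (unit_root a i) (\<alpha> i)) * x * multi_deriv \<alpha> G 0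
      = taylor_coeff (todd_symbol u b) \<alpha> * x * multi_deriv \<alpha> G 0" for \<alpha> x
  proof (cases "\<exists>i. i \<notin> F \<and> \<alpha> i \<noteq> 0")
    case True
    then show ?thesis
      using deriv0 by auto
  next
    case False
    then have "\<alpha> i = 0" if "i \<notin> F" for i
      using that by blast
    from taylor_coeff_todd_symbol_at_vertex[OF v(2,3) F this] show ?thesis
      by simp
  qed
  have "remainder M g G \<in> O(\<lambda>N. 1 / of_nat N ^ M)"
  proof (rule landau_o.big.in_cong[THEN iffD1, OF _ asymp], rule eventually_sequentiallyI[of 1])
    fix N :: nat assume "N \<ge> 1"
    then show "lattice_sum N \<phi> - (\<Sum>\<alpha> | sum \<alpha> UNIV < M.
            (\<Sum>a\<in>fract_coords u F. \<Prod>i\<in>UNIV. todd_coeff (unit_root a i) (\<alpha> i))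
              * (1 / of_nat N ^ (sum \<alpha> UNIV)) * multi_deriv \<alpha> G 0) = remainder M g G N"
      unfolding remainder_def lattice_sum_def sum_eq[OF \<open>N \<ge> 1\<close>] coeff by (simp only: power_one_over)
  qed
  with \<delta> r G integral show ?thesis
    by (intro exI[of _ "min \<delta> r"] conjI exI[of _ G]) auto
qed

text \<open>Each piece has its own function \<open>G S\<close>, equal to its integral for small
  \<open>h\<close>. Their sum equals the full integral on a neighbourhood of 0, which determines the
  derivatives at 0, and the \<open>G S\<close> are regular enough for differentiating the sum
  termwise.\<close>

lemma Euler_Maclaurin:
  assumes f: "smooth_compact_support f"
  shows "remainder M f (\<lambda>h. integral (shifted h) f) \<in> O(\<lambda>N. 1 / of_nat N ^ M)"
proof -
  \<comment> \<open>The regularity demanded by \<open>cone_expansion\<close>; the cutoffs are chosen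
    accordingly.\<close>
  define k where "k = (M + 2) * CARD('n)"
  have Ckf: "Ck k f"
    using f by (intro smooth_imp_Ck) (simp add: smooth_compact_support_def)
  have "bounded {x. f x \<noteq> 0}"
    using f by (auto simp: smooth_compact_support_def intro: bounded_subset[OF compact_imp_bounded closure_subset])
  then obtain \<rho> where \<rho>: "\<And>x. f x \<noteq> 0 \<Longrightarrow> norm x \<le> \<rho>"
    by (auto simp: bounded_iff)
  obtain r where r: "r > 0" "\<And>S x. face_at u b S = {} \<Longrightarrow> norm x \<le> \<rho>
      \<Longrightarrow> \<not> ((\<forall>i. u i \<bullet> x \<le> b i + r) \<and> (\<forall>i\<in>S. b i - 2 * r \<le> u i \<bullet> x))"
    by (rule uniform_nonface_separation[of \<rho>]) (rule that)
  define g where "g S x = f x * facet_bump k r u b S x" for S x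
  have Ckg: "Ck k (g S)" for S
    unfolding g_def[abs_def] by (intro Ck_mult Ckf Ck_facet_bump)
  have supp: "f x \<noteq> 0" "facet_bump k r u b S x \<noteq> 0" if "g S x \<noteq> 0" for S x
    using that by (auto simp: g_def)
  have g0: "g S x = 0" if "norm x > \<rho>" for S x
    using \<rho>[of x] that by (auto simp: g_def)
  have f_eq: "f x = (\<Sum>S\<in>UNIV. g S x)" for x
    by (simp add: g_def sum_facet_bump flip: sum_distrib_left)
  define good where "good S \<delta> G \<longleftrightarrow> \<delta> > 0 \<and> Ck M G \<and>
    (\<forall>h. (\<forall>i. \<bar>h $ i\<bar> \<le> \<delta>) \<longrightarrow> integral (shifted h) (g S) = G h) \<and>
    remainder M (g S) G \<in> O(\<lambda>N. 1 / of_nat N ^ M)" for S \<delta> G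
  have "\<exists>\<delta> G. good S \<delta> G" for S
  proof (cases "face_at u b S = {}")
    case True
    have sep: "\<not> (\<forall>i. u i \<bullet> x \<le> b i + r)" if "g S x \<noteq> 0" for x
      using r(2)[OF True \<rho>[OF supp(1)[OF that]]] facet_bump_support(1)[OF supp(2)[OF that] r(1)]
      by (auto intro: less_imp_le)
    have "remainder M (g S) (\<lambda>h. 0) = (\<lambda>N. 0)"
      by (rule expansion_away_from_polytope(2)[OF r(1) sep])
    then have "remainder M (g S) (\<lambda>h. 0) \<in> O(\<lambda>N. 1 / of_nat N ^ M)"
      by (auto intro: bigoI[of _ 0])
    then have "good S r (\<lambda>h. 0)"
      unfolding good_def using r(1) expansion_away_from_polytope(1)[OF r(1) sep] by simp
    then show ?thesis
      by blast
  next
    case False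
    then show ?thesis
    proof (rule vertex_exists)
      fix v F e
      assume F: "S \<subseteq> F" "v \<in> int_lattice" "\<And>i. i \<in> F \<Longrightarrow> u i \<bullet> v = b i" "v \<in> \<Delta>" "vertex_cone u F e"
      have "\<exists>\<delta>>0. \<exists>G. Ck M G \<and>
        (\<forall>h. (\<forall>i. \<bar>h $ i\<bar> \<le> \<delta>) \<longrightarrow> integral (shifted h) (g S) = G h) \<and>
        remainder M (g S) G \<in> O(\<lambda>N. 1 / of_nat N ^ M)"
      proof (rule expansion_near_vertex[OF F(5,2,4,3) Ckg[unfolded k_def] g0 r(1)])
        show "u i \<bullet> x < b i - r" if "g S x \<noteq> 0" "i \<notin> F" for x i
          using facet_bump_support(2)[OF supp(2)[OF that(1)] r(1)] that(2) F(1) by blast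
      qed
      then show ?thesis
        unfolding good_def by blast
    qed
  qed
  then obtain \<delta> G where good: "\<And>S. good S (\<delta> S) (G S)"
    by metis
  have \<delta>: "\<delta> S > 0" and G: "Ck M (G S)" and O: "remainder M (g S) (G S) \<in> O(\<lambda>N. 1 / of_nat N ^ M)" for S
    using good[of S] by (simp_all add: good_def)
  have int: "integral (shifted h) (g S) = G S h" if "\<forall>i. \<bar>h $ i\<bar> \<le> \<delta> S" for S and h :: "(real, 'd) vec"
    using good[of S] that unfolding good_def by blast
  define \<delta>' where "\<delta>' = Min (range \<delta>)"
  have \<delta>': "\<delta>' > 0" "\<delta>' \<le> \<delta> S" for S
    using \<delta> by (auto simp: \<delta>'_def)
  define U where "U = {h :: (real, 'd) vec. \<forall>i. \<bar>h $ i\<bar> < \<delta>'}"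
  have "U = (\<Inter>i. {h. \<bar>h $ i\<bar> < \<delta>'})"
    by (auto simp: U_def)
  then have U: "open U" "0 \<in> U"
    using \<delta>' by (auto simp: U_def intro!: open_INT open_Collect_less continuous_intros)
  define H where "H h = integral (shifted h) f" for h :: "(real, 'd) vec"
  have H: "H h = (\<Sum>S\<in>UNIV. G S h)" if "h \<in> U" for h
  proof -
    have "closed (shifted h)"
      using closed_halfspaces[of UNIV u] by (simp add: polyhedron_of_def)
    then have "(g S) integrable_on shifted h" for S
      by (intro integrable_compact_support[OF Ck_imp_continuous[OF Ckg] g0])
    then have "H h = (\<Sum>S\<in>UNIV. integral (shifted h) (g S))"
      unfolding H_def f_eq by (intro integral_sum) auto
    also have "\<dots> = (\<Sum>S\<in>UNIV. G S h)"
    proof (intro sum.cong refl int allI)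
      fix S i
      show "\<bar>h $ i\<bar> \<le> \<delta> S"
        using that \<delta>'(2)[of S] by (auto simp: U_def intro: less_imp_le less_le_trans)
    qed
    finally show ?thesis .
  qed
  have deriv: "multi_deriv \<alpha> H 0 = (\<Sum>S\<in>UNIV. multi_deriv \<alpha> (G S) 0)" if "sum \<alpha> UNIV < M" for \<alpha>
  proof -
    have "multi_deriv \<alpha> H 0 = multi_deriv \<alpha> (\<lambda>h. \<Sum>S\<in>UNIV. G S h) 0"
      by (rule multi_deriv_cong_open[OF U(1) H U(2)])
    also have "\<dots> = (\<Sum>S\<in>UNIV. multi_deriv \<alpha> (G S) 0)"
      using that by (subst multi_deriv_sum) (auto intro: Ck_mono[OF G])
    finally show ?thesis .
  qed
  have "remainder M f H N = (\<Sum>S\<in>UNIV. remainder M (g S) (G S) N)" for N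
  proof -
    have "1 / of_nat N ^ CARD('n) * (\<Sum>k\<in>scaled_points N. f (k /\<^sub>R real N))
        = (\<Sum>S\<in>UNIV. 1 / of_nat N ^ CARD('n) * (\<Sum>k\<in>scaled_points N. g S (k /\<^sub>R real N)))"
      unfolding sum_distrib_left[symmetric] by (subst sum.swap) (simp add: f_eq)
    moreover have "(\<Sum>\<alpha> | sum \<alpha> UNIV < M.
        taylor_coeff (todd_symbol u b) \<alpha> * (1 / of_nat N ^ (sum \<alpha> UNIV)) * multi_deriv \<alpha> H 0)
      = (\<Sum>S\<in>UNIV. \<Sum>\<alpha> | sum \<alpha> UNIV < M.
        taylor_coeff (todd_symbol u b) \<alpha> * (1 / of_nat N ^ (sum \<alpha> UNIV)) * multi_deriv \<alpha> (G S) 0)"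
      by (subst sum.swap) (intro sum.cong refl, simp only: mem_Collect_eq deriv sum_distrib_left)
    ultimately show ?thesis
      by (simp only: remainder_def sum_subtractf)
  qed
  then have "remainder M f H = (\<lambda>N. \<Sum>S\<in>UNIV. remainder M (g S) (G S) N)"
    by blast
  then show ?thesis
    unfolding H_def[abs_def, symmetric] using big_sum_in_bigo[OF O] by simp
qed

end

theorem theorem4p2:
  fixes \<Delta> :: "(real ^ 'n) set"
    and u :: "'d::{finite,linorder} \<Rightarrow> real ^ 'n"
    and c :: "'d \<Rightarrow> int"
    and f :: "real ^ 'n \<Rightarrow> complex"
  assumes "lattice_polytope \<Delta>"
    and "simple_polytope \<Delta>"
    and "aff_dim \<Delta> = int CARD('n)"
    and "\<Delta> = polyhedron_of u (\<lambda>i. real_of_int (c i))"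
    and "bij_betw (\<lambda>i. {x \<in> \<Delta>. u i \<bullet> x = real_of_int (c i)}) UNIV {S. S facet_of \<Delta>}"
    and "\<And>i. primitive_vector (u i)"
    and "smooth_compact_support f"
  shows "\<forall>M::nat.
    (\<lambda>N::nat.
        1 / of_nat N ^ CARD('n) *
          (\<Sum>k \<in> int_lattice \<inter> (\<lambda>x. real N *\<^sub>R x) ` \<Delta>. f (k /\<^sub>R real N))
      - (\<Sum>\<alpha> | (\<Sum>i\<in>UNIV. \<alpha> i) < M.
          taylor_coeff (todd_symbol u (\<lambda>i. real_of_int (c i))) \<alpha>
          * (1 / of_nat N ^ (\<Sum>i\<in>UNIV. \<alpha> i))
          * multi_deriv \<alpha>
              (\<lambda>h::real ^ 'd::{finite,linorder}.
                integral (polyhedron_of u (\<lambda>i. real_of_int (c i) + h $ i)) f) 0))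
    \<in> O(\<lambda>N. 1 / of_nat N ^ M)"
proof -
  interpret simple_lattice_polytope \<Delta> u c
    by unfold_locales (fact assms)+
  show ?thesis
    using Euler_Maclaurin[OF assms(7)] by (simp only: remainder_def[abs_def]) blast
qed

end
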